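(* There exists $d_0>0$ such that for every real number $d\ge d_0$ the following holds. If $k$ is a positive integer and $C_1,\dots,C_k$ are measurable subsets of the hyperbolic plane $\mathbb{H}$ such that $\mathbb{H}=\bigcup_{i=1}^k C_i$ and such that no $C_i$ contains a pair of points at hyperbolic distance exactly $d$, then $k\ge 6$.
   Context: $\mathbb{H}$ denotes the hyperbolic plane of constant sectional curvature $-1$, with its hyperbolic distance. Measurability is with respect to the isometry-invariant (Haar) measure on $\mathbb{H}$, i.e. the hyperbolic area measure. In the Poincaré disk model $D=\{z=x+iy\in\mathbb{C} : |z|<1\}$ this measure is $dz=4(1-x^2-y^2)^{-2}\,dx\,dy$, and the distance from the origin to $z\in D$ is $\ln\frac{1+|z|}{1-|z|}$. *)

theory Defs
  imports "HOL-Analysis.Analysis"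
begin

definition hyp_plane :: "complex set" where
  "hyp_plane = {z. norm z < 1}"

(* The Moebius automorphism w |-> (w - z) / (1 - cnj z * w) of the disk sends z to 0, so the
   formula for the distance from the origin determines all distances. *)
definition hyp_dist :: "complex \<Rightarrow> complex \<Rightarrow> real" where
  "hyp_dist z w =
     (let t = norm ((w - z) / (1 - cnj z * w)) in ln ((1 + t) / (1 - t)))"

(* Based on lebesgue rather than lborel, so that the measurable sets are those of the
   completed area measure. *)
definition hyp_area :: "complex measure" where
  "hyp_area = density (lebesgue_on hyp_plane)
     (\<lambda>z. ennreal (4 / (1 - (Re z)\<^sup>2 - (Im z)\<^sup>2)\<^sup>2))"

lemma hyp_dist_0: "hyp_dist 0 z = ln ((1 + norm z) / (1 - norm z))"
  by (simp add: hyp_dist_def Let_def)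

lemma hyp_dist_commute: "hyp_dist z w = hyp_dist w z"
proof -
  have "norm (1 - cnj z * w) = norm (1 - cnj w * z)"
    using complex_mod_cnj[of "1 - cnj z * w"] by (simp add: mult.commute)
  then show ?thesis
    by (simp add: hyp_dist_def norm_divide norm_minus_commute)
qed

lemma space_hyp_area: "space hyp_area = hyp_plane"
  by (simp add: hyp_area_def)

lemma sets_hyp_area: "C \<in> sets hyp_area \<longleftrightarrow> C \<in> sets lebesgue \<and> C \<subseteq> hyp_plane"
proof -
  have "hyp_plane = ball 0 1"
    by (simp add: hyp_plane_def set_eq_iff)
  moreover have "ball (0::complex) 1 \<in> sets lebesgue"
    by (rule fmeasurableD[OF lmeasurable_ball])
  ultimately have "hyp_plane \<inter> space lebesgue \<in> sets lebesgue"
    by simp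
  then show ?thesis
    by (simp add: hyp_area_def sets_restrict_space_iff conj_commute)
qed

end

theory Submission
  imports Defs "HOL-Probability.Probability"
begin

text \<open>
  In half-plane coordinates, two points at heights y and y' lie at distance d if and only if their
  horizontal offset X satisfies X^2 = 2 cosh(d) y y' - y^2 - y'^2. Take strips a = 0, 1, ..., A - 1, where
  strip a consists of the points of height q^(2a) u with u in [1, 2], for a huge constant q. The
  edges of length d between strips a and b give a bilinear form \<open>beta\<close> that shifts the
  horizontal coordinate by X, where X is of order e^(d/2) q^(a+b): its order of magnitude depends on a + b only.

  Such a shift acts as the identity on functions of horizontal frequency much lower than 1 / X. On
  frequencies much higher than 1 / X the form is negligible, since X varies with u and the
  oscillation cancels; this is where measurability enters. Hence, decomposing functions by scale
  \<open>c\<close> with averages over nested cells, the sum of the forms over all pairs of strips with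
  |a - b| \<open>\<le>\<close> n reduces at each scale to the matrix with entries 1 where |a - b| \<open>\<le>\<close> n and
  a + b < c, up to one diagonal term. A reflection principle bounds the least eigenvalue of that
  matrix by the minimum of the Dirichlet kernel, about -0.217 (2n + 1), while constant functions see
  about 2n + 1. Hoffman's ratio bound then yields k - 1 > 4.
\<close>

section \<open>Averages over cells\<close>

text \<open>The scales are spaced by a huge ratio, so for a pair of strips (a, b) only one scale, c
  = a + b, is neither fine nor coarse compared with the offset. On that scale the form is controlled
  by Cauchy-Schwarz alone. But for fixed a the scales a + b are pairwise distinct, so by Bessel's
  inequality these middle parts cost, over a whole row, a single unit of \<open>ip\<close>. This is
  what wide bands buy: for n = 150 the unit is small against 2n + 1 = 301. The numbers have to
  satisfy 4 * (0.245 * 301 + 1) = 298.98 < 301, and the gap must also absorb the incomplete boundary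
  rows, a fraction 300 / A, and an error proportional to \<delta> for each of A^2 pairs. So the
  parameters are chosen in the order n, A, \<delta>, then q in terms of \<delta>, and last the lower
  bound 100 * q^300 for \<kappa> = 2 cosh d, which lets the mixed term \<kappa> u v dominate the
  offset throughout the band |a - b| \<le> 150. No choice depends on d or on the colouring, so one
  d0 serves all.\<close>

definition bounded_support :: "real \<Rightarrow> real \<Rightarrow> (real \<Rightarrow> real) \<Rightarrow> bool" where
  "bounded_support B S F \<longleftrightarrow> F \<in> borel_measurable borel \<and> (\<forall>x. \<bar>F x\<bar> \<le> B) \<and> (\<forall>x. S < \<bar>x\<bar> \<longrightarrow> F x = 0)"

text \<open>The interval [L j, L j + L) of the grid of step L that contains x. Being half-open, the
  cells partition the line, and refine each other when the steps are integer multiples.\<close>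

definition cell :: "real \<Rightarrow> real \<Rightarrow> real set" where
  "cell L x = {y. \<lfloor>y / L\<rfloor> = \<lfloor>x / L\<rfloor>}"

text \<open>Conditional expectation onto the grid of step L. It plays the role of a Fourier cutoff
  at frequency 1 / L.\<close>

definition cell_avg :: "real \<Rightarrow> (real \<Rightarrow> real) \<Rightarrow> real \<Rightarrow> real" where
  "cell_avg L F x = (\<integral>y. F y * indicator (cell L x) y \<partial>lborel) / L"

lemma bounded_supportD:
  assumes "bounded_support B S F"
  shows "F \<in> borel_measurable borel" "\<bar>F x\<bar> \<le> B" "S < \<bar>x\<bar> \<Longrightarrow> F x = 0" "0 \<le> B"
  using assms unfolding bounded_support_def
  by (auto intro: order_trans[OF abs_ge_zero])

lemma bounded_support_mono:
  assumes "bounded_support B S F" "B \<le> B'" "S \<le> S'"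
  shows "bounded_support B' S' F"
  using assms unfolding bounded_support_def by (auto intro: order_trans)

lemma bounded_support_bound:
  assumes "bounded_support B S F"
  shows "\<bar>F x\<bar> \<le> B * indicator {-S..S} x"
  using bounded_supportD(2,3)[OF assms, of x] by (auto simp: indicator_def abs_le_iff)

lemma bounded_support_integrable:
  assumes "bounded_support B S F"
  shows "integrable lborel F"
proof (rule Bochner_Integration.integrable_bound)
  show "integrable lborel (\<lambda>x. B * indicator {-S..S} x :: real)"
    by (intro integrable_mult_right integrable_real_indicator) (auto simp: emeasure_lborel_Icc_eq)
  show "AE x in lborel. norm (F x) \<le> norm (B * indicator {-S..S} x)"
    using bounded_support_bound[OF assms] by (auto simp: abs_le_iff intro!: AE_I2 order_trans[OF _ abs_ge_self])
qed (use bounded_supportD[OF assms] in auto)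

lemma integral_bounded_support:
  assumes "bounded_support B S F" "0 \<le> S"
  shows "\<bar>\<integral>x. F x \<partial>lborel\<bar> \<le> B * (2 * S)"
proof -
  have "\<bar>\<integral>x. F x \<partial>lborel\<bar> \<le> (\<integral>x. \<bar>F x\<bar> \<partial>lborel)"
    by (rule integral_abs_bound)
  also have "\<dots> \<le> (\<integral>x. B * indicator {-S..S} x \<partial>lborel)"
    using bounded_support_bound[OF assms(1)]
    by (intro integral_mono integrable_abs bounded_support_integrable[OF assms(1)]
        integrable_mult_right integrable_real_indicator) (auto simp: emeasure_lborel_Icc_eq)
  also have "\<dots> = B * (2 * S)"
    using assms(2) by (simp add: measure_def)
  finally show ?thesis .
qed

lemma bounded_support_mult:
  assumes "bounded_support B S F" "G \<in> borel_measurable borel" "\<And>x. \<bar>G x\<bar> \<le> B'"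
  shows "bounded_support (B * B') S (\<lambda>x. F x * G x)"
  using bounded_supportD[OF assms(1)] assms(2,3) unfolding bounded_support_def
  by (auto simp: abs_mult intro!: mult_mono)

lemma lborel_integral_shift:
  fixes F :: "real \<Rightarrow> real"
  shows "(\<integral>x. F (x + c) \<partial>lborel) = (\<integral>x. F x \<partial>lborel)"
  using lborel_integral_real_affine[of 1 F c] by (simp add: add.commute)

lemma cell_eq:
  assumes "L > 0"
  shows "cell L x = {L * \<lfloor>x / L\<rfloor> ..< L * \<lfloor>x / L\<rfloor> + L}"
proof -
  have "\<lfloor>y / L\<rfloor> = k \<longleftrightarrow> L * k \<le> y \<and> y < L * k + L" for y k
    using assms by (simp add: floor_eq_iff field_simps)
  then show ?thesis unfolding cell_def by auto
qed

lemma cell_sym: "y \<in> cell L x \<longleftrightarrow> x \<in> cell L y"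
  by (auto simp: cell_def)

lemma cell_borel [measurable]: "L > 0 \<Longrightarrow> cell L x \<in> sets borel"
  by (simp add: cell_eq)

lemma emeasure_cell: "L > 0 \<Longrightarrow> emeasure lborel (cell L x) = ennreal L"
  by (simp add: cell_eq)

lemma measure_cell: "L > 0 \<Longrightarrow> measure lborel (cell L x) = L"
  by (simp add: cell_eq)

lemma cell_dist: "L > 0 \<Longrightarrow> y \<in> cell L x \<Longrightarrow> \<bar>y - x\<bar> \<le> L"
proof -
  assume L: "L > 0" and y: "y \<in> cell L x"
  have "x \<in> cell L x" by (simp add: cell_def)
  then show ?thesis using y unfolding cell_eq[OF L] by auto
qed

lemma abs_cell_avg_le:
  assumes L: "L > 0" and "\<And>x. \<bar>F x\<bar> \<le> B"
  shows "\<bar>cell_avg L F x\<bar> \<le> B"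
proof -
  have "\<bar>\<integral>y. F y * indicator (cell L x) y \<partial>lborel\<bar> \<le> (\<integral>y. \<bar>F y * indicator (cell L x) y\<bar> \<partial>lborel)"
    by (rule integral_abs_bound)
  also have "\<dots> \<le> (\<integral>y. B * indicator (cell L x) y \<partial>lborel)"
    using assms(2) order_trans[OF abs_ge_zero assms(2)] L
    by (intro integral_mono' integrable_mult_right integrable_real_indicator)
       (auto simp: emeasure_cell abs_mult indicator_def)
  also have "\<dots> = B * L"
    using L by (simp add: measure_cell)
  finally show ?thesis using L by (simp add: cell_avg_def field_simps)
qed

lemma cell_avg_support:
  assumes L: "L > 0" and "\<And>x. S < \<bar>x\<bar> \<Longrightarrow> F x = 0" "S + L < \<bar>x\<bar>"
  shows "cell_avg L F x = 0"
proof -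
  have "(\<lambda>y. F y * indicator (cell L x) y) = (\<lambda>_. 0)"
  proof
    show "F y * indicator (cell L x) y = 0" for y
      using cell_dist[OF L, of y x] assms(2)[of y] assms(3) by (cases "y \<in> cell L x") auto
  qed
  then show ?thesis unfolding cell_avg_def by (simp only: integral_zero div_0)
qed

lemma bounded_support_cell_avg:
  assumes L: "L > 0" and F: "bounded_support B S F"
  shows "bounded_support B (S + L) (cell_avg L F)"
proof -
  note [measurable] = bounded_supportD(1)[OF F]
  have "cell_avg L F \<in> borel_measurable borel"
    unfolding cell_avg_def cell_def indicator_def by measurable
  then show ?thesis
    unfolding bounded_support_def
    using abs_cell_avg_le[OF L, of F B] cell_avg_support[OF L, of S F] bounded_supportD[OF F] by blast
qed

lemma cell_avg_cong_cell: "y \<in> cell L x \<Longrightarrow> cell_avg L F y = cell_avg L F x"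
  by (simp add: cell_avg_def cell_def)

lemma cell_avg_of_const:
  assumes L: "L > 0" and "\<And>y. y \<in> cell L x \<Longrightarrow> F y = c"
  shows "cell_avg L F x = c"
proof -
  have "(\<integral>y. F y * indicator (cell L x) y \<partial>lborel) = (\<integral>y. c * indicator (cell L x) y \<partial>lborel)"
    using assms(2) by (intro Bochner_Integration.integral_cong) (auto simp: indicator_def)
  then show ?thesis using L by (simp add: cell_avg_def measure_cell)
qed

text \<open>Nesting requires an integer ratio of the steps, which is why the ratio q of consecutive
  scales is a natural number.\<close>

lemma cell_subset_multiple:
  assumes "L > 0" "m > 0" 
  shows "cell L x \<subseteq> cell (real m * L) x"
proof
  fix y assume "y \<in> cell L x"
  moreover have "\<lfloor>z / (real m * L)\<rfloor> = \<lfloor>z / L\<rfloor> div int m" for z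
    using floor_divide_real_eq_div[of "int m" "z / L"] by (simp add: field_simps)
  ultimately show "y \<in> cell (real m * L) x" by (simp add: cell_def)
qed

lemma cell_avg_coarse:
  assumes "L > 0" "m > 0"
  shows "cell_avg L (cell_avg (real m * L) F) = cell_avg (real m * L) F"
  using cell_subset_multiple[OF assms] assms(1)
  by (intro ext cell_avg_of_const cell_avg_cong_cell) auto

text \<open>Fubini, since the averaging kernel \<open>indicator (cell L x) y / L\<close> is
  symmetric in x and y.\<close>

lemma cell_avg_selfadjoint:
  assumes L: "L > 0" and F: "bounded_support B S F" and G: "bounded_support B' S' G"
  shows "(\<integral>x. cell_avg L F x * G x \<partial>lborel) = (\<integral>x. F x * cell_avg L G x \<partial>lborel)"
proof -
  note [measurable] = bounded_supportD(1)[OF F] bounded_supportD(1)[OF G]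
  let ?h = "\<lambda>x y. F y * indicator (cell L x) y * G x"
  have "integrable (lborel \<Otimes>\<^sub>M lborel) (\<lambda>(x, y). ?h x y)"
  proof (rule Bochner_Integration.integrable_bound)
    have "emeasure (lborel \<Otimes>\<^sub>M lborel) ({-S'..S'} \<times> {-S..S}) < \<infinity>"
      by (subst lborel.emeasure_pair_measure_Times) (auto simp: emeasure_lborel_Icc_eq ennreal_mult_less_top)
    then show "integrable (lborel \<Otimes>\<^sub>M lborel) (\<lambda>p. (B * B') * indicator ({-S'..S'} \<times> {-S..S}) p :: real)"
      by (intro integrable_mult_right integrable_real_indicator) auto
    show "AE p in lborel \<Otimes>\<^sub>M lborel. norm (case p of (x, y) \<Rightarrow> ?h x y)
        \<le> norm ((B * B') * indicator ({-S'..S'} \<times> {-S..S}) p :: real)"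
    proof (rule AE_I2, clarify)
      fix x y :: real
      have "\<bar>F y\<bar> * \<bar>G x\<bar> \<le> (B * indicator {-S..S} y) * (B' * indicator {-S'..S'} x)"
        by (intro mult_mono bounded_support_bound[OF F] bounded_support_bound[OF G])
           (use bounded_supportD(4)[OF F] in \<open>auto simp: indicator_def\<close>)
      then show "norm (?h x y) \<le> norm ((B * B') * indicator ({-S'..S'} \<times> {-S..S}) (x, y) :: real)"
        using bounded_supportD(4)[OF F] bounded_supportD(4)[OF G]
        by (auto simp: indicator_def abs_mult split: if_splits)
    qed
    show "(\<lambda>(x, y). ?h x y) \<in> borel_measurable (lborel \<Otimes>\<^sub>M lborel)"
      unfolding cell_def indicator_def by measurable
  qed
  then have "(\<integral>y. \<integral>x. ?h x y \<partial>lborel \<partial>lborel) = (\<integral>x. \<integral>y. ?h x y \<partial>lborel \<partial>lborel)"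
    by (rule lborel_pair.Fubini_integral)
  moreover have "(\<integral>x. ?h x y \<partial>lborel) = L * (F y * cell_avg L G y)" for y
  proof -
    have "(\<integral>x. ?h x y \<partial>lborel) = (\<integral>x. F y * (G x * indicator (cell L y) x) \<partial>lborel)"
      by (intro Bochner_Integration.integral_cong) (auto simp: indicator_def cell_sym)
    then show ?thesis using L by (simp add: cell_avg_def)
  qed
  moreover have "(\<integral>y. ?h x y \<partial>lborel) = L * (cell_avg L F x * G x)" for x
    using L by (simp add: cell_avg_def)
  ultimately have "L * (\<integral>x. F x * cell_avg L G x \<partial>lborel) = L * (\<integral>x. cell_avg L F x * G x \<partial>lborel)"
    by (simp only: integral_mult_right_zero)
  then show ?thesis using L by simp
qed

text \<open>
  Averaging is self-adjoint, so it can be moved to the indicator of the interval, which it changes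
  only on the two cells that contain the end points.
\<close>

lemma integral_cell_avg_error:
  assumes L: "L > 0" and G: "bounded_support B S G"
  shows "\<bar>\<integral>x. indicator {a..b} x * (G x - cell_avg L G x) \<partial>lborel\<bar> \<le> 4 * L * B"
proof -
  let ?I = "indicator {a..b} :: real \<Rightarrow> real"
  have I: "bounded_support 1 (max \<bar>a\<bar> \<bar>b\<bar>) ?I"
    by (auto simp: bounded_support_def indicator_def)
  note AI = bounded_support_cell_avg[OF L I] and AG = bounded_support_cell_avg[OF L G]
  note [measurable] = bounded_supportD(1)[OF I] bounded_supportD(1)[OF G] bounded_supportD(1)[OF AI] bounded_supportD(1)[OF AG]
  have int: "integrable lborel (\<lambda>x. ?I x * G x)" "integrable lborel (\<lambda>x. ?I x * cell_avg L G x)"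
    "integrable lborel (\<lambda>x. cell_avg L ?I x * G x)"
    by (rule bounded_support_integrable bounded_support_mult[OF I] bounded_support_mult[OF AI]
        bounded_supportD(1)[OF G] bounded_supportD(1)[OF AG] bounded_supportD(2)[OF G] bounded_supportD(2)[OF AG])+
  have "(\<integral>x. ?I x * (G x - cell_avg L G x) \<partial>lborel)
      = (\<integral>x. ?I x * G x \<partial>lborel) - (\<integral>x. ?I x * cell_avg L G x \<partial>lborel)"
    using int by (simp add: right_diff_distrib)
  also have "\<dots> = (\<integral>x. ?I x * G x \<partial>lborel) - (\<integral>x. cell_avg L ?I x * G x \<partial>lborel)"
    by (simp add: cell_avg_selfadjoint[OF L I G])
  also have "\<dots> = (\<integral>x. (?I x - cell_avg L ?I x) * G x \<partial>lborel)"
    using int by (simp add: left_diff_distrib)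
  finally have eq: "(\<integral>x. ?I x * (G x - cell_avg L G x) \<partial>lborel) = \<dots>" .
  have pt: "\<bar>?I x - cell_avg L ?I x\<bar> \<le> 2 * indicator (cell L a) x + 2 * indicator (cell L b) x" for x
  proof (cases "x \<in> cell L a \<or> x \<in> cell L b")
    case True
    have "\<bar>?I x - cell_avg L ?I x\<bar> \<le> 2"
      using bounded_supportD(2)[OF AI, of x] bounded_supportD(2)[OF I, of x] by linarith
    then show ?thesis using True by (auto simp: indicator_def)
  next
    case False
    then have *: "a \<notin> cell L x" "b \<notin> cell L x" by (auto simp: cell_sym)
    have x: "x \<in> cell L x" by (simp add: cell_def)
    have "?I y = ?I x" if "y \<in> cell L x" for y
      using * x that unfolding cell_eq[OF L] by (auto simp: indicator_def)
    then show ?thesis using cell_avg_of_const[OF L, of x ?I "?I x"] by simp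
  qed
  have "\<bar>\<integral>x. (?I x - cell_avg L ?I x) * G x \<partial>lborel\<bar> \<le> (\<integral>x. \<bar>(?I x - cell_avg L ?I x) * G x\<bar> \<partial>lborel)"
    by (rule integral_abs_bound)
  also have "\<dots> \<le> (\<integral>x. (2 * indicator (cell L a) x + 2 * indicator (cell L b) x) * B \<partial>lborel)"
  proof (rule integral_mono')
    show "integrable lborel (\<lambda>x. (2 * indicator (cell L a) x + 2 * indicator (cell L b) x) * B)"
      using L by (intro integrable_mult_left Bochner_Integration.integrable_add integrable_mult_right integrable_real_indicator)
        (auto simp: emeasure_cell)
    show "\<bar>(?I x - cell_avg L ?I x) * G x\<bar> \<le> (2 * indicator (cell L a) x + 2 * indicator (cell L b) x) * B" for x
      using pt[of x] bounded_supportD(2)[OF G, of x] by (simp add: abs_mult mult_mono)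
    show "0 \<le> (2 * indicator (cell L a) x + 2 * indicator (cell L b) x) * B" for x
      using bounded_supportD(4)[OF G] by simp
  qed
  also have "\<dots> = 4 * L * B"
    using L by (simp add: Bochner_Integration.integral_add emeasure_cell measure_cell)
  finally show ?thesis unfolding eq .
qed

text \<open>The difference of floors counts the grid points in (x, x + X], that is, where a function
  constant on cells may jump. After translating the first floor, the two integrals cancel on the
  overlap of [-S, S] and [X - S, X + S]; two end intervals of length X remain, on which the floor is
  of size S / L.\<close>

lemma integral_floor_shift:
  fixes X L S :: real
  assumes L: "L > 0" and X: "0 \<le> X" and S: "0 \<le> S"
  shows "(\<integral>x. indicator {-S..S} x * real_of_int (\<lfloor>(x + X) / L\<rfloor> - \<lfloor>x / L\<rfloor>) \<partial>lborel) \<le> X * (2 * S + X + L) / L"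
proof -
  let ?f = "\<lambda>x. real_of_int \<lfloor>x / L\<rfloor>"
  have fb: "x / L - 1 \<le> ?f x" "?f x \<le> x / L" for x by linarith+
  have int: "integrable lborel (\<lambda>x. indicator {a..b} x * ?f x)" for a b
  proof (rule bounded_support_integrable)
    define m where "m = max \<bar>a\<bar> \<bar>b\<bar>"
    have "\<bar>?f x\<bar> \<le> m / L + 1" if "x \<in> {a..b}" for x
    proof -
      have "\<bar>x\<bar> \<le> m" using that by (auto simp: m_def)
      then have "\<bar>x / L\<bar> \<le> m / L" using L by (simp add: divide_right_mono)
      then show ?thesis using fb[of x] by linarith
    qed
    moreover have "0 \<le> m / L + 1" using L by (simp add: m_def)
    ultimately show "bounded_support (m / L + 1) m (\<lambda>x. indicator {a..b} x * ?f x)"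
      by (auto simp: bounded_support_def indicator_def m_def)
  qed
  have shift: "integrable lborel (\<lambda>x. indicator {-S..S} x * ?f (x + X))"
      "(\<integral>x. indicator {-S..S} x * ?f (x + X) \<partial>lborel) = (\<integral>x. indicator {X - S..X + S} x * ?f x \<partial>lborel)"
  proof -
    have e: "indicator {-S..S} x * ?f (x + X) = indicator {X - S..X + S} (x + X) * ?f (x + X)" for x
      by (auto simp: indicator_def)
    show "(\<integral>x. indicator {-S..S} x * ?f (x + X) \<partial>lborel) = (\<integral>x. indicator {X - S..X + S} x * ?f x \<partial>lborel)"
      unfolding e using lborel_integral_shift[of "\<lambda>x. indicator {X - S..X + S} x * ?f x" X] .
    show "integrable lborel (\<lambda>x. indicator {-S..S} x * ?f (x + X))"
      unfolding e using lborel_integrable_real_affine[OF int[of "X - S" "X + S"], of 1 X] by (simp add: add.commute)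
  qed
  have "(\<integral>x. indicator {-S..S} x * real_of_int (\<lfloor>(x + X) / L\<rfloor> - \<lfloor>x / L\<rfloor>) \<partial>lborel)
      = (\<integral>x. indicator {-S..S} x * ?f (x + X) - indicator {-S..S} x * ?f x \<partial>lborel)"
    by (simp add: right_diff_distrib)
  also have "\<dots> = (\<integral>x. indicator {X - S..X + S} x * ?f x - indicator {-S..S} x * ?f x \<partial>lborel)"
    using int shift by simp
  also have "\<dots> \<le> (\<integral>x. indicator {S..S+X} x * ((S + X) / L) + indicator {-S..X-S} x * (S / L + 1) \<partial>lborel)"
  proof (rule integral_mono)
    show "integrable lborel (\<lambda>x. indicator {X - S..X + S} x * ?f x - indicator {-S..S} x * ?f x)"
      using int by auto
    show "integrable lborel (\<lambda>x. indicator {S..S+X} x * ((S + X) / L) + indicator {-S..X-S} x * (S / L + 1))"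
      by (intro Bochner_Integration.integrable_add integrable_mult_left integrable_real_indicator)
         (auto simp: emeasure_lborel_Icc_eq)
    fix x :: real
    have 1: "x \<le> S + X \<Longrightarrow> ?f x \<le> (S + X) / L"
      using fb(2)[of x] L by (smt (verit) divide_right_mono)
    have 2: "- S \<le> x \<Longrightarrow> - ?f x \<le> S / L + 1"
    proof -
      assume "- S \<le> x"
      then have "- (S / L) \<le> x / L" using L divide_right_mono[of "-S" x L] by simp
      then show ?thesis using fb(1)[of x] by linarith
    qed
    have p: "0 \<le> (S + X) / L" "0 \<le> S / L" using L S X by auto
    show "indicator {X - S..X + S} x * ?f x - indicator {-S..S} x * ?f x
        \<le> indicator {S..S+X} x * ((S + X) / L) + indicator {-S..X-S} x * (S / L + 1)"
      using 1 2 p X S by (auto simp: indicator_def)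
  qed
  also have "\<dots> = X * ((S + X) / L) + X * (S / L + 1)"
    using X by (subst Bochner_Integration.integral_add)
      (auto simp: emeasure_lborel_Icc_eq intro!: integrable_mult_left integrable_real_indicator)
  also have "\<dots> = X * (2 * S + X + L) / L"
    using L by (simp add: field_simps)
  finally show ?thesis .
qed

text \<open>\<open>cell_avg L G\<close> is constant on cells, so the integrand vanishes unless a
  grid point lies between x and x + X, and then it is at most 2 B' B.\<close>

lemma cell_avg_shift_error_nonneg:
  fixes X L S :: real
  assumes L: "L > 0" and X: "0 \<le> X" "X \<le> L" and S: "0 \<le> S"
    and F: "bounded_support B' S F" and G: "bounded_support B S' G"
  shows "\<bar>(\<integral>x. F x * (cell_avg L G (x + X) - cell_avg L G x) \<partial>lborel)\<bar> \<le> 2 * B' * B * X * (2 * S + 2 * L) / L"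
proof -
  let ?k = "\<lambda>x. real_of_int (\<lfloor>(x + X) / L\<rfloor> - \<lfloor>x / L\<rfloor>)"
  note A = bounded_support_cell_avg[OF L G]
  have B: "0 \<le> B" "0 \<le> B'" using F G by (auto dest: bounded_supportD(4))
  have k: "0 \<le> ?k x" "?k x \<le> 1" "x + X \<notin> cell L x \<Longrightarrow> ?k x = 1" for x
  proof -
    have "x / L \<le> (x + X) / L" "(x + X) / L \<le> x / L + 1" using L X by (auto simp: field_simps)
    then have "\<lfloor>x / L\<rfloor> \<le> \<lfloor>(x + X) / L\<rfloor>" "\<lfloor>(x + X) / L\<rfloor> \<le> \<lfloor>x / L\<rfloor> + 1" by linarith+
    then show "0 \<le> ?k x" "?k x \<le> 1" "x + X \<notin> cell L x \<Longrightarrow> ?k x = 1" by (auto simp: cell_def)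
  qed
  have pt: "\<bar>F x * (cell_avg L G (x + X) - cell_avg L G x)\<bar> \<le> 2 * B' * B * (indicator {-S..S} x * ?k x)" for x
  proof (cases "x + X \<in> cell L x \<or> x \<notin> {-S..S}")
    case True
    then have "F x * (cell_avg L G (x + X) - cell_avg L G x) = 0"
      using bounded_supportD(3)[OF F, of x] cell_avg_cong_cell[of "x + X" L x G] by (auto simp: abs_if)
    moreover have "0 \<le> 2 * B' * B * (indicator {-S..S} x * ?k x)"
      using B k(1)[of x] by (intro mult_nonneg_nonneg) auto
    ultimately show ?thesis by (simp only: abs_zero)
  next
    case False
    then have "indicator {-S..S} x * ?k x = 1" using k(3)[of x] by auto
    moreover have "\<bar>F x\<bar> * \<bar>cell_avg L G (x + X) - cell_avg L G x\<bar> \<le> B' * (2 * B)"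
      using bounded_supportD(2)[OF F, of x] bounded_supportD(2)[OF A, of x] bounded_supportD(2)[OF A, of "x+X"] B
      by (intro mult_mono) auto
    ultimately show ?thesis by (simp add: abs_mult)
  qed
  have "\<bar>(\<integral>x. F x * (cell_avg L G (x + X) - cell_avg L G x) \<partial>lborel)\<bar>
      \<le> (\<integral>x. \<bar>F x * (cell_avg L G (x + X) - cell_avg L G x)\<bar> \<partial>lborel)"
    by (rule integral_abs_bound)
  also have "\<dots> \<le> (\<integral>x. 2 * B' * B * (indicator {-S..S} x * ?k x) \<partial>lborel)"
  proof (rule integral_mono'[OF _ pt])
    show "integrable lborel (\<lambda>x. 2 * B' * B * (indicator {- S..S} x * ?k x))"
      by (intro integrable_mult_right bounded_support_integrable[of 1 S])
         (use k in \<open>auto simp: bounded_support_def indicator_def\<close>)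
    show "0 \<le> 2 * B' * B * (indicator {-S..S} x * ?k x)" for x
      using B k(1)[of x] by (intro mult_nonneg_nonneg) auto
  qed
  also have "\<dots> = 2 * B' * B * (\<integral>x. indicator {-S..S} x * ?k x \<partial>lborel)" by simp
  also have "\<dots> \<le> 2 * B' * B * (X * (2 * S + X + L) / L)"
    using integral_floor_shift[OF L X(1) S] B by (intro mult_left_mono) auto
  also have "\<dots> \<le> 2 * B' * B * (X * (2 * S + 2 * L) / L)"
    using X L B S by (intro mult_left_mono divide_right_mono) auto
  finally show ?thesis by (simp add: mult.assoc)
qed

lemma cell_avg_shift_error:
  fixes X L S :: real
  assumes L: "L > 0" and X: "\<bar>X\<bar> \<le> L" and S: "0 \<le> S"
    and F: "bounded_support B' S F" and G: "bounded_support B S' G"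
  shows "\<bar>(\<integral>x. F x * cell_avg L G (x + X) \<partial>lborel) - (\<integral>x. F x * cell_avg L G x \<partial>lborel)\<bar>
      \<le> 2 * B' * B * \<bar>X\<bar> * (2 * S + 4 * L) / L"
proof -
  note A = bounded_support_cell_avg[OF L G]
  note [measurable] = bounded_supportD(1)[OF F] bounded_supportD(1)[OF A]
  have B: "0 \<le> B" "0 \<le> B'" using F G by (auto dest: bounded_supportD(4))
  have "integrable lborel (\<lambda>x. F x * cell_avg L G (x + X))" "integrable lborel (\<lambda>x. F x * cell_avg L G x)"
    by (rule bounded_support_integrable bounded_support_mult[OF F] | simp | rule bounded_supportD(2)[OF A])+
  then have eq: "(\<integral>x. F x * cell_avg L G (x + X) \<partial>lborel) - (\<integral>x. F x * cell_avg L G x \<partial>lborel)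
      = (\<integral>x. F x * (cell_avg L G (x + X) - cell_avg L G x) \<partial>lborel)"
    by (simp add: right_diff_distrib)
  have "\<bar>\<integral>x. F x * (cell_avg L G (x + X) - cell_avg L G x) \<partial>lborel\<bar> \<le> 2 * B' * B * \<bar>X\<bar> * (2 * (S + \<bar>X\<bar>) + 2 * L) / L"
  proof (cases "0 \<le> X")
    case True
    then have "\<bar>\<integral>x. F x * (cell_avg L G (x + X) - cell_avg L G x) \<partial>lborel\<bar> \<le> 2 * B' * B * X * (2 * (S + X) + 2 * L) / L"
      using cell_avg_shift_error_nonneg[OF L True _ _ bounded_support_mono[OF F order_refl, of "S+X"] G] X S by auto
    then show ?thesis using True by simp
  next
    case False
    \<comment> \<open>For X < 0 the substitution x -> x - X moves the shift onto F, whose support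
      grows by |X|, and leaves a shift of the average by -X > 0.\<close>
    have F': "bounded_support B' (S + \<bar>X\<bar>) (\<lambda>x. F (x - X))"
      using bounded_supportD[OF F] unfolding bounded_support_def by auto
    have "(\<integral>x. F x * (cell_avg L G (x + X) - cell_avg L G x) \<partial>lborel)
       = - (\<integral>x. F (x - X) * (cell_avg L G (x + (-X)) - cell_avg L G x) \<partial>lborel)"
      by (subst lborel_integral_shift[of _ "-X", symmetric]) (simp flip: Bochner_Integration.integral_minus add: algebra_simps)
    moreover have "\<bar>\<integral>x. F (x - X) * (cell_avg L G (x + (-X)) - cell_avg L G x) \<partial>lborel\<bar>
      \<le> 2 * B' * B * (-X) * (2 * (S + \<bar>X\<bar>) + 2 * L) / L"
      by (rule cell_avg_shift_error_nonneg[OF L _ _ _ F' G]) (use False X S in auto)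
    ultimately show ?thesis using False by simp
  qed
  also have "\<dots> \<le> 2 * B' * B * \<bar>X\<bar> * (2 * S + 4 * L) / L"
    using X B L by (intro divide_right_mono mult_left_mono) auto
  finally show ?thesis unfolding eq .
qed

section \<open>Bilinear forms on strips\<close>

context prob_space
begin

text \<open>\<open>u\<close> is the relative height inside a strip, distributed by \<open>M\<close>,
  and \<open>x\<close> the horizontal coordinate.\<close>

definition test :: "real \<Rightarrow> real \<Rightarrow> ('a \<times> real \<Rightarrow> real) \<Rightarrow> bool" where
  "test B S f \<longleftrightarrow> f \<in> borel_measurable (M \<Otimes>\<^sub>M borel) \<and> (\<forall>u x. \<bar>f (u, x)\<bar> \<le> B) \<and> (\<forall>u x. S < \<bar>x\<bar> \<longrightarrow> f (u, x) = 0)"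

definition tests :: "('a \<times> real \<Rightarrow> real) set" where
  "tests = {f. \<exists>B S. test B S f}"

text \<open>Integrands for \<open>tri_integral\<close>. The bounds are asked for only on
  \<open>space M\<close>, because a \<open>shift_fun\<close> is controlled only there.\<close>

definition kernel :: "real \<Rightarrow> real \<Rightarrow> ('a \<times> 'a \<times> real \<Rightarrow> real) \<Rightarrow> bool" where
  "kernel B S h \<longleftrightarrow> h \<in> borel_measurable (M \<Otimes>\<^sub>M M \<Otimes>\<^sub>M borel) \<and>
     (\<forall>u\<in>space M. \<forall>v\<in>space M. \<forall>x. \<bar>h (u, v, x)\<bar> \<le> B \<and> (S < \<bar>x\<bar> \<longrightarrow> h (u, v, x) = 0))"

definition tri_integral :: "('a \<times> 'a \<times> real \<Rightarrow> real) \<Rightarrow> real" where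
  "tri_integral h = (\<integral>u. \<integral>v. \<integral>x. h (u, v, x) \<partial>lborel \<partial>M \<partial>M)"

definition ip :: "('a \<times> real \<Rightarrow> real) \<Rightarrow> ('a \<times> real \<Rightarrow> real) \<Rightarrow> real" where
  "ip f g = (\<integral>u. \<integral>x. f (u, x) * g (u, x) \<partial>lborel \<partial>M)"

text \<open>An edge joins (u, x) in one strip to (v, x + X u v) in the other, and the form
  integrates over all edges. For X = 0 it pairs the means of f and g over the heights.\<close>

definition beta :: "('a \<Rightarrow> 'a \<Rightarrow> real) \<Rightarrow> ('a \<times> real \<Rightarrow> real) \<Rightarrow> ('a \<times> real \<Rightarrow> real) \<Rightarrow> real" where
  "beta X f g = (\<integral>u. \<integral>v. \<integral>x. f (u, x) * g (v, x + X u v) \<partial>lborel \<partial>M \<partial>M)"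

definition shift_fun :: "real \<Rightarrow> ('a \<Rightarrow> 'a \<Rightarrow> real) \<Rightarrow> bool" where
  "shift_fun K X \<longleftrightarrow> (\<lambda>(u, v). X u v) \<in> borel_measurable (M \<Otimes>\<^sub>M M) \<and> (\<forall>u\<in>space M. \<forall>v\<in>space M. \<bar>X u v\<bar> \<le> K)"

definition avg :: "real \<Rightarrow> ('a \<times> real \<Rightarrow> real) \<Rightarrow> 'a \<times> real \<Rightarrow> real" where
  "avg L f = (\<lambda>(u, x). cell_avg L (\<lambda>y. f (u, y)) x)"

lemma testD:
  assumes "test B S f"
  shows "f \<in> borel_measurable (M \<Otimes>\<^sub>M borel)" "\<bar>f (u, x)\<bar> \<le> B" "S < \<bar>x\<bar> \<Longrightarrow> f (u, x) = 0" "0 \<le> B"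
  using assms order_trans[OF abs_ge_zero, of "f undefined" B] unfolding test_def
  by (auto, metis surj_pair)

lemma test_mono: "test B S f \<Longrightarrow> B \<le> B' \<Longrightarrow> S \<le> S' \<Longrightarrow> test B' S' f"
  unfolding test_def by (auto intro: order_trans)

lemma testI_tests: "test B S f \<Longrightarrow> f \<in> tests"
  by (auto simp: tests_def)

lemma testsE:
  assumes "f \<in> tests" obtains B S where "test B S f" "0 \<le> B" "0 \<le> S"
proof -
  obtain B S where f: "test B S f" using assms by (auto simp: tests_def)
  then have "test B (max S 0) f" by (rule test_mono) auto
  then show ?thesis using that testD(4)[OF f] by (meson max.cobounded2)
qed

lemma test_slice:
  assumes "test B S f" "u \<in> space M"
  shows "bounded_support B S (\<lambda>x. f (u, x))"
proof -
  have "f \<circ> Pair u \<in> borel_measurable borel"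
    using measurable_comp[OF measurable_Pair1'[OF assms(2)] testD(1)[OF assms(1)]] by simp
  then show ?thesis using testD[OF assms(1)] unfolding bounded_support_def comp_def by auto
qed

lemma test_diff: "test B S f \<Longrightarrow> test B' S g \<Longrightarrow> test (B + B') S (\<lambda>p. f p - g p)"
  unfolding test_def by (auto intro!: order_trans[OF abs_triangle_ineq4] add_mono)

lemma test_add: "test B S f \<Longrightarrow> test B' S g \<Longrightarrow> test (B + B') S (\<lambda>p. f p + g p)"
  unfolding test_def by (auto intro!: order_trans[OF abs_triangle_ineq] add_mono)

lemma test_scale: "test B S f \<Longrightarrow> test (\<bar>c\<bar> * B) S (\<lambda>p. c * f p)"
  unfolding test_def by (auto simp: abs_mult intro!: mult_left_mono)

lemma tests_add: assumes "f \<in> tests" "g \<in> tests" shows "(\<lambda>p. f p + g p) \<in> tests"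
proof -
  obtain B S B' S' where "test B S f" "test B' S' g" using assms by (auto simp: tests_def)
  then have "test B (max S S') f" "test B' (max S S') g" by (auto elim: test_mono)
  then show ?thesis using test_add testI_tests by blast
qed

lemma tests_scale: "f \<in> tests \<Longrightarrow> (\<lambda>p. c * f p) \<in> tests"
  using test_scale testI_tests by (fastforce elim: testsE)

lemma tests_zero: "(\<lambda>p. 0) \<in> tests"
  by (auto simp: tests_def test_def)

lemma tests_diff: assumes "f \<in> tests" "g \<in> tests" shows "(\<lambda>p. f p - g p) \<in> tests"
  using tests_add[OF assms(1) tests_scale[OF assms(2), of "-1"]] by simp

lemma tests_sum: "(\<And>i. i \<in> I \<Longrightarrow> f i \<in> tests) \<Longrightarrow> (\<lambda>p. \<Sum>i\<in>I. f i p) \<in> tests"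
  by (induction I rule: infinite_finite_induct) (auto intro: tests_add tests_zero)

lemma kernel_slice:
  assumes "kernel B S h" "u \<in> space M" "v \<in> space M"
  shows "bounded_support B S (\<lambda>x. h (u, v, x))"
proof -
  have [measurable]: "h \<in> borel_measurable (M \<Otimes>\<^sub>M M \<Otimes>\<^sub>M borel)" using assms by (simp add: kernel_def)
  have "(\<lambda>x. h (u, v, x)) \<in> borel_measurable borel"
    using assms by measurable
  then show ?thesis using assms unfolding kernel_def bounded_support_def by auto
qed

lemma kernel_inner_measurable:
  assumes "kernel B S h"
  shows "(\<lambda>(u, v). \<integral>x. h (u, v, x) \<partial>lborel) \<in> borel_measurable (M \<Otimes>\<^sub>M M)"
proof -
  have [measurable]: "h \<in> borel_measurable (M \<Otimes>\<^sub>M M \<Otimes>\<^sub>M borel)" using assms by (simp add: kernel_def)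
  show ?thesis by measurable
qed

lemma kernel_inner_bound:
  assumes "kernel B S h" "0 \<le> S" "u \<in> space M" "v \<in> space M"
  shows "\<bar>\<integral>x. h (u, v, x) \<partial>lborel\<bar> \<le> B * (2 * S)"
  using integral_bounded_support[OF kernel_slice[OF assms(1,3,4)] assms(2)] .

lemma bounded_integrable:
  assumes "k \<in> borel_measurable M" "\<And>u. u \<in> space M \<Longrightarrow> \<bar>k u\<bar> \<le> (C::real)"
  shows "integrable M k" "\<bar>\<integral>u. k u \<partial>M\<bar> \<le> C"
proof -
  show i: "integrable M k" using assms by (intro integrable_const_bound[of _ C]) auto
  have "\<bar>\<integral>u. k u \<partial>M\<bar> \<le> (\<integral>u. \<bar>k u\<bar> \<partial>M)" by (rule integral_abs_bound)
  also have "\<dots> \<le> (\<integral>u. C \<partial>M)" using i assms by (intro integral_mono) auto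
  finally show "\<bar>\<integral>u. k u \<partial>M\<bar> \<le> C" by (simp add: prob_space)
qed

lemma two_level:
  assumes [measurable]: "(\<lambda>(u, v). k u v) \<in> borel_measurable (M \<Otimes>\<^sub>M M)"
    and b: "\<And>u v. u \<in> space M \<Longrightarrow> v \<in> space M \<Longrightarrow> \<bar>k u v\<bar> \<le> (C::real)"
  shows "u \<in> space M \<Longrightarrow> integrable M (\<lambda>v. k u v)"
    "integrable M (\<lambda>u. \<integral>v. k u v \<partial>M)"
    "\<bar>\<integral>u. \<integral>v. k u v \<partial>M \<partial>M\<bar> \<le> C"
    "(\<integral>u. \<integral>v. k u v \<partial>M \<partial>M) = (\<integral>v. \<integral>u. k u v \<partial>M \<partial>M)"
proof -
  interpret P: pair_prob_space M M ..
  have m: "(\<lambda>v. k u v) \<in> borel_measurable M" if "u \<in> space M" for u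
    using that by measurable
  show "integrable M (\<lambda>v. k u v)" if "u \<in> space M" for u
    using bounded_integrable(1)[OF m[OF that] b[OF that]] by simp
  have i: "\<bar>\<integral>v. k u v \<partial>M\<bar> \<le> C" if "u \<in> space M" for u
    using bounded_integrable(2)[OF m[OF that] b[OF that]] by simp
  have m2: "(\<lambda>u. \<integral>v. k u v \<partial>M) \<in> borel_measurable M" by measurable
  show "integrable M (\<lambda>u. \<integral>v. k u v \<partial>M)" "\<bar>\<integral>u. \<integral>v. k u v \<partial>M \<partial>M\<bar> \<le> C"
    using bounded_integrable[OF m2 i] by auto
  have "integrable (M \<Otimes>\<^sub>M M) (\<lambda>(u, v). k u v)"
    by (rule P.integrable_const_bound[of _ C]) (auto simp: space_pair_measure intro!: AE_I2 b)
  then show "(\<integral>u. \<integral>v. k u v \<partial>M \<partial>M) = (\<integral>v. \<integral>u. k u v \<partial>M \<partial>M)"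
    using P.Fubini_integral[of k] by simp
qed

lemma kernel_levels:
  assumes h: "kernel B S h"
  shows "u \<in> space M \<Longrightarrow> v \<in> space M \<Longrightarrow> integrable lborel (\<lambda>x. h (u, v, x))"
    "u \<in> space M \<Longrightarrow> integrable M (\<lambda>v. \<integral>x. h (u, v, x) \<partial>lborel)"
    "integrable M (\<lambda>u. \<integral>v. \<integral>x. h (u, v, x) \<partial>lborel \<partial>M)"
    "(\<integral>u. \<integral>v. \<integral>x. h (u, v, x) \<partial>lborel \<partial>M \<partial>M) = (\<integral>v. \<integral>u. \<integral>x. h (u, v, x) \<partial>lborel \<partial>M \<partial>M)"
proof -
  have "kernel B (max S 0) h" using h unfolding kernel_def by auto
  then have b: "\<bar>\<integral>x. h (u, v, x) \<partial>lborel\<bar> \<le> B * (2 * max S 0)" if "u \<in> space M" "v \<in> space M" for u v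
    using kernel_inner_bound[of B "max S 0"] that by auto
  show "u \<in> space M \<Longrightarrow> v \<in> space M \<Longrightarrow> integrable lborel (\<lambda>x. h (u, v, x))"
    by (rule bounded_support_integrable[OF kernel_slice[OF h]])
  note T = two_level[of "\<lambda>u v. \<integral>x. h (u, v, x) \<partial>lborel", OF kernel_inner_measurable[OF h] b]
  show "u \<in> space M \<Longrightarrow> integrable M (\<lambda>v. \<integral>x. h (u, v, x) \<partial>lborel)"
    "integrable M (\<lambda>u. \<integral>v. \<integral>x. h (u, v, x) \<partial>lborel \<partial>M)"
    "(\<integral>u. \<integral>v. \<integral>x. h (u, v, x) \<partial>lborel \<partial>M \<partial>M) = (\<integral>v. \<integral>u. \<integral>x. h (u, v, x) \<partial>lborel \<partial>M \<partial>M)"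
    using T by auto
qed

lemma tri_integral_add:
  assumes h: "kernel B S h" and k: "kernel B' S' k"
  shows "tri_integral (\<lambda>p. h p + k p) = tri_integral h + tri_integral k"
proof -
  note H = kernel_levels[OF h] and K = kernel_levels[OF k]
  have "tri_integral (\<lambda>p. h p + k p) = (\<integral>u. \<integral>v. (\<integral>x. h (u, v, x) \<partial>lborel) + (\<integral>x. k (u, v, x) \<partial>lborel) \<partial>M \<partial>M)"
    unfolding tri_integral_def using H(1) K(1) by (intro Bochner_Integration.integral_cong refl Bochner_Integration.integral_add) auto
  also have "\<dots> = (\<integral>u. (\<integral>v. \<integral>x. h (u, v, x) \<partial>lborel \<partial>M) + (\<integral>v. \<integral>x. k (u, v, x) \<partial>lborel \<partial>M) \<partial>M)"
    using H(2) K(2) by (intro Bochner_Integration.integral_cong refl Bochner_Integration.integral_add) auto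
  also have "\<dots> = tri_integral h + tri_integral k"
    unfolding tri_integral_def using H(3) K(3) by simp
  finally show ?thesis .
qed

lemma tri_integral_scale: "tri_integral (\<lambda>p. c * h p) = c * tri_integral h"
  by (simp add: tri_integral_def)

lemma tri_integral_mono:
  assumes h: "kernel B S h" and k: "kernel B' S' k"
    and le: "\<And>u v x. u \<in> space M \<Longrightarrow> v \<in> space M \<Longrightarrow> h (u, v, x) \<le> k (u, v, x)"
  shows "tri_integral h \<le> tri_integral k"
  unfolding tri_integral_def
  by (intro integral_mono kernel_levels[OF h] kernel_levels[OF k] le) auto

lemma kernel_scale: "kernel B S h \<Longrightarrow> kernel (\<bar>c\<bar> * B) S (\<lambda>p. c * h p)"
  unfolding kernel_def by (auto simp: abs_mult intro!: mult_left_mono)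

lemma kernel_add: assumes "kernel B S h" "kernel B' S' k" shows "kernel (B + B') (max S S') (\<lambda>p. h p + k p)"
proof -
  have "h \<in> borel_measurable (M \<Otimes>\<^sub>M M \<Otimes>\<^sub>M borel)" "k \<in> borel_measurable (M \<Otimes>\<^sub>M M \<Otimes>\<^sub>M borel)"
    using assms by (auto simp: kernel_def)
  moreover have "\<bar>h (u, v, x) + k (u, v, x)\<bar> \<le> B + B'" if "u \<in> space M" "v \<in> space M" for u v x
    using assms that unfolding kernel_def by (auto intro!: order_trans[OF abs_triangle_ineq] add_mono)
  ultimately show ?thesis using assms unfolding kernel_def by auto
qed

lemma kernel_beta:
  assumes f: "test B S f" and g: "test B' S' g" and X: "shift_fun K X"
  shows "kernel (B * B') S (\<lambda>(u, v, x). f (u, x) * g (v, x + X u v))"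
proof -
  have [measurable]: "f \<in> borel_measurable (M \<Otimes>\<^sub>M borel)" "g \<in> borel_measurable (M \<Otimes>\<^sub>M borel)"
    "(\<lambda>(u, v). X u v) \<in> borel_measurable (M \<Otimes>\<^sub>M M)"
    using f g X by (auto simp: test_def shift_fun_def)
  have "(\<lambda>(u, v, x). f (u, x) * g (v, x + X u v)) \<in> borel_measurable (M \<Otimes>\<^sub>M M \<Otimes>\<^sub>M borel)"
    by measurable
  then show ?thesis using testD[OF f] testD[OF g] unfolding kernel_def
    by (auto simp: abs_mult intro!: mult_mono)
qed

lemma beta_tri: "beta X f g = tri_integral (\<lambda>(u, v, x). f (u, x) * g (v, x + X u v))"
  by (simp add: beta_def tri_integral_def)

lemma shift_fun_zero: "shift_fun 0 (\<lambda>_ _. 0)"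
  by (simp add: shift_fun_def)

lemma beta_scale_left: "beta X (\<lambda>p. c * f p) g = c * beta X f g"
  by (simp add: beta_def mult.assoc)

lemma beta_scale_right: "beta X f (\<lambda>p. c * g p) = c * beta X f g"
  by (simp add: beta_def mult.left_commute)

lemma beta_add_left:
  assumes "f \<in> tests" "f' \<in> tests" "g \<in> tests" "shift_fun K X"
  shows "beta X (\<lambda>p. f p + f' p) g = beta X f g + beta X f' g"
proof -
  obtain B S B' S' B'' S'' where T: "test B S f" "test B' S' f'" "test B'' S'' g" using assms by (auto simp: tests_def)
  show ?thesis unfolding beta_tri
    by (subst tri_integral_add[OF kernel_beta[OF T(1,3) assms(4)] kernel_beta[OF T(2,3) assms(4)], symmetric])
       (auto intro!: arg_cong[of _ _ tri_integral] simp: fun_eq_iff distrib_right)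
qed

lemma beta_add_right:
  assumes "f \<in> tests" "g \<in> tests" "g' \<in> tests" "shift_fun K X"
  shows "beta X f (\<lambda>p. g p + g' p) = beta X f g + beta X f g'"
proof -
  obtain B S B' S' B'' S'' where T: "test B S f" "test B' S' g" "test B'' S'' g'" using assms by (auto simp: tests_def)
  show ?thesis unfolding beta_tri
    by (subst tri_integral_add[OF kernel_beta[OF T(1,2) assms(4)] kernel_beta[OF T(1,3) assms(4)], symmetric])
       (auto intro!: arg_cong[of _ _ tri_integral] simp: fun_eq_iff distrib_left)
qed

lemma beta_diff_left:
  assumes "f \<in> tests" "f' \<in> tests" "g \<in> tests" "shift_fun K X"
  shows "beta X (\<lambda>p. f p - f' p) g = beta X f g - beta X f' g"
  using beta_add_left[OF assms(1) tests_scale[OF assms(2), of "-1"] assms(3,4)] beta_scale_left[of X "-1" f' g] by simp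

lemma beta_diff_right:
  assumes "f \<in> tests" "g \<in> tests" "g' \<in> tests" "shift_fun K X"
  shows "beta X f (\<lambda>p. g p - g' p) = beta X f g - beta X f g'"
  using beta_add_right[OF assms(1,2) tests_scale[OF assms(3), of "-1"] assms(4)] beta_scale_right[of X f "-1" g'] by simp

lemma beta_sum_left:
  assumes "\<And>i. i \<in> I \<Longrightarrow> f i \<in> tests" "g \<in> tests" "shift_fun K X"
  shows "beta X (\<lambda>p. \<Sum>i\<in>I. f i p) g = (\<Sum>i\<in>I. beta X (f i) g)"
  using assms(1)
proof (induction I rule: infinite_finite_induct)
  case (insert i I)
  then show ?case
    using beta_add_left[of "f i" "\<lambda>p. \<Sum>i\<in>I. f i p" g K X] assms(2,3) tests_sum[of I f] by simp
qed (simp_all add: beta_def)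

lemma beta_sum_right:
  assumes "\<And>i. i \<in> I \<Longrightarrow> g i \<in> tests" "f \<in> tests" "shift_fun K X"
  shows "beta X f (\<lambda>p. \<Sum>i\<in>I. g i p) = (\<Sum>i\<in>I. beta X f (g i))"
  using assms(1)
proof (induction I rule: infinite_finite_induct)
  case (insert i I)
  then show ?case
    using beta_add_right[of f "g i" "\<lambda>p. \<Sum>i\<in>I. g i p" K X] assms(2,3) tests_sum[of I g] by simp
qed (simp_all add: beta_def)

lemma kernel_sq:
  assumes f: "test B S f"
  shows "kernel (B * B) S (\<lambda>(u, v, x). f (u, x) * f (u, x))"
    "kernel (B * B) S (\<lambda>(u, v, x). f (v, x) * f (v, x))"
proof -
  have [measurable]: "f \<in> borel_measurable (M \<Otimes>\<^sub>M borel)" using f by (rule testD(1))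
  have b: "\<bar>f p * f p\<bar> \<le> B * B" for p
    unfolding abs_mult by (cases p) (simp only: mult_mono[OF testD(2)[OF f] testD(2)[OF f] testD(4)[OF f] abs_ge_zero])
  have z: "S < \<bar>x\<bar> \<Longrightarrow> f (u, x) * f (u, x) = 0" for u x
    using testD(3)[OF f] by simp
  have m: "(\<lambda>(u, v, x). f (u, x) * f (u, x)) \<in> borel_measurable (M \<Otimes>\<^sub>M M \<Otimes>\<^sub>M borel)"
    by measurable
  have m': "(\<lambda>(u, v, x). f (v, x) * f (v, x)) \<in> borel_measurable (M \<Otimes>\<^sub>M M \<Otimes>\<^sub>M borel)"
    by measurable
  show "kernel (B * B) S (\<lambda>(u, v, x). f (u, x) * f (u, x))"
    unfolding kernel_def prod.case using b z m by (intro conjI ballI allI impI)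
  show "kernel (B * B) S (\<lambda>(u, v, x). f (v, x) * f (v, x))"
    unfolding kernel_def prod.case using b z m' by (intro conjI ballI allI impI)
qed

lemma ip_tri: "ip f f = tri_integral (\<lambda>(u, v, x). f (u, x) * f (u, x))"
  "ip f f = tri_integral (\<lambda>(u, v, x). f (v, x) * f (v, x))"
  by (simp_all add: ip_def tri_integral_def prob_space)

lemma tri_integral_shift:
  "tri_integral (\<lambda>(u, v, x). h (u, v, x + X u v)) = tri_integral h"
proof -
  have "(\<integral>x. h (u, v, x + X u v) \<partial>lborel) = (\<integral>x. h (u, v, x) \<partial>lborel)" for u v
    by (rule lborel_integral_shift)
  then show ?thesis by (simp add: tri_integral_def)
qed

lemma kernel_shift:
  assumes h: "kernel B S h" and X: "shift_fun K X"
  shows "kernel B (S + K) (\<lambda>(u, v, x). h (u, v, x + X u v))"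
proof -
  have [measurable]: "h \<in> borel_measurable (M \<Otimes>\<^sub>M M \<Otimes>\<^sub>M borel)" "(\<lambda>(u, v). X u v) \<in> borel_measurable (M \<Otimes>\<^sub>M M)"
    using h X by (auto simp: kernel_def shift_fun_def)
  have "(\<lambda>(u, v, x). h (u, v, x + X u v)) \<in> borel_measurable (M \<Otimes>\<^sub>M M \<Otimes>\<^sub>M borel)"
    by measurable
  moreover have "S < \<bar>x + X u v\<bar>" if "u \<in> space M" "v \<in> space M" "S + K < \<bar>x\<bar>" for u v x
    using X that unfolding shift_fun_def by fastforce
  ultimately show ?thesis using h unfolding kernel_def by auto
qed

text \<open>Integrate 2 f g \<le> f^2 + g^2. Translation in x preserves Lebesgue measure, so the
  shifted square of g still integrates to \<open>ip g g\<close>.\<close>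

lemma beta_le_ip:
  assumes f: "f \<in> tests" and g: "g \<in> tests" and X: "shift_fun K X"
  shows "beta X f g \<le> (ip f f + ip g g) / 2"
proof -
  obtain B S B' S' where T: "test B S f" "test B' S' g" using f g by (auto simp: tests_def)
  note k1 = kernel_sq(1)[OF T(1)] and k2 = kernel_shift[OF kernel_sq(2)[OF T(2)] X]
  let ?h1 = "\<lambda>(u :: 'a, v :: 'a, x). f (u, x) * f (u, x)"
  let ?h2 = "\<lambda>(u, v, x). (\<lambda>(u :: 'a, v, x). g (v, x) * g (v, x)) (u, v, x + X u v)"
  have "beta X f g \<le> tri_integral (\<lambda>p. (1/2) * (?h1 p + ?h2 p))"
    unfolding beta_tri
  proof (rule tri_integral_mono[OF kernel_beta[OF T X] kernel_scale[OF kernel_add[OF k1 k2]]])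
    fix u v x
    show "(case (u, v, x) of (u, v, x) \<Rightarrow> f (u, x) * g (v, x + X u v)) \<le> (1/2) * (?h1 (u, v, x) + ?h2 (u, v, x))"
      using sum_squares_bound[of "f (u, x)" "g (v, x + X u v)"] by (simp add: power2_eq_square)
  qed
  also have "\<dots> = (1/2) * (tri_integral ?h1 + tri_integral ?h2)"
    by (simp only: tri_integral_scale tri_integral_add[OF k1 k2])
  also have "tri_integral ?h2 = ip g g"
    by (simp only: tri_integral_shift ip_tri(2))
  finally show ?thesis unfolding ip_tri(1)[symmetric] by simp
qed

lemma beta_ge_ip:
  assumes f: "f \<in> tests" and g: "g \<in> tests" and X: "shift_fun K X"
  shows "- (ip f f + ip g g) / 2 \<le> beta X f g"
proof -
  have "ip (\<lambda>p. -1 * f p) (\<lambda>p. -1 * f p) = ip f f" by (simp add: ip_def)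
  then show ?thesis
    using beta_le_ip[OF tests_scale[OF f, of "-1"] g X] beta_scale_left[of X "-1" f g] by simp
qed

text \<open>The edges traversed backwards: translate x by - X u v and exchange the order of u and v.
  Thus estimates on the second argument also serve for the first.\<close>

lemma beta_adjoint:
  assumes f: "f \<in> tests" and g: "g \<in> tests" and X: "shift_fun K X"
  shows "beta X f g = beta (\<lambda>v u. - X u v) g f"
proof -
  obtain B S B' S' where T: "test B S f" "test B' S' g" using f g by (auto simp: tests_def)
  have "beta X f g = (\<integral>v. \<integral>u. \<integral>x. f (u, x) * g (v, x + X u v) \<partial>lborel \<partial>M \<partial>M)"
    using kernel_levels(4)[OF kernel_beta[OF T X]] by (simp add: beta_def)
  also have "\<dots> = (\<integral>v. \<integral>u. \<integral>x. g (v, x) * f (u, x + - X u v) \<partial>lborel \<partial>M \<partial>M)"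
  proof -
    have "(\<integral>x. f (u, x) * g (v, x + X u v) \<partial>lborel) = (\<integral>x. g (v, x) * f (u, x + - X u v) \<partial>lborel)" for u v
      using lborel_integral_shift[of "\<lambda>x. f (u, x) * g (v, x + X u v)" "- X u v"] by (simp add: mult.commute)
    then show ?thesis by (simp only:)
  qed
  finally show ?thesis by (simp add: beta_def)
qed

lemma shift_fun_adjoint:
  assumes "shift_fun K X" shows "shift_fun K (\<lambda>v u. - X u v)"
proof -
  have [measurable]: "(\<lambda>(u, v). X u v) \<in> borel_measurable (M \<Otimes>\<^sub>M M)" using assms by (simp add: shift_fun_def)
  have "(\<lambda>(v, u). - X u v) \<in> borel_measurable (M \<Otimes>\<^sub>M M)" by measurable
  then show ?thesis using assms by (simp add: shift_fun_def)
qed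

section \<open>Cell averages in the horizontal coordinate\<close>

lemma test_avg:
  assumes f: "test B S f" and L: "L > 0"
  shows "test B (S + L) (avg L f)"
proof -
  have [measurable]: "f \<in> borel_measurable (M \<Otimes>\<^sub>M borel)" using f by (simp add: test_def)
  have "avg L f \<in> borel_measurable (M \<Otimes>\<^sub>M borel)"
    unfolding avg_def cell_avg_def cell_def indicator_def by measurable
  moreover have "\<bar>avg L f (u, x)\<bar> \<le> B" for u x
    using abs_cell_avg_le[OF L testD(2)[OF f]] by (simp add: avg_def)
  moreover have "avg L f (u, x) = 0" if "S + L < \<bar>x\<bar>" for u x
    using cell_avg_support[OF L, of S "\<lambda>y. f (u, y)" x] testD(3)[OF f] that by (simp add: avg_def)
  ultimately show ?thesis by (simp add: test_def)
qed

lemma tests_avg: "f \<in> tests \<Longrightarrow> L > 0 \<Longrightarrow> avg L f \<in> tests"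
  by (meson testsE testI_tests test_avg)

lemma avg_coarse: "L > 0 \<Longrightarrow> m > 0 \<Longrightarrow> avg L (avg (real m * L) f) = avg (real m * L) f"
  by (auto simp: fun_eq_iff avg_def cell_avg_coarse)

lemma avg_idem: "L > 0 \<Longrightarrow> avg L (avg L f) = avg L f"
  using avg_coarse[of L 1 f] by simp

lemma ip_avg:
  assumes f: "f \<in> tests" and g: "g \<in> tests" and L: "L > 0"
  shows "ip (avg L f) g = ip f (avg L g)"
proof -
  obtain B S B' S' where T: "test B S f" "test B' S' g" using f g by (auto simp: tests_def)
  show ?thesis unfolding ip_def
    by (rule Bochner_Integration.integral_cong[OF refl])
       (simp add: avg_def cell_avg_selfadjoint[OF L test_slice[OF T(1)] test_slice[OF T(2)]])
qed

lemma beta0_avg: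
  assumes f: "f \<in> tests" and g: "g \<in> tests" and L: "L > 0"
  shows "beta (\<lambda>_ _. 0) (avg L f) g = beta (\<lambda>_ _. 0) f (avg L g)"
proof -
  obtain B S B' S' where T: "test B S f" "test B' S' g" using f g by (auto simp: tests_def)
  show ?thesis unfolding beta_def
    by (rule Bochner_Integration.integral_cong[OF refl], rule Bochner_Integration.integral_cong[OF refl])
       (simp add: avg_def cell_avg_selfadjoint[OF L test_slice[OF T(1)] test_slice[OF T(2)]])
qed

text \<open>The estimate for low frequencies: for frozen u and v it is
  \<open>cell_avg_shift_error\<close>, and the bound survives averaging over the heights. The
  relative error is of order K / L.\<close>

lemma beta_avg_shift:
  assumes f: "test B' S f" and g: "test B S' g" and X: "shift_fun K X" and L: "K \<le> L" "L > 0" and S: "0 \<le> S"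
  shows "\<bar>beta X f (avg L g) - beta (\<lambda>_ _. 0) f (avg L g)\<bar> \<le> 2 * B' * B * K * (2 * S + 4 * L) / L"
proof -
  note A = test_avg[OF g L(2)]
  note k1 = kernel_beta[OF f A X] and k2 = kernel_beta[OF f A shift_fun_zero]
  let ?i1 = "\<lambda>u v. \<integral>x. f (u, x) * avg L g (v, x + X u v) \<partial>lborel"
  let ?i2 = "\<lambda>u v. \<integral>x. f (u, x) * avg L g (v, x + 0) \<partial>lborel"
  have m: "(\<lambda>(u, v). ?i1 u v - ?i2 u v) \<in> borel_measurable (M \<Otimes>\<^sub>M M)"
    using borel_measurable_diff[OF kernel_inner_measurable[OF k1] kernel_inner_measurable[OF k2]]
    by (simp add: case_prod_unfold)
  have b: "\<bar>?i1 u v - ?i2 u v\<bar> \<le> 2 * B' * B * K * (2 * S + 4 * L) / L" if "u \<in> space M" "v \<in> space M" for u v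
  proof -
    have x: "\<bar>X u v\<bar> \<le> K" using X that by (simp add: shift_fun_def)
    have "\<bar>?i1 u v - ?i2 u v\<bar> \<le> 2 * B' * B * \<bar>X u v\<bar> * (2 * S + 4 * L) / L"
      using cell_avg_shift_error[OF L(2) _ S test_slice[OF f that(1)] test_slice[OF g that(2)], of "X u v"] x L
      by (simp add: avg_def)
    also have "\<dots> \<le> 2 * B' * B * K * (2 * S + 4 * L) / L"
      using x L S testD(4)[OF f] testD(4)[OF g]
      by (intro divide_right_mono mult_right_mono mult_left_mono) auto
    finally show ?thesis .
  qed
  have "beta X f (avg L g) - beta (\<lambda>_ _. 0) f (avg L g) = (\<integral>u. \<integral>v. ?i1 u v - ?i2 u v \<partial>M \<partial>M)"
  proof -
    have "(\<integral>v. ?i1 u v - ?i2 u v \<partial>M) = (\<integral>v. ?i1 u v \<partial>M) - (\<integral>v. ?i2 u v \<partial>M)" if "u \<in> space M" for u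
      using kernel_levels(2)[OF k1 that] kernel_levels(2)[OF k2 that] unfolding prod.case
      by (rule Bochner_Integration.integral_diff)
    then have "(\<integral>u. \<integral>v. ?i1 u v - ?i2 u v \<partial>M \<partial>M) = (\<integral>u. (\<integral>v. ?i1 u v \<partial>M) - (\<integral>v. ?i2 u v \<partial>M) \<partial>M)"
      by (intro Bochner_Integration.integral_cong refl)
    also have "\<dots> = (\<integral>u. \<integral>v. ?i1 u v \<partial>M \<partial>M) - (\<integral>u. \<integral>v. ?i2 u v \<partial>M \<partial>M)"
      using kernel_levels(3)[OF k1] kernel_levels(3)[OF k2] unfolding prod.case
      by (rule Bochner_Integration.integral_diff)
    finally show ?thesis by (simp only: beta_def)
  qed
  then show ?thesis using two_level(3)[OF m b] by simp
qed

end

text \<open>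
  Van der Corput's estimate for a merely bounded \<open>G\<close> with small integrals over intervals: substitute
  and apply the second mean value theorem to the monotone factor \<open>1 / \<phi>'\<close>.
\<close>

lemma oscillation_bound:
  fixes \<phi> \<phi>' G :: "real \<Rightarrow> real"
  assumes ab: "a \<le> b" and c: "0 < c"
    and \<phi>: "\<phi> \<in> borel_measurable borel"
    and der: "\<And>u. u \<in> {a..b} \<Longrightarrow> (\<phi> has_real_derivative \<phi>' u) (at u)"
    and cont: "continuous_on {a..b} \<phi>'"
    and anti: "\<And>u v. a \<le> u \<Longrightarrow> u \<le> v \<Longrightarrow> v \<le> b \<Longrightarrow> \<phi>' v \<le> \<phi>' u"
    and low: "\<And>u. u \<in> {a..b} \<Longrightarrow> c \<le> \<phi>' u"
    and G: "bounded_support B S G"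
    and H: "\<And>p q. \<bar>\<integral>x. indicator {p..q} x * G x \<partial>lborel\<bar> \<le> H"
  shows "\<bar>\<integral>u. indicator {a..b} u * G (\<phi> u) \<partial>lborel\<bar> \<le> 2 * H / c"
proof -
  define F where "F u = G (\<phi> u) * \<phi>' u" for u
  note [measurable] = \<phi> bounded_supportD(1)[OF G]
  have F: "F integrable_on {p..q}" "\<bar>integral {p..q} F\<bar> \<le> H" if pq: "a \<le> p" "p \<le> q" "q \<le> b" for p q
  proof -
    have s: "{p..q} \<subseteq> {a..b}" using pq by auto
    have nnp: "0 \<le> \<phi>' u" if "u \<in> {p..q}" for u
      using low[of u] c s that by (meson less_imp_le order_trans subsetD)
    have "set_integrable lborel {\<phi> p..\<phi> q} G"
      unfolding set_integrable_def using bounded_support_integrable[OF G]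
      by (simp add: mult.commute[of "indicator _ _"] integrable_real_mult_indicator)
    note I = integral_substitution[OF this der continuous_on_subset[OF cont s] _ pq(2)]
    have int: "set_integrable lborel {p..q} F"
      unfolding F_def by (rule I(1)) (use s nnp in auto)
    show "F integrable_on {p..q}" by (rule set_borel_integral_eq_integral(1)[OF int])
    have "integral {p..q} F = (LBINT x. F x * indicator {p..q} x)"
      using set_borel_integral_eq_integral(2)[OF int] by (simp add: set_lebesgue_integral_def mult.commute)
    also have "\<dots> = (LBINT x. G x * indicator {\<phi> p..\<phi> q} x)"
      unfolding F_def by (rule I(2)[symmetric]) (use s nnp in auto)
    finally show "\<bar>integral {p..q} F\<bar> \<le> H" using H[of "\<phi> p" "\<phi> q"] by (simp add: mult.commute)
  qed
  have mono: "1 / \<phi>' u \<le> 1 / \<phi>' v" if "a \<le> u" "u \<le> v" "v \<le> b" for u v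
    using anti[OF that] low[of v] c that by (intro divide_left_mono mult_pos_pos) auto
  have nn: "0 \<le> 1 / \<phi>' u" "1 / \<phi>' u \<le> 1 / c" if "u \<in> {a..b}" for u
    using low[OF that] c by (auto simp: frac_le)
  obtain m where m: "m \<in> {a..b}"
    and hi: "((\<lambda>x. 1 / \<phi>' x * F x) has_integral (1 / \<phi>' a * integral {a..m} F + 1 / \<phi>' b * integral {m..b} F)) {a..b}"
    using second_mean_value_theorem_full[of F a b "\<lambda>u. 1 / \<phi>' u", OF F(1)[OF order_refl ab order_refl] ab mono] by blast
  have "((\<lambda>x. G (\<phi> x)) has_integral (1 / \<phi>' a * integral {a..m} F + 1 / \<phi>' b * integral {m..b} F)) {a..b}"
    using hi by (rule has_integral_eq[rotated]) (use low c in \<open>force simp: F_def\<close>)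
  moreover have "set_integrable lborel {a..b} (\<lambda>u. G (\<phi> u))"
    unfolding set_integrable_def
    by (rule bounded_support_integrable[of B "max \<bar>a\<bar> \<bar>b\<bar>"])
       (use bounded_supportD(2,4)[OF G] in \<open>auto simp: bounded_support_def indicator_def\<close>)
  ultimately have "(\<integral>u. indicator {a..b} u * G (\<phi> u) \<partial>lborel) = 1 / \<phi>' a * integral {a..m} F + 1 / \<phi>' b * integral {m..b} F"
    using set_borel_integral_eq_integral(2)[of "{a..b}" "\<lambda>u. G (\<phi> u)"]
    by (simp add: set_lebesgue_integral_def integral_unique)
  moreover have "\<bar>1 / \<phi>' a * integral {a..m} F\<bar> \<le> 1 / c * H" "\<bar>1 / \<phi>' b * integral {m..b} F\<bar> \<le> 1 / c * H"
    unfolding abs_mult using nn[of a] nn[of b] F(2)[of a m] F(2)[of m b] m ab c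
    by (intro mult_mono; auto)+
  moreover have "2 * H / c = 1 / c * H + 1 / c * H" by simp
  ultimately show ?thesis by linarith
qed

section \<open>The operator behind a form and its norm\<close>

context prob_space
begin

lemma Fubini_test:
  assumes f: "test B S f"
  shows "(\<integral>v. \<integral>x. f (v, x) \<partial>lborel \<partial>M) = (\<integral>x. \<integral>v. f (v, x) \<partial>M \<partial>lborel)"
proof -
  interpret P: pair_sigma_finite M lborel ..
  have [measurable]: "f \<in> borel_measurable (M \<Otimes>\<^sub>M borel)" using f by (rule testD(1))
  have "integrable (M \<Otimes>\<^sub>M lborel) (\<lambda>(v, x). f (v, x))"
  proof (rule Bochner_Integration.integrable_bound)
    have "emeasure (M \<Otimes>\<^sub>M lborel) (space M \<times> {-S..S}) < \<infinity>"
      by (subst lborel.emeasure_pair_measure_Times) (auto simp: emeasure_lborel_Icc_eq ennreal_mult_less_top emeasure_space_1)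
    then show "integrable (M \<Otimes>\<^sub>M lborel) (\<lambda>p. B * indicator (space M \<times> {-S..S}) p :: real)"
      by (intro integrable_mult_right integrable_real_indicator) auto
    show "AE p in M \<Otimes>\<^sub>M lborel. norm (case p of (v, x) \<Rightarrow> f (v, x)) \<le> norm (B * indicator (space M \<times> {-S..S}) p :: real)"
    proof (rule AE_I2, clarify)
      fix v :: 'a and x :: real assume "(v, x) \<in> space (M \<Otimes>\<^sub>M lborel)"
      then have v: "v \<in> space M" by (simp add: space_pair_measure)
      show "norm (f (v, x)) \<le> norm (B * indicator (space M \<times> {-S..S}) (v, x) :: real)"
        using bounded_support_bound[OF test_slice[OF f v], of x] testD(4)[OF f] v
        by (auto simp: indicator_def split: if_splits)
    qed
  qed measurable
  then show ?thesis using P.Fubini_integral[of "\<lambda>v x. f (v, x)"] by simp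
qed

text \<open>The operator with \<open>beta X f g = ip f (spread X g)\<close>. The indicator makes it
  a \<open>test\<close>, whose bounds are required for every u and not only in
  \<open>space M\<close>.\<close>

definition spread :: "('a \<Rightarrow> 'a \<Rightarrow> real) \<Rightarrow> ('a \<times> real \<Rightarrow> real) \<Rightarrow> 'a \<times> real \<Rightarrow> real" where
  "spread X g = (\<lambda>(u, x). indicator (space M) u * (\<integral>v. g (v, x + X u v) \<partial>M))"

lemma test_spread:
  assumes g: "test B S g" and X: "shift_fun K X"
  shows "test B (S + K) (spread X g)"
proof -
  have [measurable]: "g \<in> borel_measurable (M \<Otimes>\<^sub>M borel)" "(\<lambda>(u, v). X u v) \<in> borel_measurable (M \<Otimes>\<^sub>M M)"
    using g X by (auto simp: test_def shift_fun_def)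
  have "spread X g \<in> borel_measurable (M \<Otimes>\<^sub>M borel)"
    unfolding spread_def by measurable
  moreover have "\<bar>spread X g (u, x)\<bar> \<le> B" for u x
  proof (cases "u \<in> space M")
    case True
    then have "(\<lambda>v. g (v, x + X u v)) \<in> borel_measurable M" by measurable
    then have "\<bar>\<integral>v. g (v, x + X u v) \<partial>M\<bar> \<le> B" using bounded_integrable(2) testD(2)[OF g] by blast
    then show ?thesis using True by (simp add: spread_def)
  qed (use testD(4)[OF g] in \<open>simp add: spread_def\<close>)
  moreover have "spread X g (u, x) = 0" if x: "S + K < \<bar>x\<bar>" for u x
  proof (cases "u \<in> space M")
    case True
    have "g (v, x + X u v) = 0" if "v \<in> space M" for v
      using testD(3)[OF g, of "x + X u v" v] X x True that unfolding shift_fun_def by fastforce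
    then have "(\<integral>v. g (v, x + X u v) \<partial>M) = (\<integral>v. 0 \<partial>M)" by (intro Bochner_Integration.integral_cong refl)
    then show ?thesis by (simp add: spread_def)
  qed (simp add: spread_def)
  ultimately show ?thesis by (simp add: test_def)
qed

lemma Fubini_shift:
  assumes F: "bounded_support B S F" and g: "test B' S' g" and Y: "Y \<in> borel_measurable M"
  shows "(\<integral>v. \<integral>x. F x * g (v, x + Y v) \<partial>lborel \<partial>M) = (\<integral>x. F x * (\<integral>v. g (v, x + Y v) \<partial>M) \<partial>lborel)"
proof -
  have [measurable]: "F \<in> borel_measurable borel" "g \<in> borel_measurable (M \<Otimes>\<^sub>M borel)" "Y \<in> borel_measurable M"
    using F g Y by (auto simp: test_def bounded_support_def)
  let ?h = "\<lambda>(v, x). F x * g (v, x + Y v)"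
  have "?h \<in> borel_measurable (M \<Otimes>\<^sub>M borel)" by measurable
  moreover have "\<bar>F x * g (v, x + Y v)\<bar> \<le> B * B'" for v x
    unfolding abs_mult using bounded_supportD(2,4)[OF F] testD(2,4)[OF g] by (intro mult_mono) auto
  ultimately have "test (B * B') S ?h"
    using bounded_supportD(3)[OF F] unfolding test_def by auto
  note F = Fubini_test[OF this]
  then show ?thesis by simp
qed

lemma beta_eq_ip_spread:
  assumes f: "test B S f" and g: "test B' S' g" and X: "shift_fun K X"
  shows "beta X f g = ip f (spread X g)"
proof -
  have [measurable]: "(\<lambda>(u, v). X u v) \<in> borel_measurable (M \<Otimes>\<^sub>M M)"
    using X by (simp add: shift_fun_def)
  have "(\<integral>v. \<integral>x. f (u, x) * g (v, x + X u v) \<partial>lborel \<partial>M) = (\<integral>x. f (u, x) * spread X g (u, x) \<partial>lborel)"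
    if u: "u \<in> space M" for u
    using Fubini_shift[OF test_slice[OF f u] g, of "X u"] u by (simp add: spread_def)
  then show ?thesis unfolding beta_def ip_def by (rule Bochner_Integration.integral_cong[OF refl])
qed

text \<open>
  The \<open>T T*\<close> method: expanding the square and moving the average over \<open>u\<close> inside leaves the
  oscillatory integral with phase \<open>X u w - X u v\<close>.
\<close>

lemma ip_spread_le:
  assumes g: "test B S g" and X: "shift_fun K X" and S: "0 \<le> S"
    and \<eta>: "(\<lambda>(v, w). \<eta> v w) \<in> borel_measurable (M \<Otimes>\<^sub>M M)"
    and \<eta>_bd: "\<And>v w. v \<in> space M \<Longrightarrow> w \<in> space M \<Longrightarrow> \<bar>\<eta> v w\<bar> \<le> C"
    and osc: "\<And>v w x. v \<in> space M \<Longrightarrow> w \<in> space M \<Longrightarrow> \<bar>\<integral>u. g (w, x + (X u w - X u v)) \<partial>M\<bar> \<le> \<eta> v w"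
  shows "ip (spread X g) (spread X g) \<le> B * (2 * S) * (\<integral>v. \<integral>w. \<eta> v w \<partial>M \<partial>M)"
proof -
  have [measurable]: "g \<in> borel_measurable (M \<Otimes>\<^sub>M borel)" "(\<lambda>(u, v). X u v) \<in> borel_measurable (M \<Otimes>\<^sub>M M)"
    using g X by (auto simp: test_def shift_fun_def)
  \<comment> \<open>The variable x is recentred at the point of height v, so that u enters through
    the phase X u w - X u v alone.\<close>
  define k where "k u v w = (\<integral>x. g (v, x) * g (w, x + (X u w - X u v)) \<partial>lborel)" for u v w
  have kb: "\<bar>k u v w\<bar> \<le> B * B * (2 * S)" if "u \<in> space M" "v \<in> space M" "w \<in> space M" for u v w
  proof -
    have [measurable]: "(\<lambda>x. g (w, x)) \<in> borel_measurable borel"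
      using bounded_supportD(1)[OF test_slice[OF g that(3)]] .
    have "bounded_support (B * B) S (\<lambda>x. g (v, x) * g (w, x + (X u w - X u v)))"
      by (rule bounded_support_mult[OF test_slice[OF g that(2)]]) (use testD(2)[OF g] in auto)
    from integral_bounded_support[OF this S] show ?thesis unfolding k_def .
  qed
  have [measurable]: "(\<lambda>(u, v, w). k u v w) \<in> borel_measurable (M \<Otimes>\<^sub>M M \<Otimes>\<^sub>M M)"
    unfolding k_def by measurable
  have [measurable]: "(\<lambda>p. k (fst (fst p)) (snd (fst p)) (snd p)) \<in> borel_measurable ((M \<Otimes>\<^sub>M M) \<Otimes>\<^sub>M M)"
    unfolding k_def by measurable
  have inner: "(\<integral>x. spread X g (u, x) * g (v, x + X u v) \<partial>lborel) = (\<integral>w. k u v w \<partial>M)"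
    if "u \<in> space M" "v \<in> space M" for u v
  proof -
    have "(\<integral>x. spread X g (u, x) * g (v, x + X u v) \<partial>lborel)
        = (\<integral>x. g (v, x) * (\<integral>w. g (w, x + (X u w - X u v)) \<partial>M) \<partial>lborel)"
      using lborel_integral_shift[of "\<lambda>x. spread X g (u, x) * g (v, x + X u v)" "- X u v"] that
      by (simp add: spread_def algebra_simps)
    also have "\<dots> = (\<integral>w. k u v w \<partial>M)"
      unfolding k_def using Fubini_shift[OF test_slice[OF g that(2)] g, of "\<lambda>w. X u w - X u v"] that by simp
    finally show ?thesis .
  qed
  have "ip (spread X g) (spread X g) = (\<integral>u. \<integral>v. \<integral>x. spread X g (u, x) * g (v, x + X u v) \<partial>lborel \<partial>M \<partial>M)"
    using beta_eq_ip_spread[OF test_spread[OF g X] g X] by (simp add: beta_def)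
  also have "\<dots> = (\<integral>u. \<integral>v. \<integral>w. k u v w \<partial>M \<partial>M \<partial>M)"
    by (rule Bochner_Integration.integral_cong[OF refl], rule Bochner_Integration.integral_cong[OF refl], rule inner)
  also have "\<dots> = (\<integral>v. \<integral>u. \<integral>w. k u v w \<partial>M \<partial>M \<partial>M)"
  proof (rule two_level(4))
    show "(\<lambda>(u, v). \<integral>w. k u v w \<partial>M) \<in> borel_measurable (M \<Otimes>\<^sub>M M)" by measurable
    show "\<bar>\<integral>w. k u v w \<partial>M\<bar> \<le> B * B * (2 * S)" if "u \<in> space M" "v \<in> space M" for u v
      by (rule bounded_integrable(2)) (use that kb in auto)
  qed
  also have "\<dots> = (\<integral>v. \<integral>w. \<integral>u. k u v w \<partial>M \<partial>M \<partial>M)"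
  proof (rule Bochner_Integration.integral_cong[OF refl])
    fix v assume v: "v \<in> space M"
    show "(\<integral>u. \<integral>w. k u v w \<partial>M \<partial>M) = (\<integral>w. \<integral>u. k u v w \<partial>M \<partial>M)"
    proof (rule two_level(4))
      show "(\<lambda>(u, w). k u v w) \<in> borel_measurable (M \<Otimes>\<^sub>M M)"
        unfolding k_def using v by measurable
      show "\<bar>k u v w\<bar> \<le> B * B * (2 * S)" if "u \<in> space M" "w \<in> space M" for u w
        using kb that v by simp
    qed
  qed
  also have "\<dots> \<le> (\<integral>v. \<integral>w. B * (2 * S) * \<eta> v w \<partial>M \<partial>M)"
  proof -
    have ku: "\<bar>\<integral>u. k u v w \<partial>M\<bar> \<le> B * B * (2 * S)" if vw: "v \<in> space M" "w \<in> space M" for v w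
    proof (rule bounded_integrable(2))
      show "(\<lambda>u. k u v w) \<in> borel_measurable M" unfolding k_def using vw by measurable
    qed (use vw kb in auto)
    have mu: "(\<lambda>(v, w). \<integral>u. k u v w \<partial>M) \<in> borel_measurable (M \<Otimes>\<^sub>M M)"
      unfolding k_def by measurable
    have m\<eta>: "(\<lambda>(v, w). B * (2 * S) * \<eta> v w) \<in> borel_measurable (M \<Otimes>\<^sub>M M)"
      using borel_measurable_times[OF borel_measurable_const \<eta>] by (simp add: case_prod_unfold)
    have b\<eta>: "\<bar>B * (2 * S) * \<eta> v w\<bar> \<le> B * (2 * S) * C" if "v \<in> space M" "w \<in> space M" for v w
      unfolding abs_mult using \<eta>_bd[OF that] testD(4)[OF g] S by (intro mult_mono) auto
    have le: "(\<integral>u. k u v w \<partial>M) \<le> B * (2 * S) * \<eta> v w" if vw: "v \<in> space M" "w \<in> space M" for v w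
    proof -
      \<comment> \<open>With w frozen, g is read as a function of (u, x) that is constant in u; then
        \<open>Fubini_shift\<close> averages the phase over u.\<close>
      have tw: "test B S (\<lambda>(u, x). g (w, x))"
        using testD[OF g] vw unfolding test_def by auto
      let ?I = "\<lambda>x. \<integral>u. g (w, x + (X u w - X u v)) \<partial>M"
      have [measurable]: "?I \<in> borel_measurable borel" using vw by measurable
      have "(\<integral>u. k u v w \<partial>M) = (\<integral>x. g (v, x) * ?I x \<partial>lborel)"
        unfolding k_def using Fubini_shift[OF test_slice[OF g vw(1)] tw, of "\<lambda>u. X u w - X u v"] vw by simp
      moreover have "bounded_support (B * \<eta> v w) S (\<lambda>x. g (v, x) * ?I x)"
        by (rule bounded_support_mult[OF test_slice[OF g vw(1)]]) (use osc vw in auto)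
      ultimately show ?thesis using integral_bounded_support[of "B * \<eta> v w" S "\<lambda>x. g (v, x) * ?I x"] S by (simp add: mult_ac)
    qed
    show ?thesis
      by (rule integral_mono[OF two_level(2)[OF mu ku] two_level(2)[OF m\<eta> b\<eta>]],
          assumption, assumption, assumption, assumption,
          rule integral_mono[OF two_level(1)[OF mu ku] two_level(1)[OF m\<eta> b\<eta>] le])
  qed
  also have "\<dots> = B * (2 * S) * (\<integral>v. \<integral>w. \<eta> v w \<partial>M \<partial>M)" by simp
  finally show ?thesis .
qed

lemma ip_sq_nonneg: "0 \<le> ip f f"
  by (simp add: ip_def)

lemma kernel_ip:
  assumes f: "test B S f" and g: "test B' S' g"
  shows "kernel (B * B') S (\<lambda>(u, v, x). f (u, x) * g (u, x))"
proof -
  have [measurable]: "f \<in> borel_measurable (M \<Otimes>\<^sub>M borel)" "g \<in> borel_measurable (M \<Otimes>\<^sub>M borel)"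
    using f g by (auto simp: test_def)
  have m: "(\<lambda>(u, v, x). f (u, x) * g (u, x)) \<in> borel_measurable (M \<Otimes>\<^sub>M M \<Otimes>\<^sub>M borel)"
    by measurable
  have b: "\<bar>f (u, x) * g (u, x)\<bar> \<le> B * B'" for u x
    unfolding abs_mult using testD(2,4)[OF f] testD(2,4)[OF g] by (intro mult_mono) auto
  have z: "S < \<bar>x\<bar> \<Longrightarrow> f (u, x) * g (u, x) = 0" for u x
    using testD(3)[OF f] by simp
  show ?thesis
    unfolding kernel_def prod.case using b z m by (intro conjI ballI allI impI)
qed

lemma ip_eq_tri_integral: "ip f g = tri_integral (\<lambda>(u, v, x). f (u, x) * g (u, x))"
  by (simp add: ip_def tri_integral_def prob_space)

lemma ip_commute: "ip f g = ip g f"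
  by (simp add: ip_def mult.commute)

lemma ip_scale_left: "ip (\<lambda>p. c * f p) g = c * ip f g"
  by (simp add: ip_def mult.assoc)

lemma ip_add_left:
  assumes "f \<in> tests" "f' \<in> tests" "g \<in> tests"
  shows "ip (\<lambda>p. f p + f' p) g = ip f g + ip f' g"
proof -
  obtain B S B' S' B'' S'' where T: "test B S f" "test B' S' f'" "test B'' S'' g" using assms by (auto simp: tests_def)
  show ?thesis unfolding ip_eq_tri_integral
    by (subst tri_integral_add[OF kernel_ip[OF T(1,3)] kernel_ip[OF T(2,3)], symmetric])
       (auto intro!: arg_cong[of _ _ tri_integral] simp: fun_eq_iff distrib_right)
qed

lemma ip_diff_left:
  assumes "f \<in> tests" "f' \<in> tests" "g \<in> tests"
  shows "ip (\<lambda>p. f p - f' p) g = ip f g - ip f' g"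
  using ip_add_left[OF assms(1) tests_scale[OF assms(2), of "-1"] assms(3)] ip_scale_left[of "-1" f' g] by simp

lemma ip_diff_right:
  assumes "f \<in> tests" "f' \<in> tests" "g \<in> tests"
  shows "ip g (\<lambda>p. f p - f' p) = ip g f - ip g f'"
  using ip_diff_left[OF assms] by (simp add: ip_commute)

lemma ip_diff_diff:
  assumes "f \<in> tests" "g \<in> tests"
  shows "ip (\<lambda>p. f p - g p) (\<lambda>p. f p - g p) = ip f f - 2 * ip f g + ip g g"
  using assms by (simp add: ip_diff_left ip_diff_right tests_diff ip_commute)

text \<open>Cauchy-Schwarz in weighted form, from the square of f - t g. The weight t stays free so
  that \<open>abs_beta_le\<close> can balance a large norm of f against a small norm of
  \<open>spread X g\<close>.\<close>

lemma ip_le: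
  assumes f: "f \<in> tests" and g: "g \<in> tests" and t: "0 < t"
  shows "ip f g \<le> (ip f f / t + t * ip g g) / 2"
proof -
  have "0 \<le> ip (\<lambda>p. f p - t * g p) (\<lambda>p. f p - t * g p)" by (rule ip_sq_nonneg)
  also have "\<dots> = ip f f - 2 * (t * ip f g) + t * (t * ip g g)"
    using ip_diff_diff[OF f tests_scale[OF g, of t]] by (simp add: ip_scale_left ip_commute[of _ "\<lambda>p. t * g p"] ip_commute[of f g])
  finally show ?thesis using t by (simp add: field_simps)
qed

lemma abs_ip_le:
  assumes f: "f \<in> tests" and g: "g \<in> tests" and t: "0 < t"
  shows "\<bar>ip f g\<bar> \<le> (ip f f / t + t * ip g g) / 2"
  using ip_le[OF assms] ip_le[OF tests_scale[OF f, of "-1"] g t] ip_scale_left[of "-1" f]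
    ip_commute[of f "\<lambda>p. - 1 * f p"] by auto

lemma ip_bounded:
  assumes f: "test B S f" and S: "0 \<le> S"
  shows "ip f f \<le> B * B * (2 * S)"
proof -
  have b: "\<bar>\<integral>x. f (u, x) * f (u, x) \<partial>lborel\<bar> \<le> B * B * (2 * S)" if u: "u \<in> space M" for u
    using integral_bounded_support[OF bounded_support_mult[OF test_slice[OF f u] bounded_supportD(1,2)[OF test_slice[OF f u]]] S] .
  have [measurable]: "f \<in> borel_measurable (M \<Otimes>\<^sub>M borel)" using f by (rule testD(1))
  have "(\<lambda>u. \<integral>x. f (u, x) * f (u, x) \<partial>lborel) \<in> borel_measurable M" by measurable
  from bounded_integrable(2)[OF this b] show ?thesis unfolding ip_def by (auto simp: abs_le_iff)
qed

lemma abs_beta_le: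
  assumes f: "test B' S' f" and g: "test B S g" and X: "shift_fun K X" and S: "0 \<le> S" "0 \<le> S'" and t: "0 < t"
    and \<eta>: "(\<lambda>(v, w). \<eta> v w) \<in> borel_measurable (M \<Otimes>\<^sub>M M)"
    and \<eta>_bd: "\<And>v w. v \<in> space M \<Longrightarrow> w \<in> space M \<Longrightarrow> \<bar>\<eta> v w\<bar> \<le> C"
    and osc: "\<And>v w x. v \<in> space M \<Longrightarrow> w \<in> space M \<Longrightarrow> \<bar>\<integral>u. g (w, x + (X u w - X u v)) \<partial>M\<bar> \<le> \<eta> v w"
  shows "\<bar>beta X f g\<bar> \<le> B' * B' * S' / t + t * B * S * (\<integral>v. \<integral>w. \<eta> v w \<partial>M \<partial>M)"
proof -
  have "\<bar>beta X f g\<bar> \<le> (ip f f / t + t * ip (spread X g) (spread X g)) / 2"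
    unfolding beta_eq_ip_spread[OF f g X]
    by (rule abs_ip_le[OF testI_tests[OF f] testI_tests[OF test_spread[OF g X]] t])
  also have "\<dots> \<le> (B' * B' * (2 * S') / t + t * (B * (2 * S) * (\<integral>v. \<integral>w. \<eta> v w \<partial>M \<partial>M))) / 2"
    using ip_spread_le[OF g X S(1) \<eta> \<eta>_bd osc] ip_bounded[OF f S(2)] t
    by (intro divide_right_mono add_mono mult_left_mono) auto
  also have "\<dots> = B' * B' * S' / t + t * B * S * (\<integral>v. \<integral>w. \<eta> v w \<partial>M \<partial>M)"
    by (simp add: add_divide_distrib algebra_simps)
  finally show ?thesis .
qed

end

section \<open>The Dirichlet kernel\<close>

definition dirichlet :: "nat \<Rightarrow> real \<Rightarrow> real" where
  "dirichlet n t = 1 + 2 * (\<Sum>j=1..n. cos (real j * t))"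

lemma dirichlet_sin: "dirichlet n t * sin (t / 2) = sin ((real n + 1 / 2) * t)"
proof (induction n)
  case (Suc n)
  have "2 * cos ((real n + 1) * t) * sin (t / 2) = sin ((real n + 1) * t + t / 2) - sin ((real n + 1) * t - t / 2)"
    by (simp add: sin_add sin_diff)
  moreover have "(real n + 1) * t + t / 2 = (real (Suc n) + 1 / 2) * t" "(real n + 1) * t - t / 2 = (real n + 1 / 2) * t"
    by (simp_all add: algebra_simps)
  ultimately show ?case using Suc by (simp add: dirichlet_def algebra_simps)
qed (simp add: dirichlet_def)

lemma dirichlet_minus [simp]: "dirichlet n (- t) = dirichlet n t"
  by (simp add: dirichlet_def)

lemma sin_sq_le: "(sin x)\<^sup>2 \<le> (x::real)\<^sup>2"
  using abs_sin_x_le_abs_x[of x] by (simp only: abs_le_square_iff)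

text \<open>From sin (pi / 12) \<le> pi / 12 and the cosine of pi / 6 one gets pi^2 \<ge> 72 * (1 -
  sqrt 3 / 2) > 9.64, while 3.1^2 = 9.61.\<close>

lemma pi_ge_31_10: "31 / 10 \<le> pi"
proof -
  have s: "sqrt 3 \<le> 17321 / 10000" by (rule real_le_lsqrt) (auto simp: power2_eq_square)
  have "sqrt 3 / 2 = 1 - 2 * (sin (pi / 12))\<^sup>2"
    using cos_double_sin[of "pi / 12"] cos_30 by simp
  moreover have "(sin (pi / 12))\<^sup>2 \<le> (pi / 12)\<^sup>2" by (rule sin_sq_le)
  ultimately have "(31 / 10)\<^sup>2 \<le> pi\<^sup>2" using s by (simp add: power2_eq_square)
  then show ?thesis using power2_le_imp_le pi_ge_zero by blast
qed

lemma sin_ge_cubic: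
  assumes "0 \<le> z" shows "z - z ^ 3 / 2 \<le> sin (z::real)"
proof (cases "z = 0")
  case False
  then have z: "0 < z" using assms by simp
  obtain w where w: "0 < w" "w < z" "sin z - sin 0 = (z - 0) * cos w"
    using MVT2[OF z, of sin cos] DERIV_sin by blast
  have "(sin (w / 2))\<^sup>2 \<le> (w / 2)\<^sup>2" by (rule sin_sq_le)
  moreover have "cos w = 1 - 2 * (sin (w / 2))\<^sup>2" using cos_double_sin[of "w / 2"] by simp
  moreover have "w\<^sup>2 \<le> z\<^sup>2" using w by (intro power_mono) auto
  ultimately have "1 - z\<^sup>2 / 2 \<le> cos w" by (simp add: power2_eq_square)
  then have "z * (1 - z\<^sup>2 / 2) \<le> sin z" using w z mult_left_mono[of "1 - z\<^sup>2 / 2" "cos w" z] by simp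
  then show ?thesis by (simp add: algebra_simps power2_eq_square power3_eq_cube)
qed simp

text \<open>With x = 301 t / 2 the closed form gives \<open>dirichlet 150 t\<close> = 301 sin x /
  (301 sin (x / 301)), whose denominator is close to x where it matters. A negative numerator occurs
  only beyond pi. Up to pi + 1 use - sin x \<le> x - pi; afterwards - sin x \<le> 1, while the
  denominator has already reached almost pi + 1. Both cases give about 1 / (pi + 1) = 0.2415, and
  0.245 leaves room for the estimates of pi and of the sine.\<close>

lemma dirichlet_ge: "- (245 / 1000 * 301) \<le> dirichlet 150 t" if t: "\<bar>t\<bar> \<le> pi"
proof -
  have main: "- (245 / 1000 * 301) \<le> dirichlet 150 t" if t: "0 < t" "t \<le> pi" for t
  proof -
    define s x where "s = sin (t / 2)" and "x = 301 * t / 2"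
    have s: "0 < s" unfolding s_def using t pi_gt_zero by (intro sin_gt_zero) linarith+
    have D: "dirichlet 150 t * s = sin x"
      using dirichlet_sin[of 150 t] by (simp add: s_def x_def algebra_simps)
    \<comment> \<open>The cubic loss is at most 5^3 / (2 * 301^2) < 0.0007; the range up to 5
      contains pi + 1.\<close>
    have cub: "z - 1 / 1000 \<le> 301 * sin (z / 301)" if z: "0 \<le> z" "z \<le> 5" for z :: real
    proof -
      have "z ^ 3 \<le> 5 ^ 3" using z by (intro power_mono) auto
      then have "z / 301 - sin (z / 301) \<le> 5 ^ 3 / 301 ^ 3 / 2"
        using sin_ge_cubic[of "z / 301"] z by (simp add: power_divide)
      then show ?thesis by simp
    qed
    have "- sin x \<le> 245 / 1000 * (301 * s)"
    proof -
      consider "x \<le> pi" | "pi < x" "x \<le> pi + 1" | "pi + 1 < x" by linarith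
      then show ?thesis
      proof cases
        case 1
        then have "0 \<le> sin x" using t by (intro sin_ge_zero) (auto simp: x_def)
        then show ?thesis using s by simp
      next
        case 2
        have "- sin x = sin (x - pi)" by (simp add: sin_diff)
        also have "\<dots> \<le> x - pi" using sin_x_le_x[of "x - pi"] 2 by simp
        finally have "- sin x \<le> x - pi" .
        moreover have "x - 1 / 1000 \<le> 301 * s"
          using cub[of x] t(1) 2 pi_less_4 pi_gt_zero by (simp add: s_def x_def)
        ultimately show ?thesis using 2 pi_ge_31_10 by simp
      next
        case 3
        have "sin ((pi + 1) / 301) \<le> s"
          unfolding s_def
        proof (rule sin_monotone_2pi_le)
          show "- (pi / 2) \<le> (pi + 1) / 301" using pi_gt_zero by (simp add: field_simps)
          show "(pi + 1) / 301 \<le> t / 2" using 3 by (simp add: x_def)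
          show "t / 2 \<le> pi / 2" using t by simp
        qed
        then have "pi + 1 - 1 / 1000 \<le> 301 * s"
          using cub[of "pi + 1"] pi_less_4 pi_gt_zero by simp
        then have "1 \<le> 245 / 1000 * (301 * s)" using pi_ge_31_10 by simp
        then show ?thesis using sin_ge_minus_one[of x] by linarith
      qed
    qed
    then have "- (245 / 1000 * 301) * s \<le> dirichlet 150 t * s" unfolding D by simp
    then show ?thesis using s mult_le_cancel_right_pos by blast
  qed
  consider "t = 0" | "0 < t" | "0 < -t" by linarith
  then show ?thesis
  proof cases
    case 1 then show ?thesis by (simp add: dirichlet_def)
  next
    case 2 then show ?thesis using main t by simp
  next
    case 3 then show ?thesis using main[of "-t"] t by simp
  qed
qed

lemma has_integral_cos_int:
  fixes k :: int
  shows "((\<lambda>t::real. cos (k * t)) has_integral (if k = 0 then 2 * pi else 0)) {-pi..pi}"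
proof (cases "k = 0")
  case True
  then show ?thesis using has_integral_const_real[of "1 :: real" "-pi" pi] by simp
next
  case False
  have "((\<lambda>t::real. cos (k * t)) has_integral (sin (k * pi) / k - sin (k * (-pi)) / k)) {-pi..pi}"
    by (rule fundamental_theorem_of_calculus)
       (use False in \<open>auto intro!: derivative_eq_intros simp flip: has_real_derivative_iff_has_vector_derivative\<close>)
  moreover have "sin (k * pi) = 0" using sin_zero_iff_int2 by blast
  ultimately show ?thesis using False by simp
qed

text \<open>The Fourier coefficients of the kernel are the indicator of the band, so conditions such
  as |a - b| \<le> n turn into integrals against it.\<close>

lemma has_integral_dirichlet_cos:
  fixes k :: int
  shows "((\<lambda>t::real. dirichlet n t * cos (k * t)) has_integral (if \<bar>k\<bar> \<le> int n then 2 * pi else 0)) {-pi..pi}"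
proof -
  have "((\<lambda>t::real. cos (k * t) + (\<Sum>j=1..n. cos (real_of_int (k + int j) * t) + cos (real_of_int (k - int j) * t))) has_integral
      (if k = 0 then 2 * pi else 0) + (\<Sum>j=1..n. (if k + int j = 0 then 2 * pi else 0) + (if k - int j = 0 then 2 * pi else 0))) {-pi..pi}"
    by (intro has_integral_add has_integral_sum has_integral_cos_int) auto
  moreover have "cos (k * t) + (\<Sum>j=1..n. cos (real_of_int (k + int j) * t) + cos (real_of_int (k - int j) * t)) = dirichlet n t * cos (k * t)" for t :: real
    by (simp add: dirichlet_def distrib_right sum_distrib_left sum_distrib_right cos_add cos_diff algebra_simps)
  moreover have "(if k = 0 then 2 * pi else 0) + (\<Sum>j=1..n. (if k + int j = 0 then 2 * pi else 0) + (if k - int j = 0 then 2 * pi else 0))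
      = (if \<bar>k\<bar> \<le> int n then 2 * pi else 0)"
  proof -
    have e: "(if k + int j = 0 then 2 * pi else 0) = (if j = nat (-k) \<and> k \<le> 0 then 2 * pi else 0)"
      "(if k - int j = 0 then 2 * pi else 0) = (if j = nat k \<and> 0 \<le> k then 2 * pi else 0)" for j
      by auto
    consider "k = 0" | "k > 0" | "k < 0" by linarith
    then show ?thesis
      unfolding e sum.distrib by cases (auto simp: sum.delta)
  qed
  ultimately show ?thesis by (simp only:)
qed

text \<open>
  The reflection principle: after extending the vector oddly about \<open>(c + n) / 2\<close>, the part of the band
  matrix with \<open>a + b < c\<close> becomes a full Toeplitz matrix with symbol \<open>dirichlet n\<close>. On the level of
  Fourier transforms the odd extension is the sine transform centred at \<open>(c + n) / 2\<close>.
\<close>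

lemma gram_band_ge:
  fixes x :: "nat \<Rightarrow> nat \<Rightarrow> real" and A n c :: nat and m :: real
  assumes psd: "\<And>w. 0 \<le> (\<Sum>a<A. \<Sum>b<A. w a * w b * x a b)"
    and m: "\<And>t. \<bar>t\<bar> \<le> pi \<Longrightarrow> - m \<le> dirichlet n t" and m0: "0 \<le> m"
  shows "- m * (\<Sum>a<A. x a a) \<le> (\<Sum>a<A. \<Sum>b<A. if a + b < c \<and> a \<le> b + n \<and> b \<le> a + n then x a b else 0)"
proof -
  \<comment> \<open>The indices strictly below the centre of reflection; on them the sine vectors
    \<open>s t\<close> live.\<close>
  define I where "I a \<longleftrightarrow> 2 * a < c + n" for a
  define s where "s t a = (if I a then sin ((real a - (real c + real n) / 2) * t) else 0)" for t a
  define q where "q a b = (if a + b < c \<and> a \<le> b + n \<and> b \<le> a + n then 1 else 0) + (if a = b \<and> I a then m else (0::real))" for a b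
  have int: "((\<lambda>t. (dirichlet n t + m) * (s t a * s t b)) has_integral (pi * q a b)) {-pi..pi}" for a b
  proof (cases "I a \<and> I b")
    case True
    let ?k = "int a - int b" and ?l = "int a + int b - int c - int n"
    have "(\<lambda>t::real. (dirichlet n t + m) * (s t a * s t b)) =
      (\<lambda>t::real. (1/2) * ((dirichlet n t * cos (?k * t) + m * cos (?k * t)) - (dirichlet n t * cos (?l * t) + m * cos (?l * t))))"
    proof
      fix t :: real
      have pq: "(d + m) * ((p - q) / 2) = (1/2) * ((d * p + m * p) - (d * q + m * q))" for d p q :: real
        by (simp add: field_simps)
      let ?u = "(real a - (real c + real n) / 2) * t" and ?v = "(real b - (real c + real n) / 2) * t"
      have "?u - ?v = ?k * t" "?u + ?v = ?l * t" by (simp_all add: algebra_simps)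
      moreover have "sin ?u * sin ?v = (cos (?u - ?v) - cos (?u + ?v)) / 2" by (simp add: cos_add cos_diff)
      ultimately have "s t a * s t b = (cos (?k * t) - cos (?l * t)) / 2" using True by (simp add: s_def)
      then show "(dirichlet n t + m) * (s t a * s t b) = (1/2) * ((dirichlet n t * cos (?k * t) + m * cos (?k * t)) - (dirichlet n t * cos (?l * t) + m * cos (?l * t)))"
        by (simp only: pq)
    qed
    moreover have "(\<dots> has_integral (1/2) * (((if \<bar>?k\<bar> \<le> int n then 2 * pi else 0) + m * (if ?k = 0 then 2 * pi else 0))
       - ((if \<bar>?l\<bar> \<le> int n then 2 * pi else 0) + m * (if ?l = 0 then 2 * pi else 0)))) {-pi..pi}"
      by (intro has_integral_mult_right has_integral_diff has_integral_add has_integral_dirichlet_cos has_integral_cos_int)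
    moreover have "(1/2) * (((if \<bar>?k\<bar> \<le> int n then 2 * pi else 0) + m * (if ?k = 0 then 2 * pi else 0))
       - ((if \<bar>?l\<bar> \<le> int n then 2 * pi else 0) + m * (if ?l = 0 then 2 * pi else 0))) = pi * q a b"
    proof -
      \<comment> \<open>\<open>?l\<close> is the index difference between a and the mirror image of
        b. For a, b below the centre it is negative, and |\<open>?l\<close>| \<le> n holds exactly
        if a + b \<ge> c. Then also a - b = 2 a - (a + b) < n, and symmetrically, so the mirror term
        deletes precisely the band entries with a + b \<ge> c.\<close>
      have "?l \<noteq> 0" using True by (auto simp: I_def)
      moreover have "\<bar>?l\<bar> \<le> int n \<longleftrightarrow> c \<le> a + b" using True by (auto simp: I_def)
      moreover have "c \<le> a + b \<Longrightarrow> \<bar>?k\<bar> \<le> int n" using True by (auto simp: I_def)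
      moreover have "\<bar>?k\<bar> \<le> int n \<longleftrightarrow> a \<le> b + n \<and> b \<le> a + n" by auto
      ultimately show ?thesis using True by (auto simp: q_def algebra_simps)
    qed
    ultimately show ?thesis by simp
  next
    case False
    then have "s t a * s t b = 0" for t by (auto simp: s_def)
    then have "(\<lambda>t. (dirichlet n t + m) * (s t a * s t b)) = (\<lambda>_. 0)" by (simp only: mult_zero_right)
    \<comment> \<open>If a is not below the centre, then 2 a \<ge> c + n, and a + b < c would force
      a - b > n; hence no entry of the band is lost. The same holds for b.\<close>
    moreover have "q a b = 0" using False by (auto simp: q_def I_def)
    ultimately show ?thesis by (simp only: mult_zero_right has_integral_0)
  qed
  have "((\<lambda>t. \<Sum>a<A. \<Sum>b<A. (dirichlet n t + m) * (s t a * s t b) * x a b) has_integral (\<Sum>a<A. \<Sum>b<A. pi * q a b * x a b)) {-pi..pi}"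
    by (intro has_integral_sum has_integral_mult_left int) auto
  moreover have "0 \<le> (\<Sum>a<A. \<Sum>b<A. (dirichlet n t + m) * (s t a * s t b) * x a b)" if "t \<in> {-pi..pi}" for t
  proof -
    have "\<bar>t\<bar> \<le> pi" using that by (simp add: abs_le_iff)
    then have "0 \<le> dirichlet n t + m" using m[of t] by linarith
    then have "0 \<le> (dirichlet n t + m) * (\<Sum>a<A. \<Sum>b<A. s t a * s t b * x a b)"
      using psd[of "s t"] by (intro mult_nonneg_nonneg)
    then show ?thesis by (simp add: sum_distrib_left mult.assoc)
  qed
  ultimately have "0 \<le> (\<Sum>a<A. \<Sum>b<A. pi * q a b * x a b)" by (rule has_integral_nonneg)
  also have "\<dots> = pi * (\<Sum>a<A. \<Sum>b<A. q a b * x a b)" by (simp add: sum_distrib_left mult.assoc)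
  finally have "0 \<le> (\<Sum>a<A. \<Sum>b<A. q a b * x a b)"
    using pi_gt_zero by (simp only: zero_le_mult_iff) linarith
  also have "\<dots> = (\<Sum>a<A. \<Sum>b<A. (if a + b < c \<and> a \<le> b + n \<and> b \<le> a + n then x a b else 0) + (if b = a then (if I a then m * x a a else 0) else 0))"
    by (intro sum.cong refl) (auto simp: q_def distrib_right)
  also have "\<dots> = (\<Sum>a<A. \<Sum>b<A. if a + b < c \<and> a \<le> b + n \<and> b \<le> a + n then x a b else 0) + (\<Sum>a<A. if I a then m * x a a else 0)"
    by (simp add: sum.distrib sum.delta)
  finally have *: "0 \<le> (\<Sum>a<A. \<Sum>b<A. if a + b < c \<and> a \<le> b + n \<and> b \<le> a + n then x a b else 0) + (\<Sum>a<A. if I a then m * x a a else 0)" .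
  have diag: "0 \<le> x a a" if "a < A" for a
  proof -
    have "(\<Sum>b<A. \<Sum>b'<A. (if b = a then 1 else 0) * (if b' = a then 1 else 0) * x b b') = (\<Sum>b<A. if b = a then x a a else 0)"
      using that by (intro sum.cong refl) (auto simp: if_distrib[of "\<lambda>r. r * _"] sum.delta cong: if_cong)
    then show ?thesis using psd[of "\<lambda>b. if b = a then 1 else 0"] that by (simp add: sum.delta)
  qed
  have "(\<Sum>a<A. if I a then m * x a a else 0) \<le> m * (\<Sum>a<A. x a a)"
    unfolding sum_distrib_left using diag m0 by (intro sum_mono) auto
  then show ?thesis using * by simp
qed

section \<open>One pair of strips, split at two scales\<close>

context prob_space
begin

abbreviation beta0 :: "('a \<times> real \<Rightarrow> real) \<Rightarrow> ('a \<times> real \<Rightarrow> real) \<Rightarrow> real" where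
  "beta0 \<equiv> beta (\<lambda>_ _. 0)"

text \<open>The form is negligible on what averaging at scale L removes. The bound 4 admits both
  functions bounded by 2 and the differences of two of their averages, as they occur in
  \<open>beta_two_scale\<close>.\<close>

definition oscillating :: "real \<Rightarrow> real \<Rightarrow> ('a \<Rightarrow> 'a \<Rightarrow> real) \<Rightarrow> bool" where
  "oscillating L \<delta> X \<longleftrightarrow> (\<forall>S f g. L \<le> S \<longrightarrow> test 4 S f \<longrightarrow> test 4 S g \<longrightarrow>
     \<bar>beta X f (\<lambda>p. g p - avg L g p)\<bar> \<le> \<delta> * S)"

text \<open>With shift 0 the form separates: \<open>beta0 f f\<close> is the integral of the square
  of x -> mean of f (u, x) over u.\<close>

lemma beta0_nonneg:
  assumes "f \<in> tests" shows "0 \<le> beta0 f f"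
proof -
  obtain B S where f: "test B S f" using assms by (auto simp: tests_def)
  define h where "h x = (\<integral>v. f (v, x) \<partial>M)" for x
  have hs: "spread (\<lambda>_ _. 0) f (u, x) = h x" if "u \<in> space M" for u x
    using that by (simp add: spread_def h_def)
  have "beta0 f f = (\<integral>u. \<integral>x. f (u, x) * h x \<partial>lborel \<partial>M)"
    unfolding beta_eq_ip_spread[OF f f shift_fun_zero] ip_def
    by (rule Bochner_Integration.integral_cong[OF refl]) (simp add: hs)
  also have "\<dots> = (\<integral>x. \<integral>u. f (u, x) * h x \<partial>M \<partial>lborel)"
  proof -
    have [measurable]: "f \<in> borel_measurable (M \<Otimes>\<^sub>M borel)" using f by (rule testD(1))
    have [measurable]: "h \<in> borel_measurable borel" unfolding h_def by measurable
    have hb: "\<bar>h x\<bar> \<le> B" for x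
      unfolding h_def by (rule bounded_integrable(2)) (use testD(2)[OF f] in auto)
    have fh: "\<bar>f (u, x) * h x\<bar> \<le> B * B" for u x
      unfolding abs_mult using testD(2,4)[OF f] hb by (intro mult_mono) auto
    have m: "(\<lambda>(u, x). f (u, x) * h x) \<in> borel_measurable (M \<Otimes>\<^sub>M borel)" by measurable
    have "test (B * B) S (\<lambda>(u, x). f (u, x) * h x)"
      unfolding test_def using m fh testD(3)[OF f] by auto
    from Fubini_test[OF this] show ?thesis by simp
  qed
  also have "\<dots> = (\<integral>x. h x * h x \<partial>lborel)" by (simp add: h_def)
  also have "\<dots> \<ge> 0" by simp
  finally show ?thesis .
qed

lemma beta0_gram:
  fixes A :: nat
  assumes F: "\<And>a. F a \<in> tests"
  shows "0 \<le> (\<Sum>a<A. \<Sum>b<A. w a * w b * beta0 (F a) (F b))"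
proof -
  have G: "(\<lambda>p. w a * F a p) \<in> tests" for a by (rule tests_scale[OF F])
  have "0 \<le> beta0 (\<lambda>p. \<Sum>a<A. w a * F a p) (\<lambda>p. \<Sum>a<A. w a * F a p)"
    by (rule beta0_nonneg[OF tests_sum[OF G]])
  also have "\<dots> = (\<Sum>a<A. \<Sum>b<A. beta0 (\<lambda>p. w a * F a p) (\<lambda>p. w b * F b p))"
  proof -
    have "beta0 (\<lambda>p. \<Sum>a<A. w a * F a p) (\<lambda>p. \<Sum>a<A. w a * F a p) = (\<Sum>a<A. beta0 (\<lambda>p. w a * F a p) (\<lambda>p. \<Sum>a<A. w a * F a p))"
      by (rule beta_sum_left[OF G tests_sum[OF G] shift_fun_zero])
    also have "\<dots> = (\<Sum>a<A. \<Sum>b<A. beta0 (\<lambda>p. w a * F a p) (\<lambda>p. w b * F b p))"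
      by (intro sum.cong refl beta_sum_right[OF G G shift_fun_zero])
    finally show ?thesis .
  qed
  also have "\<dots> = (\<Sum>a<A. \<Sum>b<A. w a * w b * beta0 (F a) (F b))"
    by (simp add: beta_scale_left beta_scale_right mult.assoc)
  finally show ?thesis .
qed

lemma ip_avg_le:
  assumes f: "f \<in> tests" and L: "L > 0"
  shows "ip (avg L f) (avg L f) \<le> ip f f"
proof -
  have "0 \<le> ip (\<lambda>p. f p - avg L f p) (\<lambda>p. f p - avg L f p)" by (rule ip_sq_nonneg)
  also have "\<dots> = ip f f - 2 * ip f (avg L f) + ip (avg L f) (avg L f)"
    by (rule ip_diff_diff[OF f tests_avg[OF f L]])
  also have "ip (avg L f) (avg L f) = ip f (avg L f)"
    using ip_avg[OF f tests_avg[OF f L] L] by (simp add: avg_idem[OF L])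
  finally show ?thesis using ip_avg[OF f tests_avg[OF f L] L] by (simp add: avg_idem[OF L])
qed

lemma test_band:
  assumes f: "test B S f" and L: "0 < L" "L \<le> L'"
  shows "test (2 * B) (S + L') (\<lambda>p. avg L f p - avg L' f p)"
proof -
  have "test B (S + L') (avg L f)" by (rule test_mono[OF test_avg[OF f L(1)]]) (use L in auto)
  from test_diff[OF this test_avg[OF f]] L show ?thesis by simp
qed

text \<open>L is far below the offsets and L' far above. Split both functions into fine, middle and
  coarse parts. Fine parts are negligible by \<open>oscillating\<close>, for f by way of the
  adjoint. Against a coarse part X may be replaced by 0, and then middle and coarse are orthogonal
  because the grids are nested. What survives is coarse with coarse, which equals
  \<open>beta0 f (avg L' g)\<close>, and middle with middle. The errors sum to (1 + 48 + 2 + 128) *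
  \<delta> * S.\<close>

lemma beta_two_scale:
  assumes f: "test 2 S f" and g: "test 2 S g" and L: "0 < L" and m: "0 < m" and L': "L' = real m * L"
    and X: "shift_fun K X" and K: "K \<le> L'" "K \<le> \<delta> * L'" and S: "L' \<le> S" and \<delta>: "0 \<le> \<delta>"
    and osc: "oscillating L \<delta> X" "oscillating L \<delta> (\<lambda>v u. - X u v)"
  shows "beta0 f (avg L' g) + beta X (\<lambda>p. avg L f p - avg L' f p) (\<lambda>p. avg L g p - avg L' g p) - 200 * \<delta> * S
     \<le> beta X f g"
proof -
  have LL': "L \<le> L'" "0 < L'" using m L by (auto simp: L' intro: mult_ge1_I)
  define E where "E = avg L" define E' where "E' = avg L'"
  define Df where "Df = (\<lambda>p. E f p - E' f p)" define Dg where "Dg = (\<lambda>p. E g p - E' g p)"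
  note T = testI_tests[OF f] testI_tests[OF g]
  note TE = tests_avg[OF T(1) L, folded E_def] tests_avg[OF T(2) L, folded E_def]
    tests_avg[OF T(1) LL'(2), folded E'_def] tests_avg[OF T(2) LL'(2), folded E'_def]
  note X' = shift_fun_adjoint[OF X]
  have Dg: "test 4 (2 * S) Dg"
    using test_mono[OF test_band[OF g L LL'(1)], of 4 "2 * S"] S by (simp add: Dg_def E_def E'_def)
  have TD: "Dg \<in> tests" by (rule testI_tests[OF Dg])
  have f4: "test 4 (2 * S) f" "test 4 S f" "test 4 S g" using f g S LL' by (auto elim: test_mono)
  have err: "2 * B * B' * K * (2 * S' + 4 * L') / L' \<le> 2 * B * B' * \<delta> * (2 * S' + 4 * L')"
    if "0 \<le> B" "0 \<le> B'" "0 \<le> S'" for B B' S' :: real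
  proof -
    have "2 * B * B' * (2 * S' + 4 * L') * K \<le> 2 * B * B' * (2 * S' + 4 * L') * (\<delta> * L')"
      using that K LL' by (intro mult_left_mono) auto
    then show ?thesis using LL' by (simp add: divide_le_eq mult_ac)
  qed
  have 1: "beta X f g = beta X f (\<lambda>p. g p - E g p) + beta X f (E' g) + beta X f Dg"
    unfolding Dg_def by (simp add: beta_diff_right[OF T(1) _ _ X] T TE)
  have 2: "\<bar>beta X f (\<lambda>p. g p - E g p)\<bar> \<le> \<delta> * S"
    using osc(1) f4 S LL' by (auto simp: oscillating_def E_def)
  have 3: "\<bar>beta X f (E' g) - beta0 f (E' g)\<bar> \<le> 48 * \<delta> * S"
  proof -
    have "\<bar>beta X f (E' g) - beta0 f (E' g)\<bar> \<le> 2 * 2 * 2 * \<delta> * (2 * S + 4 * L')"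
      using beta_avg_shift[OF f g X K(1) LL'(2)] err[of 2 2 S] S LL' by (simp add: E'_def)
    also have "\<dots> \<le> 2 * 2 * 2 * \<delta> * (6 * S)" using \<delta> S by (intro mult_left_mono) auto
    finally show ?thesis by simp
  qed
  have 4: "beta X f Dg = beta X (\<lambda>p. f p - E f p) Dg + beta X (E' f) Dg + beta X Df Dg"
    unfolding Df_def by (simp add: beta_diff_left[OF _ _ TD X] T TE)
  have 5: "\<bar>beta X (\<lambda>p. f p - E f p) Dg\<bar> \<le> \<delta> * (2 * S)"
    unfolding beta_adjoint[OF tests_diff[OF T(1) TE(1)] TD X]
    using osc(2) f4 Dg S LL' by (auto simp: oscillating_def E_def)
  have 6: "\<bar>beta X (E' f) Dg - beta0 Dg (E' f)\<bar> \<le> 128 * \<delta> * S"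
  proof -
    have "\<bar>beta X (E' f) Dg - beta0 Dg (E' f)\<bar> \<le> 2 * 4 * 2 * \<delta> * (2 * (2 * S) + 4 * L')"
      unfolding beta_adjoint[OF TE(3) TD X]
      using beta_avg_shift[OF Dg f X' K(1) LL'(2)] err[of 4 2 "2 * S"] S LL' by (simp add: E'_def)
    also have "\<dots> \<le> 2 * 4 * 2 * \<delta> * (8 * S)" using \<delta> S by (intro mult_left_mono) auto
    finally show ?thesis by simp
  qed
  have 7: "beta0 Dg (E' f) = 0"
  proof -
    have EE': "E (E' f) = E' f" unfolding E_def E'_def L' by (rule avg_coarse[OF L m])
    have "beta0 Dg (E' f) = beta0 (E g) (E' f) - beta0 (E' g) (E' f)"
      unfolding Dg_def by (rule beta_diff_left[OF TE(2,4,3) shift_fun_zero])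
    also have "beta0 (E g) (E' f) = beta0 g (E' f)"
      using beta0_avg[OF T(2) TE(3) L] EE' by (simp add: E_def)
    also have "beta0 (E' g) (E' f) = beta0 g (E' f)"
      using beta0_avg[OF T(2) TE(3) LL'(2)] avg_idem[OF LL'(2), of f] by (simp add: E'_def)
    finally show ?thesis by simp
  qed
  have "0 \<le> \<delta> * S" using \<delta> S LL' by simp
  then have "beta0 f (E' g) + beta X Df Dg - 200 * \<delta> * S \<le> beta X f g"
    using 1 2 3 4 5 6 7 by (simp only: abs_le_iff) linarith
  then show ?thesis by (simp only: Df_def Dg_def E_def E'_def)
qed

end

section \<open>Orthogonal decomposition over all scales\<close>

definition near :: "nat \<Rightarrow> nat \<Rightarrow> nat \<Rightarrow> bool" where
  "near n a b \<longleftrightarrow> a \<le> b + n \<and> b \<le> a + n"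

locale scales = prob_space +
  fixes L0 :: real and q :: nat and T :: nat
  assumes L0: "0 < L0" and q: "0 < q"
begin

definition len :: "nat \<Rightarrow> real" where "len c = L0 * real q ^ c"

text \<open>Martingale differences of the averages. The last level keeps the whole coarse average,
  so that the levels from s to T add up to \<open>avg (len s) f\<close>.\<close>

definition level :: "nat \<Rightarrow> ('a \<times> real \<Rightarrow> real) \<Rightarrow> 'a \<times> real \<Rightarrow> real" where
  "level c f = (if c < T then (\<lambda>p. avg (len c) f p - avg (len (Suc c)) f p) else avg (len c) f)"

lemma len_pos: "0 < len c"
  using L0 q by (simp add: len_def)

lemma len_add: "len (c + d) = real (q ^ d) * len c"
  by (simp add: len_def power_add)

lemma avg_avg_len: "avg (len c) (avg (len (c + d)) f) = avg (len (c + d)) f"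
  unfolding len_add using q by (intro avg_coarse len_pos) auto

lemma tests_level: "f \<in> tests \<Longrightarrow> level c f \<in> tests"
  by (simp add: level_def tests_diff tests_avg len_pos)

lemma beta0_level:
  assumes f: "f \<in> tests" and g: "g \<in> tests" and c: "c < T"
  shows "beta0 (level c f) (level c g) = beta0 f (avg (len c) g) - beta0 f (avg (len (Suc c)) g)"
proof -
  let ?E = "avg (len c)" and ?E' = "avg (len (Suc c))"
  have t: "?E f \<in> tests" "?E' f \<in> tests" "?E g \<in> tests" "?E' g \<in> tests" using f g by (auto intro: tests_avg len_pos)
  note a = avg_idem[OF len_pos] avg_avg_len[of c 1, simplified]
  have "beta0 (level c f) (level c g) = (beta0 (?E f) (?E g) - beta0 (?E' f) (?E g)) - (beta0 (?E f) (?E' g) - beta0 (?E' f) (?E' g))"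
    using c t by (simp add: level_def beta_diff_left[OF _ _ _ shift_fun_zero] beta_diff_right[OF _ _ _ shift_fun_zero] tests_diff)
  moreover have "beta0 (?E f) (?E g) = beta0 f (?E g)" "beta0 (?E f) (?E' g) = beta0 f (?E' g)"
      "beta0 (?E' f) (?E' g) = beta0 f (?E' g)"
    using beta0_avg[OF f t(3) len_pos, of c] beta0_avg[OF f t(4) len_pos, of c] beta0_avg[OF f t(4) len_pos, of "Suc c"] by (simp_all add: a)
  moreover have "beta0 (?E' f) (?E g) = beta0 f (?E' g)"
    using beta0_avg[OF t(2) g len_pos, of c] beta0_avg[OF f g len_pos, of "Suc c"] by (simp add: a)
  ultimately show ?thesis by simp
qed

lemma ip_level:
  assumes f: "f \<in> tests" and c: "c < T"
  shows "ip (level c f) (level c f) = ip f (avg (len c) f) - ip f (avg (len (Suc c)) f)"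
proof -
  let ?E = "avg (len c)" and ?E' = "avg (len (Suc c))"
  have t: "?E f \<in> tests" "?E' f \<in> tests" using f by (auto intro: tests_avg len_pos)
  note a = avg_idem[OF len_pos] avg_avg_len[of c 1, simplified]
  have "ip (level c f) (level c f) = ip (?E f) (?E f) - 2 * ip (?E f) (?E' f) + ip (?E' f) (?E' f)"
    using c t by (simp add: level_def ip_diff_diff)
  moreover have "ip (?E f) (?E f) = ip f (?E f)" "ip (?E f) (?E' f) = ip f (?E' f)" "ip (?E' f) (?E' f) = ip f (?E' f)"
    using ip_avg[OF f t(1) len_pos, of c] ip_avg[OF f t(2) len_pos, of c] ip_avg[OF f t(2) len_pos, of "Suc c"] by (simp_all add: a)
  ultimately show ?thesis by simp
qed

text \<open>Bessel's inequality. The squares telescope to that of \<open>avg (len 0) f\<close>; the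
  loss is the part of f finer than the first scale.\<close>

lemma sum_ip_level:
  assumes f: "f \<in> tests"
  shows "(\<Sum>c\<le>T. ip (level c f) (level c f)) \<le> ip f f"
proof -
  have "(\<Sum>c\<le>T. ip (level c f) (level c f)) = (\<Sum>c<T. ip (level c f) (level c f)) + ip (level T f) (level T f)"
    by (simp add: lessThan_Suc_atMost[symmetric])
  also have "(\<Sum>c<T. ip (level c f) (level c f)) = ip f (avg (len 0) f) - ip f (avg (len T) f)"
    using sum_lessThan_telescope'[of "\<lambda>c. ip f (avg (len c) f)" T] by (simp add: ip_level[OF f])
  also have "ip (level T f) (level T f) = ip f (avg (len T) f)"
    using ip_avg[OF f tests_avg[OF f len_pos] len_pos, of T T] by (simp add: level_def avg_idem[OF len_pos])
  also have "ip f (avg (len 0) f) - ip f (avg (len T) f) + ip f (avg (len T) f) = ip (avg (len 0) f) (avg (len 0) f)"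
    using ip_avg[OF f tests_avg[OF f len_pos] len_pos, of 0 0] by (simp add: avg_idem[OF len_pos])
  also have "\<dots> \<le> ip f f" by (rule ip_avg_le[OF f len_pos])
  finally show ?thesis .
qed

text \<open>Taken at s = a + b + 1, this rewrites the coarse part of the form as a sum over scales
  in which the pair (a, b) occurs at scale c exactly if a + b < c, the pattern of
  \<open>gram_band_ge\<close>.\<close>

lemma sum_beta0_level:
  assumes f: "f \<in> tests" and g: "g \<in> tests" and s: "s \<le> T"
  shows "(\<Sum>c\<in>{s..T}. beta0 (level c f) (level c g)) = beta0 f (avg (len s) g)"
proof -
  have "{s..T} = insert T {s..<T}" using s by auto
  then have "(\<Sum>c\<in>{s..T}. beta0 (level c f) (level c g)) = beta0 (level T f) (level T g) + (\<Sum>c=s..<T. beta0 (level c f) (level c g))"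
    by simp
  also have "(\<Sum>c=s..<T. beta0 (level c f) (level c g)) = (\<Sum>c=s..<T. beta0 f (avg (len c) g) - beta0 f (avg (len (Suc c)) g))"
    by (intro sum.cong refl beta0_level f g) simp
  also have "\<dots> = beta0 f (avg (len s) g) - beta0 f (avg (len T) g)"
    using sum_Suc_diff'[OF s, of "\<lambda>c. - beta0 f (avg (len c) g)"] by simp
  also have "beta0 (level T f) (level T g) = beta0 f (avg (len T) g)"
    using beta0_avg[OF f tests_avg[OF g len_pos] len_pos, of T T] by (simp add: level_def avg_idem[OF len_pos])
  finally show ?thesis by simp
qed

text \<open>At each fixed scale the values \<open>beta0\<close> of the levels form a Gram matrix, so
  \<open>gram_band_ge\<close> applies scale by scale, and Bessel's inequality adds up the diagonals.
  T = 2 A leaves room for every a + b + 1.\<close>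

lemma sum_beta0_ge:
  assumes f: "\<And>a. f a \<in> tests" and T: "T = 2 * A"
    and m: "\<And>t. \<bar>t\<bar> \<le> pi \<Longrightarrow> - m \<le> dirichlet n t" and m0: "0 \<le> m"
  shows "- m * (\<Sum>a<A. ip (f a) (f a)) \<le> (\<Sum>a<A. \<Sum>b<A. if near n a b then beta0 (f a) (avg (len (a + b + 1)) (f b)) else 0)"
proof -
  have "- m * (\<Sum>a<A. ip (f a) (f a)) \<le> - m * (\<Sum>a<A. \<Sum>c\<le>T. beta0 (level c (f a)) (level c (f a)))"
  proof -
    have "(\<Sum>a<A. \<Sum>c\<le>T. beta0 (level c (f a)) (level c (f a))) \<le> (\<Sum>a<A. \<Sum>c\<le>T. ip (level c (f a)) (level c (f a)))"
      by (intro sum_mono order_trans[OF beta_le_ip[OF tests_level tests_level shift_fun_zero]] f) simp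
    also have "\<dots> \<le> (\<Sum>a<A. ip (f a) (f a))" by (intro sum_mono sum_ip_level f)
    finally show ?thesis using mult_left_mono[OF _ m0] by (simp only: minus_mult_left[symmetric] neg_le_iff_le)
  qed
  also have "\<dots> = (\<Sum>c\<le>T. - m * (\<Sum>a<A. beta0 (level c (f a)) (level c (f a))))"
    by (subst sum.swap) (simp only: sum_distrib_left)
  also have "\<dots> \<le> (\<Sum>c\<le>T. \<Sum>a<A. \<Sum>b<A. if a + b < c \<and> near n a b then beta0 (level c (f a)) (level c (f b)) else 0)"
    unfolding near_def
    by (intro sum_mono gram_band_ge[where x = "\<lambda>a b. beta0 (level _ (f a)) (level _ (f b))"] beta0_gram tests_level f m m0)
  also have "\<dots> = (\<Sum>a<A. \<Sum>b<A. \<Sum>c\<le>T. if a + b < c \<and> near n a b then beta0 (level c (f a)) (level c (f b)) else 0)"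
    by (subst sum.swap, rule sum.cong[OF refl], rule sum.swap)
  also have "\<dots> = (\<Sum>a<A. \<Sum>b<A. if near n a b then beta0 (f a) (avg (len (a + b + 1)) (f b)) else 0)"
  proof (intro sum.cong refl)
    fix a b assume "a \<in> {..<A}" "b \<in> {..<A}"
    then have ab: "a + b + 1 \<le> T" by (simp add: T)
    have "(\<Sum>c\<le>T. if a + b < c then beta0 (level c (f a)) (level c (f b)) else 0) = (\<Sum>c\<in>{a + b + 1..T}. beta0 (level c (f a)) (level c (f b)))"
      by (rule sum.mono_neutral_cong_right) auto
    also have "\<dots> = beta0 (f a) (avg (len (a + b + 1)) (f b))" by (rule sum_beta0_level[OF f f ab])
    finally show "(\<Sum>c\<le>T. if a + b < c \<and> near n a b then beta0 (level c (f a)) (level c (f b)) else 0)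
      = (if near n a b then beta0 (f a) (avg (len (a + b + 1)) (f b)) else 0)" by simp
  qed
  finally show ?thesis .
qed

text \<open>Each product is bounded below by half of its two squares. In row a the level a + b
  occurs for one b only, so Bessel's inequality bounds the row by \<open>ip (f a) (f a)\<close>,
  whatever the width n; the halves belonging to b are summed by columns.\<close>

lemma sum_beta_level_ge:
  assumes f: "\<And>a. f a \<in> tests" and T: "T = 2 * A" and X: "\<And>a b. shift_fun (K a b) (X a b)"
  shows "- (\<Sum>a<A. ip (f a) (f a)) \<le> (\<Sum>a<A. \<Sum>b<A. if near n a b then beta (X a b) (level (a + b) (f a)) (level (a + b) (f b)) else 0)"
proof -
  let ?N = "\<lambda>a c. ip (level c (f a)) (level c (f a))"
  have row: "(\<Sum>b<A. ?N a (a + b)) \<le> ip (f a) (f a)" if "a < A" for a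
  proof -
    have "(\<Sum>b<A. ?N a (a + b)) = (\<Sum>c\<in>(+) a ` {..<A}. ?N a c)"
      by (subst sum.reindex) (auto simp: inj_on_def)
    also have "\<dots> \<le> (\<Sum>c\<le>T. ?N a c)"
      using that by (intro sum_mono2) (auto simp: T ip_sq_nonneg)
    also have "\<dots> \<le> ip (f a) (f a)" by (rule sum_ip_level[OF f])
    finally show ?thesis .
  qed
  have sw: "(\<Sum>a<A. \<Sum>b<A. ?N b (a + b)) = (\<Sum>a<A. \<Sum>b<A. ?N a (a + b))"
    by (subst sum.swap) (simp add: add.commute)
  have "- (\<Sum>a<A. ip (f a) (f a)) \<le> - (\<Sum>a<A. \<Sum>b<A. ?N a (a + b))"
    unfolding neg_le_iff_le by (rule sum_mono) (use row in simp)
  also have "\<dots> = (\<Sum>a<A. \<Sum>b<A. - (?N a (a + b) + ?N b (a + b)) / 2)"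
  proof -
    have "(\<Sum>a<A. \<Sum>b<A. - (?N a (a + b) + ?N b (a + b)) / 2)
        = (-1/2) * (\<Sum>a<A. \<Sum>b<A. ?N a (a + b)) + (-1/2) * (\<Sum>a<A. \<Sum>b<A. ?N b (a + b))"
      unfolding sum_distrib_left sum.distrib[symmetric] by (intro sum.cong refl) (simp add: field_simps)
    then show ?thesis unfolding sw by simp
  qed
  also have "\<dots> \<le> (\<Sum>a<A. \<Sum>b<A. if near n a b then beta (X a b) (level (a + b) (f a)) (level (a + b) (f b)) else 0)"
  proof (intro sum_mono)
    fix a b
    have "0 \<le> ?N a (a + b)" "0 \<le> ?N b (a + b)" by (rule ip_sq_nonneg)+
    then show "- (?N a (a + b) + ?N b (a + b)) / 2 \<le> (if near n a b then beta (X a b) (level (a + b) (f a)) (level (a + b) (f b)) else 0)"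
      using beta_ge_ip[OF tests_level[OF f] tests_level[OF f] X, of "a + b" a "a + b" b a b] by auto
  qed
  finally show ?thesis .
qed

text \<open>Coarse parts cost m, middle parts cost 1, and every pair of strips adds the error of
  \<open>beta_two_scale\<close>.\<close>

theorem sum_beta_ge:
  assumes f: "\<And>a. test 2 S (f a)" and T: "T = 2 * A"
    and m: "\<And>t. \<bar>t\<bar> \<le> pi \<Longrightarrow> - m \<le> dirichlet n t" and m0: "0 \<le> m"
    and X: "\<And>a b. shift_fun (K a b) (X a b)"
    and K: "\<And>a b. K a b \<le> len (a + b + 1)" "\<And>a b. K a b \<le> \<delta> * len (a + b + 1)"
    and S: "len T \<le> S" and \<delta>: "0 \<le> \<delta>"
    and osc: "\<And>a b. near n a b \<Longrightarrow> oscillating (len (a + b)) \<delta> (X a b)"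
      "\<And>a b. near n a b \<Longrightarrow> oscillating (len (a + b)) \<delta> (\<lambda>v u. - X a b u v)"
  shows "- (m + 1) * (\<Sum>a<A. ip (f a) (f a)) - real A * real A * (200 * \<delta> * S)
     \<le> (\<Sum>a<A. \<Sum>b<A. if near n a b then beta (X a b) (f a) (f b) else 0)"
proof -
  have Tf: "f a \<in> tests" for a by (rule testI_tests[OF f])
  have lenT: "len c \<le> S" if "c \<le> T" for c
  proof -
    have "len c \<le> len T" using that L0 q by (auto simp: len_def intro!: mult_left_mono power_increasing)
    then show ?thesis using S by simp
  qed
  have "0 \<le> \<delta> * S" using \<delta> lenT[of 0] len_pos[of 0] by simp
  have "- (m + 1) * (\<Sum>a<A. ip (f a) (f a)) - real A * real A * (200 * \<delta> * S)
    = - m * (\<Sum>a<A. ip (f a) (f a)) + - (\<Sum>a<A. ip (f a) (f a)) + (\<Sum>a<A. \<Sum>b<A. - (200 * \<delta> * S))"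
    by (simp add: algebra_simps)
  also have "\<dots> \<le> (\<Sum>a<A. \<Sum>b<A. if near n a b then beta0 (f a) (avg (len (a + b + 1)) (f b)) else 0)
     + (\<Sum>a<A. \<Sum>b<A. if near n a b then beta (X a b) (level (a + b) (f a)) (level (a + b) (f b)) else 0)
     + (\<Sum>a<A. \<Sum>b<A. - (200 * \<delta> * S))"
    by (intro add_mono sum_beta0_ge[OF Tf T m m0] sum_beta_level_ge[OF Tf T X] order_refl)
  also have "\<dots> = (\<Sum>a<A. \<Sum>b<A. (if near n a b then beta0 (f a) (avg (len (a + b + 1)) (f b)) else 0)
     + (if near n a b then beta (X a b) (level (a + b) (f a)) (level (a + b) (f b)) else 0) - 200 * \<delta> * S)"
    by (simp add: sum.distrib sum_subtractf)
  also have "\<dots> \<le> (\<Sum>a<A. \<Sum>b<A. if near n a b then beta (X a b) (f a) (f b) else 0)"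
  proof (intro sum_mono)
    fix a b assume "a \<in> {..<A}" "b \<in> {..<A}"
    then have ab: "a + b < T" by (simp add: T)
    show "(if near n a b then beta0 (f a) (avg (len (a + b + 1)) (f b)) else 0)
     + (if near n a b then beta (X a b) (level (a + b) (f a)) (level (a + b) (f b)) else 0) - 200 * \<delta> * S
      \<le> (if near n a b then beta (X a b) (f a) (f b) else 0)"
    proof (cases "near n a b")
      case True
      have "len (a + b + 1) = real q * len (a + b)" using len_add[of "a + b" 1] by simp
      from beta_two_scale[OF f f len_pos q this X K lenT \<delta> osc[OF True]] ab True
      show ?thesis by (simp add: level_def)
    qed (use \<open>0 \<le> \<delta> * S\<close> in \<open>simp add: mult.commute\<close>)
  qed
  finally show ?thesis .
qed

end

section \<open>Offsets between horocycles\<close>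

text \<open>
  For points at heights \<open>y = q^(2a) u\<close> and \<open>y' = q^(2b) v\<close> the offset
  \<open>sqrt (\<kappa> y y' - y^2 - y'^2)\<close>, where \<open>\<kappa> = 2 cosh d\<close>, equals \<open>q^(a+b) * R u v\<close> with
  \<open>r = q^(2a) / q^(2b)\<close> and \<open>s = 1 / r\<close>. Both are powers of \<open>q\<close> that stay bounded while \<open>\<kappa>\<close> grows.
\<close>

locale horo_shift =
  fixes \<kappa> r s :: real
  assumes rs: "r * s = 1" and r: "0 < r" "100 * r \<le> \<kappa>" and s: "0 < s" "100 * s \<le> \<kappa>"
begin

definition P :: "real \<Rightarrow> real \<Rightarrow> real" where "P u v = \<kappa> * u * v - r * u\<^sup>2 - s * v\<^sup>2"
definition R :: "real \<Rightarrow> real \<Rightarrow> real" where "R u v = sqrt (P u v)"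
definition Ru :: "real \<Rightarrow> real \<Rightarrow> real" where "Ru u v = (\<kappa> * v - 2 * r * u) / (2 * R u v)"
text \<open>The mixed second derivative of R. Its numerator is 2 \<kappa> P minus the product of the
  two partial derivatives of P, which collapses to (\<kappa>^2 - 4 r s) u v, and r s = 1.\<close>

definition Ruv :: "real \<Rightarrow> real \<Rightarrow> real" where "Ruv u v = (\<kappa>\<^sup>2 - 4) * u * v / (4 * (R u v) ^ 3)"

lemma kappa_ge: "100 \<le> \<kappa>"
proof (cases "1 \<le> r")
  case False
  then have "1 \<le> s" using rs r(1) s(1) by (metis less_eq_real_def linorder_not_less mult_le_cancel_right1 mult_less_cancel_right2 order.trans)
  then show ?thesis using s by simp
qed (use r in simp)

lemma P_bounds:
  assumes "u \<in> {1..2}" "v \<in> {1..2}"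
  shows "0 < P u v" "P u v \<le> \<kappa> * (u * v)" "P u v \<le> 4 * \<kappa>"
proof -
  have uv: "1 \<le> u * v" "u * v \<le> 4" using assms mult_mono[of 1 u 1 v] mult_mono[of u 2 v 2] by auto
  have sq: "u\<^sup>2 \<le> 4" "v\<^sup>2 \<le> 4" using assms power_mono[of u 2 2] power_mono[of v 2 2] by auto
  have 1: "r * u\<^sup>2 \<le> r * 4" "s * v\<^sup>2 \<le> s * 4" using sq r s by (auto intro: mult_left_mono)
  have 2: "\<kappa> * 1 \<le> \<kappa> * (u * v)" "\<kappa> * (u * v) \<le> \<kappa> * 4" using uv kappa_ge by (auto intro!: mult_left_mono)
  have 3: "0 \<le> r * u\<^sup>2" "0 \<le> s * v\<^sup>2" using r s by auto
  have eq: "P u v = \<kappa> * (u * v) - r * u\<^sup>2 - s * v\<^sup>2" by (simp add: P_def mult.assoc)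
  show "0 < P u v" "P u v \<le> \<kappa> * (u * v)" "P u v \<le> 4 * \<kappa>"
    unfolding eq using 1 2 3 r s kappa_ge by linarith+
qed

lemma R_pos: "u \<in> {1..2} \<Longrightarrow> v \<in> {1..2} \<Longrightarrow> 0 < R u v"
  by (simp add: R_def P_bounds)

lemma R_sq: "u \<in> {1..2} \<Longrightarrow> v \<in> {1..2} \<Longrightarrow> R u v * R u v = P u v"
  using P_bounds(1)[of u v] by (simp add: R_def less_imp_le)

lemma R_le: 
  assumes "u \<in> {1..2}" "v \<in> {1..2}" shows "\<bar>R u v\<bar> \<le> 2 * sqrt \<kappa>"
proof -
  have "R u v \<le> sqrt (4 * \<kappa>)" using P_bounds(3)[OF assms] by (simp add: R_def)
  also have "\<dots> = 2 * sqrt \<kappa>" by (simp add: real_sqrt_mult)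
  finally show ?thesis using R_pos[OF assms] by simp
qed

lemma R_deriv:
  assumes "u \<in> {1..2}" "v \<in> {1..2}"
  shows "((\<lambda>u. R u v) has_real_derivative Ru u v) (at u)"
proof -
  have "((\<lambda>u. P u v) has_real_derivative (\<kappa> * v - 2 * r * u)) (at u)"
    unfolding P_def by (auto intro!: derivative_eq_intros)
  from DERIV_chain2[OF DERIV_real_sqrt[OF P_bounds(1)[OF assms]] this]
  show ?thesis unfolding R_def[abs_def] Ru_def by (simp add: R_def field_simps)
qed

lemma R_deriv2:
  assumes "u \<in> {1..2}" "v \<in> {1..2}"
  shows "((\<lambda>v. R u v) has_real_derivative (\<kappa> * u - 2 * s * v) / (2 * R u v)) (at v)"
proof -
  have "((\<lambda>v. P u v) has_real_derivative (\<kappa> * u - 2 * s * v)) (at v)"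
    unfolding P_def by (auto intro!: derivative_eq_intros)
  from DERIV_chain2[OF DERIV_real_sqrt[OF P_bounds(1)[OF assms]] this]
  show ?thesis unfolding R_def[abs_def] by (simp add: R_def field_simps)
qed

lemma Ru_deriv:
  assumes uv: "u \<in> {1..2}" "v \<in> {1..2}"
  shows "((\<lambda>v. Ru u v) has_real_derivative Ruv u v) (at v)"
proof -
  let ?R = "R u v" and ?a = "\<kappa> * v - 2 * r * u" and ?b = "\<kappa> * u - 2 * s * v"
  have R: "?R \<noteq> 0" using R_pos[OF uv] by simp
  have "((\<lambda>v. Ru u v) has_real_derivative (\<kappa> * (2 * ?R) - ?a * (2 * (?b / (2 * ?R)))) / ((2 * ?R) * (2 * ?R))) (at v)"
    unfolding Ru_def using R
    by (auto intro!: derivative_eq_intros R_deriv2[OF uv])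
  moreover have "(\<kappa> * (2 * ?R) - ?a * (2 * (?b / (2 * ?R)))) / ((2 * ?R) * (2 * ?R)) = (2 * \<kappa> * (?R * ?R) - ?a * ?b) / (4 * ?R ^ 3)"
    using R by (simp add: field_simps power3_eq_cube)
  moreover have "2 * \<kappa> * (?R * ?R) - ?a * ?b = (\<kappa>\<^sup>2 - 4) * u * v"
  proof -
    have "2 * \<kappa> * P u v - ?a * ?b = (\<kappa>\<^sup>2 - 4 * (r * s)) * u * v"
      unfolding P_def by (simp add: algebra_simps power2_eq_square)
    then show ?thesis by (simp only: R_sq[OF uv] rs mult_1_right)
  qed
  ultimately show ?thesis by (simp only: Ruv_def)
qed

text \<open>Dropping the negative terms of P gives R \<le> sqrt \<kappa> * z with z = sqrt (u v)
  \<le> 2. With \<kappa>^2 - 4 \<ge> \<kappa>^2 / 2 this makes Ruv at least sqrt \<kappa> / (8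
  z).\<close>

lemma Ruv_ge:
  assumes uv: "u \<in> {1..2}" "v \<in> {1..2}"
  shows "sqrt \<kappa> / 16 \<le> Ruv u v"
proof -
  define z where "z = sqrt (u * v)"
  have uvp: "1 \<le> u * v" "u * v \<le> 4" using uv mult_mono[of 1 u 1 v] mult_mono[of u 2 v 2] by auto
  have z: "0 < z" "z \<le> 2" "z * z = u * v" using uvp by (auto simp: z_def real_le_lsqrt)
  have k: "0 < sqrt \<kappa>" "sqrt \<kappa> * sqrt \<kappa> = \<kappa>" using kappa_ge by auto
  have "R u v \<le> sqrt \<kappa> * z" using P_bounds(2)[OF uv] by (simp add: R_def z_def flip: real_sqrt_mult)
  then have R3: "R u v ^ 3 \<le> (sqrt \<kappa> * z) ^ 3" using R_pos[OF uv] by (intro power_mono) auto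
  have "100 * 100 \<le> \<kappa> * \<kappa>" using kappa_ge by (intro mult_mono) auto
  then have k2: "\<kappa>\<^sup>2 / 2 \<le> \<kappa>\<^sup>2 - 4" by (simp add: power2_eq_square)
  have "sqrt \<kappa> / 16 * (4 * R u v ^ 3) \<le> sqrt \<kappa> / 16 * (4 * (sqrt \<kappa> * z) ^ 3)"
    using R3 k by (intro mult_left_mono) auto
  also have "\<dots> = (sqrt \<kappa> * sqrt \<kappa>) * (sqrt \<kappa> * sqrt \<kappa>) * z * (z * z) / 4"
  proof -
    have "a / 16 * (4 * (a * z) ^ 3) = (a * a) * (a * a) * z * (z * z) / 4" for a :: real
      by (simp add: power3_eq_cube field_simps)
    then show ?thesis .
  qed
  also have "\<dots> = \<kappa>\<^sup>2 * (u * v) * z / 4" unfolding k(2) z(3) power2_eq_square by simp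
  also have "\<dots> \<le> \<kappa>\<^sup>2 * (u * v) * 2 / 4"
    using z uvp by (intro divide_right_mono mult_left_mono) auto
  also have "\<dots> = \<kappa>\<^sup>2 / 2 * (u * v)" by simp
  also have "\<dots> \<le> (\<kappa>\<^sup>2 - 4) * (u * v)" using k2 uvp by (intro mult_right_mono) auto
  finally have "sqrt \<kappa> / 16 * (4 * R u v ^ 3) \<le> (\<kappa>\<^sup>2 - 4) * u * v" by (simp add: mult.assoc)
  then show ?thesis using R_pos[OF uv] by (simp add: Ruv_def le_divide_eq)
qed

lemma Ru_diff_ge:
  assumes "u \<in> {1..2}" "v \<in> {1..2}" "w \<in> {1..2}" "v < w"
  shows "sqrt \<kappa> / 16 * (w - v) \<le> Ru u w - Ru u v"
proof -
  obtain z where z: "v < z" "z < w" "Ru u w - Ru u v = (w - v) * Ruv u z"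
    using MVT2[OF assms(4), of "\<lambda>v. Ru u v" "\<lambda>v. Ruv u v"] Ru_deriv[OF assms(1)] assms by auto
  then have "sqrt \<kappa> / 16 \<le> Ruv u z" using Ruv_ge assms by simp
  then show ?thesis unfolding z(3) using assms(4) by (simp add: mult.commute mult_left_mono)
qed

text \<open>As a function of u, Ruv is a positive multiple of u / R^3. The derivative of R^3 / u has
  the sign of \<kappa> x v / 2 - 2 r x^2 + s v^2, nonnegative as \<kappa> \<ge> 100 r. Integrated in
  v, this yields the monotone phase derivative that \<open>oscillation_bound\<close> asks
  for.\<close>

lemma Ruv_antimono:
  assumes u: "u \<in> {1..2}" "u' \<in> {1..2}" "u \<le> u'" and v: "v \<in> {1..2}"
  shows "Ruv u' v \<le> Ruv u v"
proof -
  have "R u v ^ 3 / u \<le> R u' v ^ 3 / u'"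
  proof (rule DERIV_nonneg_imp_nondecreasing[OF u(3)])
    fix x assume "u \<le> x" "x \<le> u'"
    then have x: "x \<in> {1..2}" using u by auto
    let ?d = "R x v * (3 * (\<kappa> * v - 2 * r * x) * x / 2 - R x v * R x v) / (x * x)"
    have "((\<lambda>u. R u v ^ 3 / u) has_real_derivative (3 * (Ru x v * R x v ^ 2) * x - R x v ^ 3 * 1) / (x * x)) (at x)"
      using x by (auto intro!: derivative_eq_intros R_deriv[OF x v] simp: numeral_3_eq_3 power2_eq_square)
    moreover have "3 * (Ru x v * R x v ^ 2) * x - R x v ^ 3 * 1 = R x v * (3 * (\<kappa> * v - 2 * r * x) * x / 2 - R x v * R x v)"
      using R_pos[OF x v] by (simp add: Ru_def field_simps power2_eq_square power3_eq_cube)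
    moreover have "0 \<le> R x v * (3 * (\<kappa> * v - 2 * r * x) * x / 2 - R x v * R x v) / (x * x)"
    proof -
      have "3 * (\<kappa> * v - 2 * r * x) * x / 2 - P x v = \<kappa> * (x * v) / 2 - 2 * (r * x\<^sup>2) + s * v\<^sup>2"
        unfolding P_def by (simp add: field_simps power2_eq_square)
      moreover have "r * x\<^sup>2 \<le> r * 4" using x r power_mono[of x 2 2] by (intro mult_left_mono) auto
      moreover have "\<kappa> * 1 \<le> \<kappa> * (x * v)" using x v kappa_ge mult_mono[of 1 x 1 v] by (intro mult_left_mono) auto
      moreover have "0 \<le> s * v\<^sup>2" using s by simp
      ultimately have "0 \<le> 3 * (\<kappa> * v - 2 * r * x) * x / 2 - P x v" using r kappa_ge by linarith
      then show ?thesis unfolding R_sq[OF x v] using R_pos[OF x v] x by simp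
    qed
    ultimately show "\<exists>y. ((\<lambda>u. R u v ^ 3 / u) has_real_derivative y) (at x) \<and> 0 \<le> y" by auto
  qed
  then have *: "u' / R u' v ^ 3 \<le> u / R u v ^ 3"
    using R_pos[OF u(1) v] R_pos[OF u(2) v] u by (simp add: field_simps)
  have "100 * 100 \<le> \<kappa> * \<kappa>" using kappa_ge by (intro mult_mono) auto
  then have "0 \<le> (\<kappa>\<^sup>2 - 4) * v / 4" using v by (simp add: power2_eq_square)
  from mult_left_mono[OF * this] show ?thesis by (simp add: Ruv_def mult_ac)
qed

lemma Ru_diff_antimono:
  assumes u: "u \<in> {1..2}" "u' \<in> {1..2}" "u \<le> u'" and v: "v \<in> {1..2}" "w \<in> {1..2}" "v \<le> w"
  shows "Ru u' w - Ru u' v \<le> Ru u w - Ru u v"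
proof -
  have "Ru u' w - Ru u w \<le> Ru u' v - Ru u v"
  proof (rule DERIV_nonpos_imp_nonincreasing[OF v(3)])
    fix x assume "v \<le> x" "x \<le> w"
    then have x: "x \<in> {1..2}" using v by auto
    show "\<exists>y. ((\<lambda>v. Ru u' v - Ru u v) has_real_derivative y) (at x) \<and> y \<le> 0"
      using DERIV_diff[OF Ru_deriv[OF u(2) x] Ru_deriv[OF u(1) x]] Ruv_antimono[OF u x] by auto
  qed
  then show ?thesis by simp
qed

lemma R_measurable [measurable]: "(\<lambda>(u, v). R u v) \<in> borel_measurable (borel \<Otimes>\<^sub>M borel)"
  unfolding R_def P_def by measurable

lemma Ru_continuous:
  assumes "v \<in> {1..2}" shows "continuous_on {1..2} (\<lambda>u. Ru u v)"
proof -
  have "continuous_on {1..2} (\<lambda>u. R u v)"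
    by (rule DERIV_continuous_on) (use R_deriv[OF _ assms] in \<open>auto intro: has_field_derivative_at_within\<close>)
  then show ?thesis unfolding Ru_def using R_pos[OF _ assms] by (intro continuous_intros) (auto, force)
qed

text \<open>The phase l * (R u w - R u v) has a derivative in u that decreases and is at least l *
  sqrt \<kappa> / 16 * \<epsilon>. The factor 32 is this 16 times the 2 of
  \<open>oscillation_bound\<close>.\<close>

lemma integral_R_diff_le_aux:
  assumes v: "v \<in> {1..2}" "w \<in> {1..2}" "0 < \<epsilon>" "\<epsilon> \<le> w - v" and l: "0 < l"
    and G: "bounded_support B S G" and H: "\<And>p q. \<bar>\<integral>x. indicator {p..q} x * G x \<partial>lborel\<bar> \<le> H"
  shows "\<bar>\<integral>u. indicator {1..2} u * G (l * (R u w - R u v)) \<partial>lborel\<bar> \<le> 32 * H / (l * sqrt \<kappa> * \<epsilon>)"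
proof -
  let ?c = "l * (sqrt \<kappa> / 16 * \<epsilon>)"
  have k: "0 < sqrt \<kappa>" using kappa_ge by simp
  have "\<bar>\<integral>u. indicator {1..2} u * G (l * (R u w - R u v)) \<partial>lborel\<bar> \<le> 2 * H / ?c"
  proof (rule oscillation_bound[where \<phi>' = "\<lambda>u. l * (Ru u w - Ru u v)", OF _ _ _ _ _ _ _ G H])
    show "(\<lambda>u. l * (R u w - R u v)) \<in> borel_measurable borel" by measurable
    show "continuous_on {1..2} (\<lambda>u. l * (Ru u w - Ru u v))"
      using Ru_continuous v by (intro continuous_intros) auto
    show "((\<lambda>u. l * (R u w - R u v)) has_real_derivative l * (Ru u w - Ru u v)) (at u)" if "u \<in> {1..2}" for u
      using R_deriv that v by (intro DERIV_cmult DERIV_diff) auto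
    show "l * (Ru u' w - Ru u' v) \<le> l * (Ru u w - Ru u v)" if "1 \<le> u" "u \<le> u'" "u' \<le> 2" for u u'
      using Ru_diff_antimono[of u u' v w] that v l by (intro mult_left_mono) auto
    show "?c \<le> l * (Ru u w - Ru u v)" if "u \<in> {1..2}" for u
    proof -
      have "sqrt \<kappa> / 16 * \<epsilon> \<le> sqrt \<kappa> / 16 * (w - v)" using v k by (intro mult_left_mono) auto
      then show ?thesis using Ru_diff_ge[OF that v(1,2)] v l by (intro mult_left_mono) auto
    qed
  qed (use l k v in auto)
  then show ?thesis by (simp add: field_simps)
qed

lemma bounded_support_reflect: "bounded_support B S G \<Longrightarrow> bounded_support B S (\<lambda>x. G (- x))"
  unfolding bounded_support_def by (auto intro: measurable_compose_rev[of G borel borel "uminus"])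

text \<open>The signs of l and w - v are normalised by exchanging v and w and by reflecting G; a
  reflected interval is an interval, so H is unchanged.\<close>

lemma integral_R_diff_le:
  assumes v: "v \<in> {1..2}" "w \<in> {1..2}" "0 < \<epsilon>" "\<epsilon> \<le> \<bar>w - v\<bar>" and l: "l \<noteq> 0"
    and G: "bounded_support B S G" and H: "\<And>p q. \<bar>\<integral>x. indicator {p..q} x * G x \<partial>lborel\<bar> \<le> H"
  shows "\<bar>\<integral>u. indicator {1..2} u * G (l * (R u w - R u v)) \<partial>lborel\<bar> \<le> 32 * H / (\<bar>l\<bar> * sqrt \<kappa> * \<epsilon>)"
proof -
  have H': "\<bar>\<integral>x. indicator {p..q} x * G (- x) \<partial>lborel\<bar> \<le> H" for p q
  proof -
    have "(\<integral>x. indicator {p..q} x * G (- x) \<partial>lborel) = (\<integral>x. indicator {-q..-p} x * G x \<partial>lborel)"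
      by (subst lborel_integral_real_affine[of "-1" _ 0]) (auto simp: indicator_def intro!: Bochner_Integration.integral_cong)
    then show ?thesis using H by simp
  qed
  have swap: "l * (R u w - R u v) = - (- l * (R u w - R u v))" "l * (R u w - R u v) = - (l * (R u v - R u w))"
     "l * (R u w - R u v) = - l * (R u v - R u w)" for u by (auto simp: algebra_simps)
  consider "v \<le> w" "0 < l" | "v \<le> w" "l < 0" | "w \<le> v" "0 < l" | "w \<le> v" "l < 0" using l by linarith
  then show ?thesis
  proof cases
    case 1 then show ?thesis using integral_R_diff_le_aux[of v w \<epsilon> l, OF _ _ _ _ _ G H] v by simp
  next
    case 2 then show ?thesis unfolding swap(1)
      using integral_R_diff_le_aux[of v w \<epsilon> "-l", OF _ _ _ _ _ bounded_support_reflect[OF G] H'] v by simp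
  next
    case 3 then show ?thesis unfolding swap(2)
      using integral_R_diff_le_aux[of w v \<epsilon> l, OF _ _ _ _ _ bounded_support_reflect[OF G] H'] v by simp
  next
    case 4 then show ?thesis unfolding swap(3)
      using integral_R_diff_le_aux[of w v \<epsilon> "-l", OF _ _ _ _ _ G H] v by simp
  qed
qed

end

text \<open>The uniform law of the relative height. Hyperbolic area has density proportional to 1 /
  u^2 on [1, 2]; the null sets are the same, and the uniform law keeps the phase integral free of a
  weight.\<close>

definition band :: "real measure" where
  "band = restrict_space lborel {1..2}"

lemma space_band [simp]: "space band = {1..2}"
  by (simp add: band_def space_restrict_space)

lemma integral_band: "(\<integral>u. f u \<partial>band) = (\<integral>u. indicator {1..2} u * f u \<partial>lborel)" for f :: "real \<Rightarrow> real"
  unfolding band_def by (subst integral_restrict_space) auto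

interpretation band: prob_space band
  by (rule prob_spaceI) (simp add: band_def emeasure_restrict_space space_restrict_space)

lemma measurable_ident_band [measurable]: "(\<lambda>u. u) \<in> band \<rightarrow>\<^sub>M borel"
  unfolding band_def by (rule measurable_restrict_space1) simp

lemma measurable_band_pair:
  fixes k :: "real \<times> real \<Rightarrow> real"
  assumes [measurable]: "k \<in> borel_measurable (borel \<Otimes>\<^sub>M borel)"
  shows "k \<in> borel_measurable (band \<Otimes>\<^sub>M band)"
proof -
  have [measurable]: "fst \<in> band \<Otimes>\<^sub>M band \<rightarrow>\<^sub>M borel" "snd \<in> band \<Otimes>\<^sub>M band \<rightarrow>\<^sub>M borel"
    using measurable_compose[OF measurable_fst measurable_ident_band] measurable_compose[OF measurable_snd measurable_ident_band] by simp_all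
  have "(\<lambda>p. k (fst p, snd p)) \<in> borel_measurable (band \<Otimes>\<^sub>M band)" by measurable
  then show ?thesis by simp
qed

section \<open>Oscillation of the offsets\<close>

context horo_shift
begin

lemma shift_fun_R: "band.shift_fun (\<bar>l\<bar> * (2 * sqrt \<kappa>)) (\<lambda>u v. l * R u v)"
proof -
  have "(\<lambda>(u, v). l * R u v) \<in> borel_measurable (borel \<Otimes>\<^sub>M borel)" by measurable
  from measurable_band_pair[OF this] show ?thesis
    unfolding band.shift_fun_def using R_le by (auto simp: abs_mult intro!: mult_left_mono)
qed

lemma integral_near_le:
  assumes "0 \<le> \<epsilon>"
  shows "(\<integral>w. indicator {w. \<bar>w - v\<bar> < \<epsilon>} w \<partial>band) \<le> 2 * \<epsilon>"
proof -
  have "(\<integral>w. indicator {w. \<bar>w - v\<bar> < \<epsilon>} w \<partial>band)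
      = (\<integral>w. indicator {1..2} w * (indicator {w. \<bar>w - v\<bar> < \<epsilon>} w :: real) \<partial>lborel)"
    by (rule integral_band)
  also have "\<dots> \<le> (\<integral>w. indicator {v - \<epsilon>..v + \<epsilon>} w \<partial>lborel)"
    by (rule integral_mono'[OF integrable_real_indicator]) (auto simp: indicator_def emeasure_lborel_Icc_eq)
  finally show ?thesis using assms by simp
qed

text \<open>For heights v and w close together the phase is too flat, and only the trivial bound 8
  is available; elsewhere \<open>integral_R_diff_le\<close> gains a factor L / (|l| sqrt \<kappa>).
  The hypothesis on L makes both contributions to the mean of \<open>\<eta>\<close> equally
  small.\<close>

lemma oscillating_R:
  assumes \<delta>: "0 < \<delta>" and l: "l \<noteq> 0" and L: "0 < L" "L \<le> \<bar>l\<bar> * sqrt \<kappa> * (\<delta> ^ 4 / 2 ^ 35)"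
  shows "band.oscillating L \<delta> (\<lambda>u v. l * R u v)"
  unfolding band.oscillating_def
proof (intro allI impI)
  fix S f g assume S: "L \<le> S" and f: "band.test 4 S f" and g: "band.test 4 S g"
  \<comment> \<open>The heights w within \<epsilon> of v have measure at most 2 \<epsilon> and
    contribute at most 16 \<epsilon> = \<delta>^2 / 2^11 to the mean, as much as the constant term
    of \<open>\<eta>\<close>.\<close>
  define \<epsilon> where "\<epsilon> = \<delta>\<^sup>2 / 2 ^ 15"
  define G where "G = (\<lambda>p. g p - band.avg L g p)"
  define \<eta> where "\<eta> v w = 8 * indicator {w. \<bar>w - v\<bar> < \<epsilon>} w + \<delta>\<^sup>2 / 2 ^ 11" for v w :: real
  have \<epsilon>: "0 < \<epsilon>" using \<delta> by (simp add: \<epsilon>_def)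
  have k: "0 < sqrt \<kappa>" using kappa_ge by simp
  have G: "band.test 8 (2 * S) G"
    unfolding G_def using band.test_diff[OF _ band.test_avg[OF g L(1)], of 4 g] band.test_mono[OF g order_refl, of "S + L"] S L
    by (auto elim: band.test_mono)
  have m\<eta>: "(\<lambda>(v, w). \<eta> v w) \<in> borel_measurable (band \<Otimes>\<^sub>M band)"
    by (rule measurable_band_pair) (unfold \<eta>_def indicator_def, measurable)
  have osc: "\<bar>\<integral>u. G (w, x + (l * R u w - l * R u v)) \<partial>band\<bar> \<le> \<eta> v w" if v: "v \<in> space band" and w: "w \<in> space band" for v w x
  proof (cases "\<bar>w - v\<bar> < \<epsilon>")
    case True
    have [measurable]: "(\<lambda>y. G (w, y)) \<in> borel_measurable borel"
      using band.test_slice[OF G w] by (simp add: bounded_support_def)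
    have [measurable]: "(\<lambda>u. R u w) \<in> borel_measurable band" "(\<lambda>u. R u v) \<in> borel_measurable band"
      by (rule measurable_compose[OF measurable_ident_band], measurable)+
    have "\<bar>\<integral>u. G (w, x + (l * R u w - l * R u v)) \<partial>band\<bar> \<le> 8"
      by (rule band.bounded_integrable(2)) (measurable, use band.testD(2)[OF G] in auto)
    then show ?thesis using True by (simp add: \<eta>_def add_increasing2)
  next
    case False
    define g0 where "g0 y = g (w, x + y)" for y
    define G0 where "G0 y = G (w, x + y)" for y
    have G0: "bounded_support 8 (2 * S + \<bar>x\<bar>) G0"
      using band.test_slice[OF G w] unfolding bounded_support_def G0_def by auto
    have H: "\<bar>\<integral>y. indicator {p..q} y * G0 y \<partial>lborel\<bar> \<le> 16 * L" for p q
    proof -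
      have "(\<integral>y. indicator {p..q} y * G0 y \<partial>lborel) = (\<integral>y. indicator {p + x..q + x} y * G (w, y) \<partial>lborel)"
        by (subst (2) lborel_integral_shift[of _ x, symmetric])
           (auto simp: indicator_def G0_def add.commute intro!: Bochner_Integration.integral_cong)
      then show ?thesis
        using integral_cell_avg_error[OF L(1) band.test_slice[OF g w], of "p + x" "q + x"] by (simp add: G_def band.avg_def)
    qed
    have "\<bar>\<integral>u. G (w, x + (l * R u w - l * R u v)) \<partial>band\<bar> = \<bar>\<integral>u. indicator {1..2} u * G0 (l * (R u w - R u v)) \<partial>lborel\<bar>"
      unfolding integral_band G0_def by (simp add: right_diff_distrib)
    also have "\<dots> \<le> 32 * (16 * L) / (\<bar>l\<bar> * sqrt \<kappa> * \<epsilon>)"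
      by (rule integral_R_diff_le[OF _ _ \<epsilon> _ l G0 H]) (use v w False in auto)
    also have "\<dots> \<le> \<delta>\<^sup>2 / 2 ^ 11"
    proof -
      \<comment> \<open>The exponent 35 is 9 + 15 + 11: from 512 = 32 * 16, from \<epsilon> and from
        the bound aimed at.\<close>
      have "512 * L \<le> 512 * (\<bar>l\<bar> * sqrt \<kappa> * (\<delta> ^ 4 / 2 ^ 35))" using L by simp
      also have "\<dots> = \<delta>\<^sup>2 / 2 ^ 11 * (\<bar>l\<bar> * sqrt \<kappa> * \<epsilon>)" by (simp add: \<epsilon>_def field_simps power2_eq_square power4_eq_xxxx)
      finally show ?thesis using \<epsilon> k l by (simp add: divide_le_eq)
    qed
    also have "\<dots> \<le> \<eta> v w" by (simp add: \<eta>_def)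
    finally show ?thesis .
  qed
  have avg\<eta>: "(\<integral>v. \<integral>w. \<eta> v w \<partial>band \<partial>band) \<le> \<delta>\<^sup>2 / 2 ^ 10"
  proof -
    have b: "\<bar>\<integral>w. \<eta> v w \<partial>band\<bar> \<le> \<delta>\<^sup>2 / 2 ^ 10" for v
    proof -
      have [measurable]: "(\<lambda>w. indicator {w. \<bar>w - v\<bar> < \<epsilon>} w :: real) \<in> borel_measurable band"
        by (rule measurable_compose[OF measurable_ident_band]) measurable
      have "integrable band (\<lambda>w. indicator {w. \<bar>w - v\<bar> < \<epsilon>} w :: real)"
        by (rule band.integrable_const_bound[of _ 1]) auto
      then have "(\<integral>w. \<eta> v w \<partial>band) = 8 * (\<integral>w. indicator {w. \<bar>w - v\<bar> < \<epsilon>} w \<partial>band) + \<delta>\<^sup>2 / 2 ^ 11"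
        unfolding \<eta>_def by (simp add: band.prob_space[simplified])
      also have "\<dots> \<le> 8 * (2 * \<epsilon>) + \<delta>\<^sup>2 / 2 ^ 11"
        using integral_near_le[of \<epsilon> v] \<epsilon> by simp
      also have "\<dots> = \<delta>\<^sup>2 / 2 ^ 10" by (simp add: \<epsilon>_def)
      finally have "(\<integral>w. \<eta> v w \<partial>band) \<le> \<delta>\<^sup>2 / 2 ^ 10" .
      moreover have "0 \<le> (\<integral>w. \<eta> v w \<partial>band)" by (simp add: \<eta>_def)
      ultimately show ?thesis by simp
    qed
    have "(\<lambda>v. \<integral>w. \<eta> v w \<partial>band) \<in> borel_measurable band"
      using m\<eta> by measurable
    from band.bounded_integrable(2)[OF this b] show ?thesis by (simp add: abs_le_iff)
  qed
  \<comment> \<open>The weight t = 32 / \<delta> makes each of the two terms equal to \<delta> * S /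
    2 once the mean of \<open>\<eta>\<close> is replaced by \<delta>^2 / 2^10.\<close>
  have "\<bar>band.beta (\<lambda>u v. l * R u v) f G\<bar> \<le> 4 * 4 * S / (32 / \<delta>) + 32 / \<delta> * 8 * (2 * S) * (\<integral>v. \<integral>w. \<eta> v w \<partial>band \<partial>band)"
  proof (rule band.abs_beta_le[OF f G shift_fun_R _ _ _ m\<eta> _ osc])
    show "\<bar>\<eta> v w\<bar> \<le> 8 + \<delta>\<^sup>2 / 2 ^ 11" for v w by (simp add: \<eta>_def indicator_def)
  qed (use S L \<delta> in auto)
  also have "\<dots> \<le> 4 * 4 * S / (32 / \<delta>) + 32 / \<delta> * 8 * (2 * S) * (\<delta>\<^sup>2 / 2 ^ 10)"
    using avg\<eta> S L \<delta> by (intro add_left_mono mult_left_mono) auto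
  also have "\<dots> = \<delta> * S" using \<delta> by (simp add: field_simps power2_eq_square)
  finally show "\<bar>band.beta (\<lambda>u v. l * R u v) f (\<lambda>p. g p - band.avg L g p)\<bar> \<le> \<delta> * S" by (simp add: G_def)
qed

end

section \<open>Hoffman's ratio bound\<close>

lemma sum_swap2:
  "(\<Sum>i\<in>I. \<Sum>j\<in>J. \<Sum>a\<in>A. \<Sum>b\<in>B. f i j a b) = (\<Sum>a\<in>A. \<Sum>b\<in>B. \<Sum>i\<in>I. \<Sum>j\<in>J. f i j a b)"
proof -
  have "(\<Sum>i\<in>I. \<Sum>j\<in>J. \<Sum>a\<in>A. \<Sum>b\<in>B. f i j a b) = (\<Sum>i\<in>I. \<Sum>a\<in>A. \<Sum>j\<in>J. \<Sum>b\<in>B. f i j a b)"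
    by (intro sum.cong refl) (rule sum.swap)
  also have "\<dots> = (\<Sum>a\<in>A. \<Sum>i\<in>I. \<Sum>b\<in>B. \<Sum>j\<in>J. f i j a b)"
    by (subst sum.swap) (intro sum.cong refl, rule sum.swap)
  also have "\<dots> = (\<Sum>a\<in>A. \<Sum>b\<in>B. \<Sum>i\<in>I. \<Sum>j\<in>J. f i j a b)"
    by (intro sum.cong refl) (rule sum.swap)
  finally show ?thesis .
qed

context prob_space
begin

lemma ip_sum_left:
  assumes "\<And>i. i \<in> I \<Longrightarrow> f i \<in> tests" "g \<in> tests"
  shows "ip (\<lambda>p. \<Sum>i\<in>I. f i p) g = (\<Sum>i\<in>I. ip (f i) g)"
  using assms(1)
proof (induction I rule: infinite_finite_induct)
  case (insert i I)
  then show ?case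
    using ip_add_left[of "f i" "\<lambda>p. \<Sum>i\<in>I. f i p" g] assms(2) tests_sum[of I f] by simp
qed (simp_all add: ip_def)

end

context scales
begin

text \<open>
  Hoffman's bound: apply \<open>sum_beta_ge\<close> to the differences \<open>F i - F j\<close> and sum over all pairs of colours.
\<close>

lemma sum_beta_colors_le:
  fixes F :: "nat \<Rightarrow> nat \<Rightarrow> 'a \<times> real \<Rightarrow> real" and k :: nat
  defines "U a \<equiv> (\<lambda>p. \<Sum>i\<in>{1..k}. F i a p)"
  assumes F: "\<And>i a. test 1 S (F i a)" and k: "0 < k"
    and orth: "\<And>a. (\<Sum>i\<in>{1..k}. ip (F i a) (F i a)) = ip (U a) (U a)"
    and avoid: "\<And>i a b. i \<in> {1..k} \<Longrightarrow> near n a b \<Longrightarrow> beta (X a b) (F i a) (F i b) = 0"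
    and T: "T = 2 * A"
    and m: "\<And>t. \<bar>t\<bar> \<le> pi \<Longrightarrow> - m \<le> dirichlet n t" and m0: "0 \<le> m"
    and X: "\<And>a b. shift_fun (K a b) (X a b)"
    and K: "\<And>a b. K a b \<le> len (a + b + 1)" "\<And>a b. K a b \<le> \<delta> * len (a + b + 1)"
    and S: "len T \<le> S" and \<delta>: "0 \<le> \<delta>"
    and osc: "\<And>a b. near n a b \<Longrightarrow> oscillating (len (a + b)) \<delta> (X a b)"
      "\<And>a b. near n a b \<Longrightarrow> oscillating (len (a + b)) \<delta> (\<lambda>v u. - X a b u v)"
  shows "(\<Sum>a<A. \<Sum>b<A. if near n a b then beta (X a b) (U a) (U b) else 0)
    \<le> (m + 1) * (real k - 1) * (\<Sum>a<A. ip (U a) (U a)) + real k * real k * (real A * real A * (100 * \<delta> * S))"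
proof -
  let ?I = "{1..k}"
  let ?e = "real A * real A * (200 * \<delta> * S)"
  have tF: "F i a \<in> tests" for i a by (rule testI_tests[OF F])
  have tU: "U a \<in> tests" for a unfolding U_def by (rule tests_sum[OF tF])
  define g where "g i j a = (\<lambda>p. F i a p - F j a p)" for i j a
  have g: "test 2 S (g i j a)" for i j a
    unfolding g_def using test_diff[OF F F, of i a j a] by simp
  let ?ip = "\<lambda>i j. (\<Sum>a<A. ip (g i j a) (g i j a))"
  let ?be = "\<lambda>i j. (\<Sum>a<A. \<Sum>b<A. if near n a b then beta (X a b) (g i j a) (g i j b) else 0)"
  have "- (m + 1) * ?ip i j - ?e \<le> ?be i j" for i j
    by (rule sum_beta_ge[OF g T m m0 X K S \<delta> osc])
  then have "(\<Sum>i\<in>?I. \<Sum>j\<in>?I. - (m + 1) * ?ip i j - ?e) \<le> (\<Sum>i\<in>?I. \<Sum>j\<in>?I. ?be i j)"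
    by (intro sum_mono)
  moreover have "(\<Sum>i\<in>?I. \<Sum>j\<in>?I. - (m + 1) * ?ip i j - ?e) = - (m + 1) * (\<Sum>i\<in>?I. \<Sum>j\<in>?I. ?ip i j) - real k * real k * ?e"
    unfolding sum_subtractf sum_distrib_left[symmetric] by simp
  \<comment> \<open>Expanding the squares gives 2 k times the sum of
    \<open>ip (F i a) (F i a)\<close> minus 2 \<open>ip (U a) (U a)\<close>; by \<open>orth\<close>
    the former sum is \<open>ip (U a) (U a)\<close> as well.\<close>
  moreover have "(\<Sum>i\<in>?I. \<Sum>j\<in>?I. ?ip i j) = 2 * (real k - 1) * (\<Sum>a<A. ip (U a) (U a))"
  proof -
    have "(\<Sum>i\<in>?I. \<Sum>j\<in>?I. ip (g i j a) (g i j a)) = 2 * (real k - 1) * ip (U a) (U a)" for a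
    proof -
      have ipU: "(\<Sum>i\<in>?I. \<Sum>j\<in>?I. ip (F i a) (F j a)) = ip (U a) (U a)"
      proof -
        have L: "ip (\<lambda>p. \<Sum>i\<in>J. F i a p) h = (\<Sum>i\<in>J. ip (F i a) h)" if "h \<in> tests" for J h
          by (rule ip_sum_left[OF tF that])
        have "ip (U a) (U a) = (\<Sum>i\<in>?I. ip (F i a) (U a))"
          using L[OF tU] by (simp add: U_def)
        also have "\<dots> = (\<Sum>i\<in>?I. \<Sum>j\<in>?I. ip (F i a) (F j a))"
        proof (rule sum.cong[OF refl])
          fix i
          have "ip (F i a) (U a) = ip (U a) (F i a)" by (rule ip_commute)
          also have "\<dots> = (\<Sum>j\<in>?I. ip (F j a) (F i a))" using L[OF tF] by (simp add: U_def)
          also have "\<dots> = (\<Sum>j\<in>?I. ip (F i a) (F j a))" by (intro sum.cong refl ip_commute)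
          finally show "ip (F i a) (U a) = (\<Sum>j\<in>?I. ip (F i a) (F j a))" .
        qed
        finally show ?thesis by simp
      qed
      have "(\<Sum>i\<in>?I. \<Sum>j\<in>?I. ip (g i j a) (g i j a))
          = (\<Sum>i\<in>?I. \<Sum>j\<in>?I. ip (F i a) (F i a) - 2 * ip (F i a) (F j a) + ip (F j a) (F j a))"
        by (simp add: g_def ip_diff_diff tF)
      also have "\<dots> = real k * (\<Sum>i\<in>?I. ip (F i a) (F i a)) - 2 * (\<Sum>i\<in>?I. \<Sum>j\<in>?I. ip (F i a) (F j a)) + real k * (\<Sum>i\<in>?I. ip (F i a) (F i a))"
        by (simp add: sum.distrib sum_subtractf sum_distrib_left)
      also have "\<dots> = 2 * (real k - 1) * ip (U a) (U a)"
        unfolding orth ipU by (simp add: algebra_simps)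
      finally show ?thesis .
    qed
    moreover have "(\<Sum>i\<in>?I. \<Sum>j\<in>?I. ?ip i j) = (\<Sum>a<A. \<Sum>i\<in>?I. \<Sum>j\<in>?I. ip (g i j a) (g i j a))"
      by (subst (2) sum.swap, subst sum.swap, simp)
    ultimately show ?thesis by (simp add: sum_distrib_left)
  qed
  \<comment> \<open>By \<open>avoid\<close> only the cross terms survive, each with a minus sign. So
    the lower bound for differences becomes an upper bound for \<open>U\<close>.\<close>
  moreover have "(\<Sum>i\<in>?I. \<Sum>j\<in>?I. ?be i j) = - 2 * (\<Sum>a<A. \<Sum>b<A. if near n a b then beta (X a b) (U a) (U b) else 0)"
  proof -
    have "(\<Sum>i\<in>?I. \<Sum>j\<in>?I. beta (X a b) (g i j a) (g i j b)) = - 2 * beta (X a b) (U a) (U b)" if nr: "near n a b" for a b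
    proof -
      have UU: "beta (X a b) (U a) (U b) = (\<Sum>i\<in>?I. \<Sum>j\<in>?I. beta (X a b) (F i a) (F j b))"
        unfolding U_def beta_sum_left[OF tF tests_sum[OF tF] X]
        by (rule sum.cong[OF refl], rule beta_sum_right[OF tF tF X])
      have ex: "beta (X a b) (g i j a) (g i j b) = - beta (X a b) (F i a) (F j b) - beta (X a b) (F j a) (F i b)"
        if "i \<in> ?I" "j \<in> ?I" for i j
        unfolding g_def using avoid[OF that(1) nr] avoid[OF that(2) nr]
        by (simp add: beta_diff_left[OF tF tF tests_diff[OF tF tF] X] beta_diff_right[OF tF tF tF X])
      have "(\<Sum>i\<in>?I. \<Sum>j\<in>?I. beta (X a b) (g i j a) (g i j b))
          = (\<Sum>i\<in>?I. \<Sum>j\<in>?I. - beta (X a b) (F i a) (F j b) - beta (X a b) (F j a) (F i b))"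
        by (intro sum.cong refl ex)
      also have "\<dots> = - (\<Sum>i\<in>?I. \<Sum>j\<in>?I. beta (X a b) (F i a) (F j b)) - (\<Sum>i\<in>?I. \<Sum>j\<in>?I. beta (X a b) (F j a) (F i b))"
        by (simp add: sum_subtractf sum_negf)
      also have "(\<Sum>i\<in>?I. \<Sum>j\<in>?I. beta (X a b) (F j a) (F i b)) = (\<Sum>i\<in>?I. \<Sum>j\<in>?I. beta (X a b) (F i a) (F j b))"
        by (rule sum.swap)
      finally show ?thesis unfolding UU by simp
    qed
    moreover have "(\<Sum>i\<in>?I. \<Sum>j\<in>?I. ?be i j) = (\<Sum>a<A. \<Sum>b<A. if near n a b then (\<Sum>i\<in>?I. \<Sum>j\<in>?I. beta (X a b) (g i j a) (g i j b)) else 0)"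
      by (subst sum_swap2) (intro sum.cong refl, auto)
    ultimately show ?thesis by (simp add: sum_distrib_left if_distrib[of "\<lambda>r. - (2 * r)"] sum_negf cong: if_cong)
  qed
  ultimately have "- (m + 1) * (2 * (real k - 1) * (\<Sum>a<A. ip (U a) (U a))) - real k * real k * ?e
      \<le> - 2 * (\<Sum>a<A. \<Sum>b<A. if near n a b then beta (X a b) (U a) (U b) else 0)"
    by simp
  then show ?thesis by (simp add: algebra_simps)
qed

end

section \<open>Constant functions on a window\<close>

context prob_space
begin

text \<open>Scaling h by t multiplies the form by t, while the bound of \<open>beta_le_ip\<close>
  stays at \<open>ip g g / 2\<close>. This handles the null set that the colours may miss.\<close>

lemma beta_null:
  assumes h: "h \<in> tests" "ip h h = 0" and g: "g \<in> tests" and X: "shift_fun K X"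
  shows "beta X h g = 0" "beta X g h = 0"
proof -
  have *: "beta Y h g = 0" if Y: "shift_fun K Y" for Y
  proof (rule ccontr)
    assume ne: "beta Y h g \<noteq> 0"
    define t where "t = (ip g g + 1) / beta Y h g"
    have "beta Y (\<lambda>p. t * h p) g \<le> (ip (\<lambda>p. t * h p) (\<lambda>p. t * h p) + ip g g) / 2"
      by (rule beta_le_ip[OF tests_scale[OF h(1)] g Y])
    also have "ip (\<lambda>p. t * h p) (\<lambda>p. t * h p) = t * t * ip h h" by (simp add: ip_def mult_ac)
    finally have "t * beta Y h g \<le> ip g g / 2" using h(2) by (simp add: beta_scale_left)
    moreover have "t * beta Y h g = ip g g + 1" using ne by (simp add: t_def)
    ultimately show False using ip_sq_nonneg[of g] by simp
  qed
  show "beta X h g = 0" by (rule *[OF X])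
  show "beta X g h = 0" unfolding beta_adjoint[OF g h(1) X] by (rule *[OF shift_fun_adjoint[OF X]])
qed

lemma ip_eq_0_AE:
  assumes h: "test B S h" and ae: "AE p in M \<Otimes>\<^sub>M lborel. h p = 0"
  shows "ip h h = 0"
proof -
  have [measurable]: "h \<in> borel_measurable (M \<Otimes>\<^sub>M borel)" using h by (rule testD(1))
  have "AE u in M. AE x in lborel. h (u, x) = 0" by (rule pair_sigma_finite.AE_pair[OF pair_sigma_finite.intro[OF sigma_finite_measure_axioms lborel.sigma_finite_measure_axioms] ae])
  then have "AE u in M. (\<integral>x. h (u, x) * h (u, x) \<partial>lborel) = 0"
  proof (eventually_elim)
    case (elim u)
    then have "AE x in lborel. h (u, x) * h (u, x) = 0" by eventually_elim simp
    then show ?case by (rule integral_eq_zero_AE)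
  qed
  then show ?thesis unfolding ip_def by (rule integral_eq_zero_AE)
qed

text \<open>For x at distance at least K from the ends of the window, both ends of every edge lie
  inside it; only the two margins of length K are lost.\<close>

lemma beta_window_ge:
  assumes S: "0 \<le> K" "K \<le> S" and X: "shift_fun K X"
  defines "I \<equiv> (\<lambda>(u, x). indicator {-S..S} x)"
  shows "2 * S - 2 * K \<le> beta X I I" "test 1 S I"
proof -
  have "(\<lambda>(u, x). indicator {-S..S} x) \<in> borel_measurable (M \<Otimes>\<^sub>M borel)" by measurable
  then show I: "test 1 S I" unfolding test_def I_def by (auto simp: indicator_def)
  let ?h = "\<lambda>(u, v, x). indicator {-S+K..S-K} x"
  have "?h \<in> borel_measurable (M \<Otimes>\<^sub>M M \<Otimes>\<^sub>M borel)" by measurable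
  then have h: "kernel 1 S ?h" using S by (auto simp: kernel_def indicator_def)
  have "tri_integral ?h \<le> beta X I I"
    unfolding beta_tri
  proof (rule tri_integral_mono[OF h kernel_beta[OF I I X]])
    fix u v x assume "u \<in> space M" "v \<in> space M"
    then have "\<bar>X u v\<bar> \<le> K" using X by (simp add: shift_fun_def)
    then show "?h (u, v, x) \<le> (case (u, v, x) of (u, v, x) \<Rightarrow> I (u, x) * I (v, x + X u v))"
      using S by (auto simp: I_def indicator_def)
  qed
  then show "2 * S - 2 * K \<le> beta X I I" using S by (simp add: tri_integral_def prob_space)
qed

lemma beta_ge_AE:
  assumes F: "test 1 S F" "AE p in M \<Otimes>\<^sub>M lborel. F p = indicator {-S..S} (snd p)"
    and G: "test 1 S G" "AE p in M \<Otimes>\<^sub>M lborel. G p = indicator {-S..S} (snd p)"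
    and S: "0 \<le> K" "K \<le> S" and X: "shift_fun K X"
  shows "2 * S - 2 * K \<le> beta X F G"
proof -
  define I :: "'a \<times> real \<Rightarrow> real" where "I = (\<lambda>(u, x). indicator {-S..S} x)"
  have I: "2 * S - 2 * K \<le> beta X I I" "test 1 S I"
    unfolding I_def by (rule beta_window_ge[OF S X])+
  have t: "I \<in> tests" "F \<in> tests" "G \<in> tests" using I F G by (auto intro: testI_tests)
  have n: "ip (\<lambda>p. I p - H p) (\<lambda>p. I p - H p) = 0"
    if H: "test 1 S H" "AE p in M \<Otimes>\<^sub>M lborel. H p = indicator {-S..S} (snd p)" for H
  proof (rule ip_eq_0_AE[OF test_diff[OF I(2) H(1)]])
    show "AE p in M \<Otimes>\<^sub>M lborel. I p - H p = 0"
      using H(2) by eventually_elim (simp add: I_def case_prod_unfold)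
  qed
  have "beta X I I - beta X F I = 0"
    using beta_null(1)[OF tests_diff[OF t(1,2)] n[OF F] t(1) X] beta_diff_left[OF t(1,2,1) X] by simp
  moreover have "beta X F I - beta X F G = 0"
    using beta_null(2)[OF tests_diff[OF t(1,3)] n[OF G] t(2) X] beta_diff_right[OF t(2,1,3) X] by simp
  ultimately show ?thesis using I(1) by simp
qed

end

text \<open>Rows with n \<le> a < A - n have all 2 n + 1 neighbours; the remaining rows are
  dropped.\<close>

lemma sum_near_ge:
  assumes c: "0 \<le> (c::real)"
  shows "(real A - 2 * real n) * ((2 * real n + 1) * c) \<le> (\<Sum>a<A. \<Sum>b<A. if near n a b then c else 0)"
proof -
  have row: "(\<Sum>b<A. if near n a b then c else 0) = (2 * real n + 1) * c" if a: "a \<in> {n..<A - n}" for a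
  proof -
    have "(\<Sum>b<A. if near n a b then c else 0) = (\<Sum>b\<in>{a - n..a + n}. c)"
      by (rule sum.mono_neutral_cong_right) (use a in \<open>auto simp: near_def\<close>)
    also have "\<dots> = (2 * real n + 1) * c" using a by (simp add: of_nat_diff algebra_simps)
    finally show ?thesis .
  qed
  have nn: "0 \<le> (\<Sum>b<A. if near n a b then c else 0)" for a using c by (intro sum_nonneg) auto
  have "(real A - 2 * real n) * ((2 * real n + 1) * c) \<le> real (card {n..<A - n}) * ((2 * real n + 1) * c)"
    using c by (intro mult_right_mono) auto
  also have "\<dots> = (\<Sum>a\<in>{n..<A - n}. \<Sum>b<A. if near n a b then c else 0)" using row by simp
  also have "\<dots> \<le> (\<Sum>a<A. \<Sum>b<A. if near n a b then c else 0)"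
    using nn by (intro sum_mono2) auto
  finally show ?thesis .
qed

section \<open>Colourings of the strips\<close>

lemma borel_measurable_band:
  fixes f :: "real \<times> real \<Rightarrow> real"
  assumes [measurable]: "f \<in> borel_measurable borel"
  shows "f \<in> borel_measurable (band \<Otimes>\<^sub>M borel)"
proof -
  have [measurable]: "f \<in> borel_measurable (borel \<Otimes>\<^sub>M borel)" by (simp add: borel_prod)
  have [measurable]: "fst \<in> band \<Otimes>\<^sub>M borel \<rightarrow>\<^sub>M (borel :: real measure)"
    using measurable_compose[OF measurable_fst measurable_ident_band] by simp
  have "(\<lambda>p. f (fst p, snd p)) \<in> borel_measurable (band \<Otimes>\<^sub>M borel)" by measurable
  then show ?thesis by simp
qed

lemma AE_band:
  fixes f :: "real \<times> real \<Rightarrow> real"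
  assumes f: "f \<in> borel_measurable borel" and ae: "AE p in lborel. fst p \<in> {1..2} \<longrightarrow> f p = 1"
  shows "AE p in band \<Otimes>\<^sub>M lborel. f p = 1"
proof -
  have [measurable]: "f \<in> borel_measurable (band \<Otimes>\<^sub>M lborel)"
    using borel_measurable_band[OF f] by (simp cong: measurable_cong_sets sets_pair_measure_cong)
  have "AE u in lborel. AE x in lborel. u \<in> {1..2::real} \<longrightarrow> f (u, x) = 1"
    using lborel_pair.AE_pair[OF ae[folded lborel_prod]] by simp
  then have "AE u in lborel. u \<in> {1..2::real} \<longrightarrow> (AE x in lborel. f (u, x) = 1)"
    by eventually_elim auto
  then have "AE u in band. AE x in lborel. f (u, x) = 1"
    unfolding band_def by (subst AE_restrict_space_iff) auto
  moreover have sets: "{p \<in> space (band \<Otimes>\<^sub>M lborel). f p = 1} \<in> sets (band \<Otimes>\<^sub>M lborel)"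
  proof -
    have "f -` {1} \<inter> space (band \<Otimes>\<^sub>M lborel) \<in> sets (band \<Otimes>\<^sub>M lborel)" by measurable
    then show ?thesis by (simp add: vimage_def Int_def conj_commute)
  qed
  ultimately show ?thesis
    by (intro pair_sigma_finite.AE_pair_measure[OF pair_sigma_finite.intro[OF band.sigma_finite_measure_axioms lborel.sigma_finite_measure_axioms] sets])
qed

text \<open>
  \<open>f i a\<close> is the indicator of colour \<open>i\<close> in strip \<open>a\<close>, in the coordinates \<open>(u, x)\<close> of the point of
  height \<open>q ^ (2 * a) * u\<close> above \<open>x\<close>. After passing to Borel subsets the colours cover only almost
  every point.
\<close>

definition band_coloring :: "nat \<Rightarrow> (nat \<Rightarrow> nat \<Rightarrow> real \<times> real \<Rightarrow> real) \<Rightarrow> bool" where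
  "band_coloring k f \<longleftrightarrow>
     (\<forall>i a. f i a \<in> borel_measurable borel) \<and> (\<forall>i a p. f i a p \<in> {0, 1}) \<and>
     (\<forall>i j a p. i \<noteq> j \<longrightarrow> f i a p * f j a p = 0) \<and> (\<forall>a p. (\<Sum>i\<in>{1..k}. f i a p) \<le> 1) \<and>
     (\<forall>a. AE p in lborel. fst p \<in> {1..2} \<longrightarrow> (\<Sum>i\<in>{1..k}. f i a p) = 1)"

text \<open>For \<kappa> = 2 cosh d the equation says that the half-plane points above x and x' at
  the two given heights lie at distance d.\<close>

definition monochromatic_pair :: "nat \<Rightarrow> real \<Rightarrow> nat \<Rightarrow> (nat \<Rightarrow> nat \<Rightarrow> real \<times> real \<Rightarrow> real) \<Rightarrow> bool" where
  "monochromatic_pair q \<kappa> k f \<longleftrightarrow> (\<exists>i\<in>{1..k}. \<exists>a b. \<exists>u\<in>{1..2}. \<exists>v\<in>{1..2}. \<exists>x x'.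
     (x' - x)\<^sup>2 + (real q ^ (2 * a) * u)\<^sup>2 + (real q ^ (2 * b) * v)\<^sup>2 = \<kappa> * (real q ^ (2 * a) * u) * (real q ^ (2 * b) * v)
     \<and> f i a (u, x) * f i b (v, x') \<noteq> 0)"

lemma band_coloring_monochromatic_pair:
  "\<exists>q::nat. 0 < q \<and> (\<forall>\<kappa> k f. 100 * real q ^ 300 \<le> \<kappa> \<longrightarrow> 1 \<le> k \<longrightarrow> k \<le> 5 \<longrightarrow> band_coloring k f \<longrightarrow> monochromatic_pair q \<kappa> k f)"
proof -
  define \<delta> :: real where "\<delta> = 1 / 10 ^ 9"
  define \<tau> :: real where "\<tau> = \<delta> ^ 4 / 2 ^ 35"
  define A :: nat where "A = 60000"
  define m :: real where "m = 245 / 1000 * 301"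
  have pos: "0 < \<delta>" "0 < \<tau>" "\<delta> \<le> 1" by (simp_all add: \<delta>_def \<tau>_def)
  \<comment> \<open>The offset is at most 2 sqrt \<kappa> * l and the next scale is \<tau> * q *
    sqrt \<kappa> * l; this q makes the former at most \<delta> times the latter.\<close>
  obtain q :: nat where "2 / (\<delta> * \<tau>) < real q" using reals_Archimedean2 by blast
  then have q2: "2 \<le> \<delta> * (\<tau> * real q)" using pos by (simp add: field_simps)
  then have q0: "0 < q" using pos by (cases q) auto
  show ?thesis
  proof (intro exI[of _ q] conjI allI impI q0, rule ccontr)
    fix \<kappa> :: real and k :: nat and f :: "nat \<Rightarrow> nat \<Rightarrow> real \<times> real \<Rightarrow> real"
    assume \<kappa>: "100 * real q ^ 300 \<le> \<kappa>" and k: "1 \<le> k" "k \<le> 5"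
      and f: "band_coloring k f" and avoid: "\<not> monochromatic_pair q \<kappa> k f"
    from f have meas: "\<forall>i a. f i a \<in> borel_measurable borel" and f01: "\<forall>i a p. f i a p \<in> {0, 1}"
      and disj: "\<forall>i j a p. i \<noteq> j \<longrightarrow> f i a p * f j a p = 0" and le1: "\<forall>a p. (\<Sum>i\<in>{1..k}. f i a p) \<le> 1"
      and ae: "\<forall>a. AE p in lborel. fst p \<in> {1..2} \<longrightarrow> (\<Sum>i\<in>{1..k}. f i a p) = 1"
      unfolding band_coloring_def by blast+
    have "0 < 100 * real q ^ 300" using q0 by simp
    then have "0 < \<kappa>" using \<kappa> by linarith
    then have k0: "0 < \<kappa>" "0 < sqrt \<kappa>" by auto
    \<comment> \<open>With this base, \<open>len (a + b)\<close> is exactly the largest L that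
      \<open>oscillating_R\<close> permits for the factor l = q^(a + b).\<close>
    interpret sc: scales band "sqrt \<kappa> * \<tau>" q "2 * A"
      by unfold_locales (use k0 pos q0 in auto)
    define ra where "ra a b = real q ^ (2 * a) / real q ^ (2 * b)" for a b
    have hs: "horo_shift \<kappa> (ra a b) (ra b a)" if "near 150 a b" for a b
    proof -
      have "100 * ra a b \<le> \<kappa>" if "a \<le> b + 150" for a b
      proof -
        \<comment> \<open>The exponent 300 is 2 * 150: inside the band the heights differ at most by
          this power of q.\<close>
        have "real q ^ (2 * a) \<le> real q ^ (2 * b + 300)" using that q0 by (intro power_increasing) auto
        then have "ra a b \<le> real q ^ 300" using q0 by (simp add: ra_def power_add divide_le_eq mult.commute)
        then show ?thesis using \<kappa> by simp
      qed
      then show ?thesis using that q0 by unfold_locales (auto simp: near_def ra_def)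
    qed
    define l where "l a b = real q ^ (a + b)" for a b
    have l: "0 < l a b" for a b using q0 by (simp add: l_def)
    \<comment> \<open>Outside the band \<open>horo_shift\<close> may fail, and the zero shift still
      satisfies the bound K.\<close>
    define X where "X a b = (if near 150 a b then (\<lambda>u v. l a b * horo_shift.R \<kappa> (ra a b) (ra b a) u v) else (\<lambda>_ _. 0))" for a b
    define K where "K a b = l a b * (2 * sqrt \<kappa>)" for a b
    have X: "band.shift_fun (K a b) (X a b)" for a b
    proof (cases "near 150 a b")
      case True
      then show ?thesis using horo_shift.shift_fun_R[OF hs[OF True], of "l a b"] l[of a b] by (simp add: X_def K_def)
    next
      case False
      then show ?thesis using l[of a b] k0 by (simp add: X_def K_def band.shift_fun_def)
    qed
    have len: "sc.len (a + b) = sqrt \<kappa> * \<tau> * l a b" for a b by (simp add: sc.len_def l_def)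
    have lenl: "sc.len (a + b) \<le> \<bar>l a b\<bar> * sqrt \<kappa> * (\<delta> ^ 4 / 2 ^ 35)" for a b
      using l[of a b] unfolding len \<tau>_def[symmetric] by (simp add: mult_ac)
    have K2: "K a b \<le> \<delta> * sc.len (a + b + 1)" for a b
    proof -
      have "K a b = l a b * sqrt \<kappa> * 2" by (simp add: K_def)
      also have "\<dots> \<le> l a b * sqrt \<kappa> * (\<delta> * (\<tau> * real q))" using q2 l[of a b] k0 by (intro mult_left_mono) auto
      also have "\<dots> = \<delta> * sc.len (a + b + 1)" by (simp add: sc.len_def l_def)
      finally show ?thesis .
    qed
    have K1: "K a b \<le> sc.len (a + b + 1)" for a b
    proof -
      have "\<delta> * sc.len (a + b + 1) \<le> 1 * sc.len (a + b + 1)"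
        using pos sc.len_pos[of "a + b + 1"] by (intro mult_right_mono) auto
      then show ?thesis using K2[of a b] by simp
    qed
    have Rsym: "horo_shift.R \<kappa> (ra a b) (ra b a) u v = horo_shift.R \<kappa> (ra b a) (ra a b) v u" if "near 150 a b" for a b u v
    proof -
      have "near 150 b a" using that by (simp add: near_def)
      then show ?thesis
        by (simp add: horo_shift.R_def[OF hs] horo_shift.P_def[OF hs] that mult_ac)
    qed
    have osc1: "band.oscillating (sc.len (a + b)) \<delta> (X a b)" if "near 150 a b" for a b
    proof -
      have "band.oscillating (sc.len (a + b)) \<delta> (\<lambda>u v. l a b * horo_shift.R \<kappa> (ra a b) (ra b a) u v)"
        using l[of a b] by (intro horo_shift.oscillating_R[OF hs[OF that] pos(1) _ sc.len_pos lenl]) auto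
      then show ?thesis using that by (simp add: X_def)
    qed
    \<comment> \<open>The adjoint form has the strips exchanged and l negated, which is why
      \<open>oscillating_R\<close> admits l of either sign.\<close>
    have osc2: "band.oscillating (sc.len (a + b)) \<delta> (\<lambda>v u. - X a b u v)" if nr: "near 150 a b" for a b
    proof -
      have nr': "near 150 b a" using nr by (simp add: near_def)
      have "band.oscillating (sc.len (a + b)) \<delta> (\<lambda>v u. (- l a b) * horo_shift.R \<kappa> (ra b a) (ra a b) v u)"
        using l[of a b] lenl[of a b] by (intro horo_shift.oscillating_R[OF hs[OF nr'] pos(1) _ sc.len_pos]) auto
      then show ?thesis using nr by (simp add: X_def Rsym[OF nr])
    qed
    \<comment> \<open>The window is as wide as the coarsest scale, so every offset is at most
      \<delta> * S and window effects are negligible.\<close>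
    define S where "S = sc.len (2 * A)"
    have S: "0 < S" unfolding S_def by (rule sc.len_pos)
    define F where "F i a = (\<lambda>p. f i a p * indicator {-S..S} (snd p))" for i a
    define U where "U a = (\<lambda>p. \<Sum>i\<in>{1..k}. F i a p)" for a
    have F: "band.test 1 S (F i a)" for i a
    proof -
      note [measurable] = borel_measurable_band[OF meas[rule_format, of i a]]
      have m: "F i a \<in> borel_measurable (band \<Otimes>\<^sub>M borel)" unfolding F_def by measurable
      have "\<bar>f i a p\<bar> \<le> 1" for p using f01[rule_format, of i a p] by auto
      then show ?thesis using m unfolding band.test_def by (auto simp: F_def indicator_def)
    qed
    have TF: "F i a \<in> band.tests" for i a by (rule band.testI_tests[OF F])
    have Ueq: "U a p = (\<Sum>i\<in>{1..k}. f i a p) * indicator {-S..S} (snd p)" for a p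
      by (simp add: U_def F_def sum_distrib_right)
    have U: "band.test 1 S (U a)" for a
    proof -
      have m: "U a \<in> borel_measurable (band \<Otimes>\<^sub>M borel)"
        unfolding U_def using band.testD(1)[OF F] by (intro borel_measurable_sum) auto
      have "0 \<le> f i a p" for i p using f01[rule_format, of i a p] by auto
      then have "\<bar>\<Sum>i\<in>{1..k}. f i a p\<bar> \<le> 1" for p
        using le1[rule_format, of a p] by (simp only: abs_of_nonneg sum_nonneg)
      then show ?thesis using m unfolding band.test_def Ueq by (auto simp: indicator_def)
    qed
    have Uae: "AE p in band \<Otimes>\<^sub>M lborel. U a p = indicator {-S..S} (snd p)" for a
    proof -
      have "AE p in band \<Otimes>\<^sub>M lborel. (\<Sum>i\<in>{1..k}. f i a p) = 1"
        using ae by (intro AE_band borel_measurable_sum meas[rule_format]) auto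
      then show ?thesis by eventually_elim (simp add: Ueq)
    qed
    have orth: "(\<Sum>i\<in>{1..k}. band.ip (F i a) (F i a)) = band.ip (\<lambda>p. \<Sum>i\<in>{1..k}. F i a p) (\<lambda>p. \<Sum>i\<in>{1..k}. F i a p)" for a
    proof -
      have TU: "(\<lambda>p. \<Sum>i\<in>{1..k}. F i a p) \<in> band.tests" by (rule band.tests_sum[OF TF])
      have "band.ip (\<lambda>p. \<Sum>i\<in>{1..k}. F i a p) (\<lambda>p. \<Sum>i\<in>{1..k}. F i a p) = (\<Sum>i\<in>{1..k}. band.ip (F i a) (\<lambda>p. \<Sum>i\<in>{1..k}. F i a p))"
        by (rule band.ip_sum_left[OF TF TU])
      also have "\<dots> = (\<Sum>i\<in>{1..k}. band.ip (F i a) (F i a))"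
      proof (rule sum.cong[OF refl])
        fix i assume i: "i \<in> {1..k}"
        have "F i a p * (\<Sum>j\<in>{1..k}. F j a p) = F i a p * F i a p" for p
        proof -
          have "F i a p * (\<Sum>j\<in>{1..k}. F j a p) = (\<Sum>j\<in>{1..k}. if j = i then F i a p * F i a p else 0)"
            unfolding sum_distrib_left
          proof (rule sum.cong[OF refl])
            fix j
            show "F i a p * F j a p = (if j = i then F i a p * F i a p else 0)"
              using disj[rule_format, of i j a p] by (auto simp: F_def)
          qed
          then show ?thesis using i by simp
        qed
        then show "band.ip (F i a) (\<lambda>p. \<Sum>i\<in>{1..k}. F i a p) = band.ip (F i a) (F i a)"
          by (simp only: band.ip_def)
      qed
      finally show ?thesis by simp
    qed
    have av: "band.beta (X a b) (F i a) (F i b) = 0" if i: "i \<in> {1..k}" and nr: "near 150 a b" for i a b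
    proof -
      have "F i a (u, x) * F i b (v, x + X a b u v) = 0" if uv: "u \<in> {1..2}" "v \<in> {1..2}" for u v x
      proof -
        let ?y = "real q ^ (2 * a) * u" and ?z = "real q ^ (2 * b) * v"
        have "(X a b u v)\<^sup>2 = (l a b)\<^sup>2 * horo_shift.P \<kappa> (ra a b) (ra b a) u v"
          using horo_shift.R_sq[OF hs[OF nr] uv] nr by (simp add: X_def power_mult_distrib power2_eq_square)
        also have "\<dots> = \<kappa> * ?y * ?z - ?y\<^sup>2 - ?z\<^sup>2"
        proof -
          have "horo_shift.P \<kappa> (ra a b) (ra b a) u v = \<kappa> * u * v - ra a b * u\<^sup>2 - ra b a * v\<^sup>2"
            by (rule horo_shift.P_def[OF hs[OF nr]])
          moreover have "(l a b)\<^sup>2 * (\<kappa> * u * v - ra a b * u\<^sup>2 - ra b a * v\<^sup>2) = \<kappa> * ?y * ?z - ?y\<^sup>2 - ?z\<^sup>2"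
          proof -
            have "(\<alpha> * \<gamma>)\<^sup>2 * (\<kappa> * u * v - \<alpha>\<^sup>2 / \<gamma>\<^sup>2 * u\<^sup>2 - \<gamma>\<^sup>2 / \<alpha>\<^sup>2 * v\<^sup>2)
                = \<kappa> * (\<alpha>\<^sup>2 * u) * (\<gamma>\<^sup>2 * v) - (\<alpha>\<^sup>2 * u)\<^sup>2 - (\<gamma>\<^sup>2 * v)\<^sup>2" if "\<alpha> \<noteq> 0" "\<gamma> \<noteq> 0" for \<alpha> \<gamma>
              using that by (simp add: field_simps power2_eq_square)
            from this[of "real q ^ a" "real q ^ b"] show ?thesis
              using q0 by (simp add: ra_def l_def power_add power_even_eq)
          qed
          ultimately show ?thesis by (simp only:)
        qed
        finally have "((x + X a b u v) - x)\<^sup>2 + ?y\<^sup>2 + ?z\<^sup>2 = \<kappa> * ?y * ?z" by simp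
        then have "f i a (u, x) * f i b (v, x + X a b u v) = 0" using avoid i uv unfolding monochromatic_pair_def by blast
        then show ?thesis by (auto simp: F_def)
      qed
      then have "band.beta (X a b) (F i a) (F i b) = (\<integral>u. \<integral>v. 0 \<partial>band \<partial>band)"
        unfolding band.beta_def
        by (intro Bochner_Integration.integral_cong[OF refl]) (simp only: space_band Bochner_Integration.integral_zero)
      then show ?thesis by simp
    qed
    have m: "- m \<le> dirichlet 150 t" if "\<bar>t\<bar> \<le> pi" for t using dirichlet_ge[OF that] by (simp add: m_def)
    have up: "(\<Sum>a<A. \<Sum>b<A. if near 150 a b then band.beta (X a b) (U a) (U b) else 0)
       \<le> (m + 1) * (real k - 1) * (\<Sum>a<A. band.ip (U a) (U a)) + real k * real k * (real A * real A * (100 * \<delta> * S))"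
      unfolding U_def
      by (rule sc.sum_beta_colors_le[OF F _ orth av refl m _ X K1 K2 _ _ osc1 osc2])
         (use k pos in \<open>auto simp: m_def S_def\<close>)
    have ipU: "(\<Sum>a<A. band.ip (U a) (U a)) \<le> real A * (2 * S)"
      using sum_mono[of "{..<A}" "\<lambda>a. band.ip (U a) (U a)" "\<lambda>_. 2 * S"] band.ip_bounded[OF U] S by simp
    have "real k * real k \<le> 5 * 5" using k by (intro mult_mono) auto
    then have up2: "(m + 1) * (real k - 1) * (\<Sum>a<A. band.ip (U a) (U a)) + real k * real k * (real A * real A * (100 * \<delta> * S))
      \<le> (m + 1) * 4 * (real A * (2 * S)) + 5 * 5 * (real A * real A * (100 * \<delta> * S))"
      using ipU k S pos
      by (intro add_mono mult_mono) (auto simp: m_def intro!: sum_nonneg band.ip_sq_nonneg)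
    have low: "(real A - 2 * real 150) * ((2 * real 150 + 1) * ((2 - 2 * \<delta>) * S))
        \<le> (\<Sum>a<A. \<Sum>b<A. if near 150 a b then band.beta (X a b) (U a) (U b) else 0)"
    proof -
      have "(\<Sum>a<A. \<Sum>b<A. if near 150 a b then (2 - 2 * \<delta>) * S else 0)
        \<le> (\<Sum>a<A. \<Sum>b<A. if near 150 a b then band.beta (X a b) (U a) (U b) else 0)"
      proof (intro sum_mono)
        fix a b assume "a \<in> {..<A}" "b \<in> {..<A}"
        then have ab: "a + b + 1 \<le> 2 * A" by auto
        have "sc.len (a + b + 1) \<le> S"
          unfolding S_def sc.len_def using ab q0 k0 pos by (intro mult_left_mono power_increasing) auto
        then have KS: "K a b \<le> \<delta> * S" using K2[of a b] pos by (meson mult_left_mono order_trans less_imp_le)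
        moreover have "\<delta> * S \<le> 1 * S" using pos S by (intro mult_right_mono) auto
        moreover have "0 \<le> K a b" using l[of a b] k0 by (simp add: K_def)
        ultimately have "2 * S - 2 * K a b \<le> band.beta (X a b) (U a) (U b)"
          by (intro band.beta_ge_AE[OF U Uae U Uae _ _ X]) auto
        then show "(if near 150 a b then (2 - 2 * \<delta>) * S else 0) \<le> (if near 150 a b then band.beta (X a b) (U a) (U b) else 0)"
          using KS by (simp add: algebra_simps)
      qed
      moreover have "0 \<le> (2 - 2 * \<delta>) * S" using pos S by simp
      ultimately show ?thesis using sum_near_ge[of "(2 - 2 * \<delta>) * S" A 150] by simp
    qed
    have "(real A - 2 * real 150) * ((2 * real 150 + 1) * (2 - 2 * \<delta>)) * S
      \<le> ((m + 1) * 4 * (real A * 2) + 5 * 5 * (real A * real A * (100 * \<delta>))) * S"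
      using low up up2 by (simp add: algebra_simps)
    then have "(real A - 2 * real 150) * ((2 * real 150 + 1) * (2 - 2 * \<delta>))
      \<le> (m + 1) * 4 * (real A * 2) + 5 * 5 * (real A * real A * (100 * \<delta>))"
      using S mult_le_cancel_right_pos by blast
    \<comment> \<open>About 59700 * 602 = 35939400 on the left, against 298.98 * 120000 + 9000 =
      35886600 on the right. The 9000 is the total error 25 * A^2 * 100 * \<delta>.\<close>
    then show False by (simp add: A_def m_def \<delta>_def)
  qed
qed

section \<open>Transfer to the disk\<close>

definition cayley :: "complex \<Rightarrow> complex" where
  "cayley z = (z - \<i>) / (z + \<i>)"

lemma cayley_in_hyp_plane:
  assumes "0 < Im z" shows "cayley z \<in> hyp_plane"
proof -
  have "(cmod (z - \<i>))\<^sup>2 < (cmod (z + \<i>))\<^sup>2"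
    using assms by (simp only: cmod_power2) (simp add: power2_eq_square algebra_simps)
  then have "cmod (z - \<i>) < cmod (z + \<i>)" using power_less_imp_less_base norm_ge_zero by blast
  moreover have "0 < cmod (z + \<i>)" using calculation norm_ge_zero[of "z - \<i>"] by linarith
  ultimately show ?thesis by (simp add: hyp_plane_def cayley_def norm_divide)
qed

lemma cayley_inverse:
  assumes "0 < Im z" shows "\<i> * (1 + cayley z) / (1 - cayley z) = z"
proof -
  have "Im (z + \<i>) \<noteq> 0" using assms by simp
  then have ne: "z + \<i> \<noteq> 0" by (metis zero_complex.sel(2))
  have "1 + cayley z = 2 * z / (z + \<i>)" "1 - cayley z = 2 * \<i> / (z + \<i>)"
    using ne by (simp_all add: cayley_def field_simps)
  then show ?thesis using ne by simp
qed

text \<open>Both sides are the pseudo-hyperbolic distance, in the disk and in the half-plane.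
  Numerator and denominator acquire factors of equal modulus.\<close>

lemma norm_cayley_quotient:
  assumes z: "0 < Im z" and w: "0 < Im w"
  shows "cmod ((cayley w - cayley z) / (1 - cnj (cayley z) * cayley w)) = cmod (w - z) / cmod (w - cnj z)"
proof -
  have "Im (z + \<i>) \<noteq> 0" "Im (w + \<i>) \<noteq> 0" "Im (cnj z - \<i>) \<noteq> 0" "Im (w - cnj z) \<noteq> 0" using z w by auto
  then have ne: "z + \<i> \<noteq> 0" "w + \<i> \<noteq> 0" "cnj z - \<i> \<noteq> 0" "w - cnj z \<noteq> 0" by (metis zero_complex.sel(2))+
  have 1: "cayley w - cayley z = 2 * \<i> * (w - z) / ((w + \<i>) * (z + \<i>))"
    using ne unfolding cayley_def by (simp add: diff_frac_eq) (simp add: algebra_simps)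
  have 2: "1 - cnj (cayley z) * cayley w = - (2 * \<i> * (w - cnj z)) / ((cnj z - \<i>) * (w + \<i>))"
  proof -
    have "cnj (cayley z) = (cnj z + \<i>) / (cnj z - \<i>)" by (simp add: cayley_def)
    moreover have "1 - a / b * (c / e) = (b * e - a * c) / (b * e)" if "b \<noteq> 0" "e \<noteq> 0" for a b c e :: complex
      using that by (simp add: field_simps)
    moreover have "(cnj z - \<i>) * (w + \<i>) - (cnj z + \<i>) * (w - \<i>) = - (2 * \<i> * (w - cnj z))"
      by (simp add: algebra_simps)
    ultimately show ?thesis using ne unfolding cayley_def[of w] by simp
  qed
  have "cmod (cnj z - \<i>) = cmod (z + \<i>)" using complex_mod_cnj[of "z + \<i>"] by simp
  then show ?thesis
    unfolding 1 2 using ne by (simp add: norm_divide norm_mult)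
qed

text \<open>With E = exp d, the squared distances from w to z and to \<open>cnj z\<close> are 2 cosh
  d * y * y' minus and plus 2 y y', that is, y y' / E times (E - 1)^2 and (E + 1)^2. Their ratio is
  the square of tanh (d / 2).\<close>

lemma hyp_dist_cayley:
  assumes y: "0 < y" and y': "0 < y'" and d: "0 < d"
    and eq: "(x' - x)\<^sup>2 + y\<^sup>2 + y'\<^sup>2 = 2 * cosh d * y * y'"
  shows "hyp_dist (cayley (Complex x y)) (cayley (Complex x' y')) = d"
proof -
  define t where "t = cmod (Complex x' y' - Complex x y) / cmod (Complex x' y' - cnj (Complex x y))"
  define E where "E = exp d"
  have E: "1 < E" using d by (simp add: E_def)
  have c: "2 * cosh d = E + 1 / E" by (simp add: cosh_def E_def exp_minus field_simps)
  have ring: "(E + 1 / E) * y * y' - 2 * y * y' = (E - 1)\<^sup>2 * (y * y' / E)"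
    "(E + 1 / E) * y * y' + 2 * y * y' = (E + 1)\<^sup>2 * (y * y' / E)"
    using E by (simp_all add: power2_diff power2_sum distrib_left distrib_right left_diff_distrib diff_divide_distrib add_divide_distrib power2_eq_square)
  have num: "(cmod (Complex x' y' - Complex x y))\<^sup>2 = (E - 1)\<^sup>2 * (y * y' / E)"
  proof -
    have "(cmod (Complex x' y' - Complex x y))\<^sup>2 = (x' - x)\<^sup>2 + (y' - y)\<^sup>2" by (simp add: cmod_power2)
    also have "\<dots> = ((x' - x)\<^sup>2 + y\<^sup>2 + y'\<^sup>2) - 2 * y * y'" by (simp add: power2_eq_square algebra_simps)
    also have "\<dots> = (E - 1)\<^sup>2 * (y * y' / E)" unfolding eq c by (rule ring)
    finally show ?thesis .
  qed
  have den: "(cmod (Complex x' y' - cnj (Complex x y)))\<^sup>2 = (E + 1)\<^sup>2 * (y * y' / E)"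
  proof -
    have "(cmod (Complex x' y' - cnj (Complex x y)))\<^sup>2 = (x' - x)\<^sup>2 + (y' + y)\<^sup>2" by (simp add: cmod_power2)
    also have "\<dots> = ((x' - x)\<^sup>2 + y\<^sup>2 + y'\<^sup>2) + 2 * y * y'" by (simp add: power2_eq_square algebra_simps)
    also have "\<dots> = (E + 1)\<^sup>2 * (y * y' / E)" unfolding eq c by (rule ring)
    finally show ?thesis .
  qed
  have "t\<^sup>2 = ((E - 1)\<^sup>2 * (y * y' / E)) / ((E + 1)\<^sup>2 * (y * y' / E))"
    unfolding t_def power_divide num den ..
  also have "\<dots> = (E - 1)\<^sup>2 / (E + 1)\<^sup>2"
    by (rule mult_divide_mult_cancel_right) (use E y y' in simp)
  finally have "t\<^sup>2 = ((E - 1) / (E + 1))\<^sup>2" by (simp only: power_divide)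
  then have t: "t = (E - 1) / (E + 1)"
  proof (rule power2_eq_imp_eq)
    show "0 \<le> t" unfolding t_def by (intro divide_nonneg_nonneg norm_ge_zero)
    show "0 \<le> (E - 1) / (E + 1)" using E by simp
  qed
  have "1 + t = 2 * E / (E + 1)" "1 - t = 2 / (E + 1)" using E by (simp_all add: t add_divide_distrib[symmetric] diff_divide_eq_iff add_divide_eq_iff)
  then have "(1 + t) / (1 - t) = E" using E by simp
  then have "ln ((1 + t) / (1 - t)) = d" by (simp add: E_def)
  then show ?thesis
    unfolding hyp_dist_def Let_def using norm_cayley_quotient[of "Complex x y" "Complex x' y'"] y y' by (simp add: t_def)
qed

text \<open>The set lies in the image of N under the inverse Cayley map followed by rescaling the
  height. The only pole of that map is 1, so it is differentiable on the open disk and sends null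
  sets to null sets.\<close>

lemma negligible_cayley_preimage:
  assumes N: "negligible N" "N \<subseteq> hyp_plane" and c: "0 < c"
  shows "negligible {p :: real \<times> real. 0 < fst p \<and> cayley (Complex (snd p) (c * fst p)) \<in> N}"
proof -
  define \<psi> :: "complex \<Rightarrow> complex" where "\<psi> w = \<i> * (1 + w) / (1 - w)" for w
  define h :: "complex \<Rightarrow> real \<times> real" where "h w = (Im (\<psi> w) * inverse c, Re (\<psi> w))" for w
  have "h differentiable_on N"
    unfolding differentiable_on_def
  proof
    fix w assume "w \<in> N"
    then have "cmod w < 1" using N by (auto simp: hyp_plane_def)
    then have "1 - w \<noteq> 0" by auto
    then have "\<psi> field_differentiable (at w)"
      unfolding \<psi>_def by (intro derivative_intros) auto
    then obtain \<psi>' where d: "(\<psi> has_derivative \<psi>') (at w)"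
      by (auto simp: field_differentiable_def has_field_derivative_def)
    have "(h has_derivative (\<lambda>v. (Im (\<psi>' v) * inverse c, Re (\<psi>' v)))) (at w)"
      unfolding h_def by (intro has_derivative_Pair has_derivative_mult_left has_derivative_Im[OF d] has_derivative_Re[OF d])
    then show "h differentiable at w within N"
      using differentiable_at_withinI differentiableI by blast
  qed
  then have "negligible (h ` N)"
    by (rule negligible_differentiable_image_negligible[rotated 2]) (use N in auto)
  moreover have "{p :: real \<times> real. 0 < fst p \<and> cayley (Complex (snd p) (c * fst p)) \<in> N} \<subseteq> h ` N"
  proof clarify
    fix u x :: real assume u: "0 < fst (u, x)" and n: "cayley (Complex (snd (u, x)) (c * fst (u, x))) \<in> N"
    have "\<psi> (cayley (Complex x (c * u))) = Complex x (c * u)"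
      unfolding \<psi>_def by (rule cayley_inverse) (use u c in simp)
    then have "h (cayley (Complex x (c * u))) = (u, x)" using c by (simp add: h_def)
    then show "(u, x) \<in> h ` N" using n by (metis image_eqI fst_conv snd_conv)
  qed
  ultimately show ?thesis by (rule negligible_subset)
qed

lemma borel_measurable_cayley:
  assumes "B \<in> sets borel"
  shows "(\<lambda>p. indicator B (cayley (Complex (snd p) (c * fst p))) :: real) \<in> borel_measurable (borel :: (real \<times> real) measure)"
proof -
  have e: "Complex a b = of_real a + \<i> * of_real b" for a b by (rule Complex_eq)
  have [measurable]: "fst \<in> borel \<rightarrow>\<^sub>M (borel :: real measure)" "snd \<in> borel \<rightarrow>\<^sub>M (borel :: real measure)"
    by (auto intro!: borel_measurable_continuous_onI continuous_intros)
  have "(\<lambda>p :: real \<times> real. cayley (Complex (snd p) (c * fst p))) \<in> borel \<rightarrow>\<^sub>M borel"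
    unfolding cayley_def e by measurable
  from measurable_compose[OF this borel_measurable_indicator[OF assms]] show ?thesis .
qed

theorem theorem1:
  "\<exists>d0::real. d0 > 0 \<and>
     (\<forall>d::real. d \<ge> d0 \<longrightarrow>
       (\<forall>(k::nat) (C :: nat \<Rightarrow> complex set).
          k \<ge> 1 \<and>
          (\<forall>i\<in>{1..k}. C i \<in> sets hyp_area) \<and>
          hyp_plane = (\<Union>i\<in>{1..k}. C i) \<and>
          (\<forall>i\<in>{1..k}. \<not> (\<exists>x\<in>C i. \<exists>y\<in>C i. hyp_dist x y = d))
          \<longrightarrow> k \<ge> 6))"
proof -
  obtain q :: nat where q: "0 < q"
    and pair: "\<And>\<kappa> k f. 100 * real q ^ 300 \<le> \<kappa> \<Longrightarrow> 1 \<le> k \<Longrightarrow> k \<le> 5 \<Longrightarrow> band_coloring k f \<Longrightarrow> monochromatic_pair q \<kappa> k f"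
    using band_coloring_monochromatic_pair by blast
  \<comment> \<open>The bound for \<kappa> carries over to d itself, as 2 cosh d \<ge> exp d >
    d.\<close>
  define d0 where "d0 = 100 * real q ^ 300"
  have d0: "0 < d0" using q by (simp add: d0_def)
  show ?thesis
  proof (intro exI[of _ d0] conjI allI impI d0, elim conjE, rule ccontr)
    fix d :: real and k :: nat and C :: "nat \<Rightarrow> complex set"
    assume d: "d0 \<le> d" and k: "1 \<le> k" and meas: "\<forall>i\<in>{1..k}. C i \<in> sets hyp_area"
      and cover: "hyp_plane = (\<Union>i\<in>{1..k}. C i)"
      and free: "\<forall>i\<in>{1..k}. \<not> (\<exists>x\<in>C i. \<exists>y\<in>C i. hyp_dist x y = d)" and "\<not> 6 \<le> k"
    then have k5: "k \<le> 5" by simp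
    have \<kappa>: "100 * real q ^ 300 \<le> 2 * cosh d"
    proof -
      have "1 + d \<le> exp d" by (rule exp_ge_add_one_self)
      moreover have "exp d \<le> 2 * cosh d" by (simp add: cosh_def)
      ultimately show ?thesis using d unfolding d0_def by linarith
    qed
    \<comment> \<open>Passing to Borel subsets makes the pullbacks to strip coordinates Borel
      functions. Subsets still avoid the distance d, and what they fail to cover is null.\<close>
    have "\<exists>B N. B \<in> sets borel \<and> negligible N \<and> B \<union> N = C i" if "i \<in> {1..k}" for i
      using sets_lebesgue_almost_borel meas that by (metis sets_hyp_area)
    then obtain B0 N where B0: "\<And>i. i \<in> {1..k} \<Longrightarrow> B0 i \<in> sets borel" "\<And>i. i \<in> {1..k} \<Longrightarrow> negligible (N i)"
      "\<And>i. i \<in> {1..k} \<Longrightarrow> B0 i \<union> N i = C i" by metis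
    \<comment> \<open>Each point goes to its first colour, which makes the colours disjoint; the
      other indices get the empty set since \<open>band_coloring\<close> speaks of all i and
      j.\<close>
    define B where "B i = (if i \<in> {1..k} then B0 i - (\<Union>j\<in>{1..<i}. B0 j) else {})" for i
    have B: "B i \<in> sets borel" for i
      using B0(1) by (auto simp: B_def intro!: sets.Diff sets.finite_UN)
    have Bdisj: "disjoint_family_on B UNIV"
      unfolding disjoint_family_on_def B_def
      by (intro ballI impI, rename_tac i j, case_tac "i < j") (auto simp: not_less)
    have BU: "(\<Union>i\<in>{1..k}. B i) = (\<Union>i\<in>{1..k}. B0 i)"
    proof (intro equalityI subsetI)
      fix z assume "z \<in> (\<Union>i\<in>{1..k}. B0 i)"
      then obtain i where "i \<in> {1..k} \<and> z \<in> B0 i" by blast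
      then obtain i where i: "i \<in> {1..k} \<and> z \<in> B0 i" "\<And>j. j < i \<Longrightarrow> \<not> (j \<in> {1..k} \<and> z \<in> B0 j)"
        using exists_least_iff[of "\<lambda>i. i \<in> {1..k} \<and> z \<in> B0 i"] by blast
      then have "z \<in> B i" by (auto simp: B_def)
      then show "z \<in> (\<Union>i\<in>{1..k}. B i)" using i by blast
    qed (auto simp: B_def split: if_splits)
    define \<Phi> where "\<Phi> a p = cayley (Complex (snd p) (real q ^ (2 * a) * fst p))" for a :: nat and p :: "real \<times> real"
    define f where "f i a p = (indicator (B i) (\<Phi> a p) :: real)" for i a p
    have sum_f: "(\<Sum>i\<in>{1..k}. f i a p) = indicator (\<Union>i\<in>{1..k}. B i) (\<Phi> a p)" for a p
      unfolding f_def
      by (rule indicator_UN_disjoint[symmetric]) (use Bdisj in \<open>auto simp: disjoint_family_on_def\<close>)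
    have "band_coloring k f"
      unfolding band_coloring_def
    proof (intro conjI)
      show "\<forall>i a. f i a \<in> borel_measurable borel"
        unfolding f_def \<Phi>_def using borel_measurable_cayley[OF B] by simp
      show "\<forall>i a p. f i a p \<in> {0, 1}" by (simp add: f_def indicator_def)
      show "\<forall>i j a p. i \<noteq> j \<longrightarrow> f i a p * f j a p = 0"
        using Bdisj by (auto simp: f_def disjoint_family_on_def indicator_def)
      show "\<forall>a p. (\<Sum>i\<in>{1..k}. f i a p) \<le> 1" unfolding sum_f by (simp add: indicator_def)
      show "\<forall>a. AE p in lborel. fst p \<in> {1..2} \<longrightarrow> (\<Sum>i\<in>{1..k}. f i a p) = 1"
      proof
        fix a
        define Z where "Z = (\<Union>i\<in>{1..k}. N i)"
        have "negligible Z" unfolding Z_def using B0(2) by (intro negligible_Union) auto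
        moreover have "Z \<subseteq> hyp_plane" unfolding Z_def cover using B0(3) by blast
        moreover have "0 < real q ^ (2 * a)" using q by simp
        ultimately have "negligible {p :: real \<times> real. 0 < fst p \<and> \<Phi> a p \<in> Z}"
          unfolding \<Phi>_def by (rule negligible_cayley_preimage)
        moreover have "{p. \<not> (fst p \<in> {1..2} \<longrightarrow> (\<Sum>i\<in>{1..k}. f i a p) = 1)} \<subseteq> {p. 0 < fst p \<and> \<Phi> a p \<in> Z}"
        proof
          fix p assume "p \<in> {p. \<not> (fst p \<in> {1..2} \<longrightarrow> (\<Sum>i\<in>{1..k}. f i a p) = 1)}"
          then have u: "fst p \<in> {1..2}" and s: "(\<Sum>i\<in>{1..k}. f i a p) \<noteq> 1" by blast+
          have "\<Phi> a p \<in> hyp_plane"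
            unfolding \<Phi>_def by (rule cayley_in_hyp_plane) (use u q in simp)
          moreover have "\<Phi> a p \<notin> (\<Union>i\<in>{1..k}. B0 i)"
            using s unfolding sum_f BU by (auto simp: indicator_def split: if_splits)
          ultimately have "\<Phi> a p \<in> Z" unfolding cover Z_def using B0(3) by blast
          then show "p \<in> {p. 0 < fst p \<and> \<Phi> a p \<in> Z}" using u by simp
        qed
        ultimately have "AE p in lebesgue. fst p \<in> {1..2} \<longrightarrow> (\<Sum>i\<in>{1..k}. f i a p) = 1"
          unfolding eventually_ae_filter_negligible by blast
        then show "AE p in lborel. fst p \<in> {1..2} \<longrightarrow> (\<Sum>i\<in>{1..k}. f i a p) = 1"
          by (simp only: AE_completion_iff)
      qed
    qed
    from pair[OF \<kappa> k k5 this] obtain i a b u v x x' where i: "i \<in> {1..k}" and u: "u \<in> {1..2}" and v: "v \<in> {1..2}"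
      and eq: "(x' - x)\<^sup>2 + (real q ^ (2 * a) * u)\<^sup>2 + (real q ^ (2 * b) * v)\<^sup>2 = 2 * cosh d * (real q ^ (2 * a) * u) * (real q ^ (2 * b) * v)"
      and ne: "f i a (u, x) * f i b (v, x') \<noteq> 0"
      unfolding monochromatic_pair_def by blast
    have "hyp_dist (\<Phi> a (u, x)) (\<Phi> b (v, x')) = d"
      unfolding \<Phi>_def fst_conv snd_conv
      by (rule hyp_dist_cayley[OF _ _ _ eq]) (use u v q d d0 in auto)
    moreover have "\<Phi> a (u, x) \<in> B i" "\<Phi> b (v, x') \<in> B i"
      using ne by (auto simp: f_def indicator_def split: if_splits)
    moreover have "B i \<subseteq> C i" using B0(3)[OF i] i by (auto simp: B_def)
    ultimately show False using free i by blast
  qed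
qed

end
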